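(* Let $g=2k+1$ with $k\ge 3$ an integer, and let $\mathcal{G}$ be the property that a graph contains a spanning maximal planar subgraph of girth $g$. Then the threshold for $G_{(g-2)n+2,\,p}\in\mathcal{G}$ is contained in the interval $\left(\left(\frac{c_1}{n}\right)^{(g-2)/g},\ \frac{c_2(\log n)^{1/k}}{n^{(g-4)/(g-2)}}\right)$ for some constants $c_1,c_2>0$. That is, there are constants $c_1,c_2>0$ such that if $p\le (c_1/n)^{(g-2)/g}$ then $\Pr[G_{(g-2)n+2,p}\in\mathcal{G}]\to 0$ as $n\to\infty$, and if $p\ge c_2(\log n)^{1/k}n^{-(g-4)/(g-2)}$ then $\Pr[G_{(g-2)n+2,p}\in\mathcal{G}]\to 1$ as $n\to\infty$.
   Context: $G_{N,p}$ is the Erdős–Rényi random graph on $N$ vertices, each edge present independently with probability $p$; here $N=(g-2)n+2$ with $n$ the asymptotic parameter. A subgraph is spanning if it contains all vertices. A planar graph of girth $g$ on $N$ vertices has at most $\frac{g}{g-2}(N-2)$ edges; it is called a maximal planar graph of girth $g$ when it has girth $g$ and exactly $\frac{g}{g-2}(N-2)$ edges (for odd $g$ this requires $N\equiv 2 \pmod{g-2}$). A threshold for a property $\mathcal{G}$ is a function $f(n)$ such that $p=o(f(n))$ implies non-membership with probability tending to $1$ and $f(n)=o(p)$ implies membership with probability tending to $1$. *)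

theory Defs
  imports "HOL-Analysis.Analysis"
begin

definition all_edges :: "nat \<Rightarrow> nat set set" where
  "all_edges N = {{u, w} | u w. u < N \<and> w < N \<and> u \<noteq> w}"

definition Gnp_prob :: "nat \<Rightarrow> real \<Rightarrow> (nat set set \<Rightarrow> bool) \<Rightarrow> real" where
  "Gnp_prob N p P = (\<Sum>E\<in>{E. E \<subseteq> all_edges N \<and> P E}.
      p ^ card E * (1 - p) ^ (card (all_edges N) - card E))"

definition planar :: "nat \<Rightarrow> nat set set \<Rightarrow> bool" where
  "planar N E \<longleftrightarrow> (\<exists>(pos :: nat \<Rightarrow> complex) (\<gamma> :: nat set \<Rightarrow> real \<Rightarrow> complex).
      inj_on pos {..<N} \<and>
      (\<forall>e\<in>E. \<exists>u w. e = {u, w} \<and> arc (\<gamma> e) \<and> pathstart (\<gamma> e) = pos u \<and> pathfinish (\<gamma> e) = pos w) \<and>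
      (\<forall>e\<in>E. \<forall>x<N. pos x \<in> path_image (\<gamma> e) \<longrightarrow> x \<in> e) \<and>
      (\<forall>e\<in>E. \<forall>e'\<in>E. e \<noteq> e' \<longrightarrow> path_image (\<gamma> e) \<inter> path_image (\<gamma> e') \<subseteq> pos ` (e \<inter> e')))"

definition has_cycle_of_length :: "nat set set \<Rightarrow> nat \<Rightarrow> bool" where
  "has_cycle_of_length E L \<longleftrightarrow> L \<ge> 3 \<and> (\<exists>vs. length vs = L \<and> distinct vs \<and>
      (\<forall>i<L. {vs ! i, vs ! ((i + 1) mod L)} \<in> E))"

definition has_girth :: "nat set set \<Rightarrow> nat \<Rightarrow> bool" where
  "has_girth E g \<longleftrightarrow> has_cycle_of_length E g \<and> (\<forall>L<g. \<not> has_cycle_of_length E L)"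

definition maximal_planar_girth :: "nat \<Rightarrow> nat \<Rightarrow> nat set set \<Rightarrow> bool" where
  "maximal_planar_girth g N H \<longleftrightarrow> planar N H \<and> has_girth H g \<and>
      real (card H) * (real g - 2) = real g * (real N - 2)"

text \<open>The property: contains a spanning maximal planar subgraph of girth g
  (spanning is automatic since the vertex set is {0..<N}).\<close>
definition has_spanning_mpg :: "nat \<Rightarrow> nat \<Rightarrow> nat set set \<Rightarrow> bool" where
  "has_spanning_mpg g N E \<longleftrightarrow> (\<exists>H \<subseteq> E. maximal_planar_girth g N H)"

end

theory Submission
  imports Defs
begin

text \<open>
  Below the threshold, union bound.  A maximal planar graph of girth \<open>g\<close> has \<open>g * n\<close> edges, and there
  are at most \<open>C ^ N * fact N\<close> planar graphs on \<open>N\<close> vertices, because they form a proper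
  minor-closed class: a plane drawing yields nonseparating continua that intersect like the edges of
  a graph, and Janiszewski's theorems exclude \<open>K\<^sub>3\<^sub>,\<^sub>3\<close> there.  In such a class a positive proportion of
  the vertices have a twin or, like one of their neighbours, bounded degree; deleting or contracting
  them gives a recursion for the number of graphs (Norine, Seymour, Thomas and Wollan).

  Above the threshold it suffices to find one suitable graph.  It is obtained from a cycle of length
  \<open>2 * k + 1\<close> by repeatedly dividing a face into three faces of the same length, the last vertices
  added being always the ones used next, so that all degrees are bounded.  Every set of \<open>m\<close> edges of
  this graph contains a forest with at least \<open>(1 - 1 / k) * m\<close> edges.  Hence the set of its copies is
  spread with parameter of order \<open>N powr ((k - 1) / k)\<close>, and the hypothesis on \<open>p\<close> exceeds the inverse of
  this by a power of \<open>n\<close>.  Exposing the random graph in a bounded number of rounds, each of which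
  shrinks the missing part of most copies by a factor that is a power of \<open>n\<close>, one therefore finds a copy.
\<close>

section \<open>Planar graphs have no minor \<open>K\<^sub>3\<^sub>,\<^sub>3\<close>\<close>

text \<open>The definition of planarity offers arcs only, no faces and no Euler formula. What the
  count draws from the plane is one excluded complete minor: it bounds the edges, hence also the
  cliques, linearly in the vertices, and these two bounds drive the recursion. The lower exponent is
  a balance: up to constants there are \<open>n powr ((g - 2) * n)\<close> candidates, each present
  with probability \<open>p ^ (g * n)\<close>, so \<open>p ^ g\<close> is compared with
  \<open>n powr - (g - 2)\<close>. For the upper bound, an edge of a forest costs a random copy a
  factor of order \<open>\<Delta> / N\<close>, which is why degrees must be bounded, and only forest
  edges can be charged, which is why every edge set must contain a large forest. The resulting
  exponent \<open>(k - 1) / k\<close> exceeds \<open>(2 * k - 3) / (2 * k - 1)\<close> by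
  \<open>1 / (k * (2 * k - 1))\<close>. This gap fixes the number of rounds. Girth is handled
  without distances or faces: integer potentials that change by at most one along edges show that a
  new edge closes no short cycle.\<close>

lemma separating_cells_coincide:
  fixes A1 A2 B1 B2 B3 D :: "complex set"
  assumes cl: "closed A1" "closed A2" "closed B1" "closed B2" "closed B3"
    and B13: "B1 \<inter> B3 = {}"
    and ns: "connected (- (A1 \<union> A2 \<union> B2))"
    and p: "p \<in> D" and D: "D \<inter> (A1 \<union> A2 \<union> B1 \<union> B2 \<union> B3) = {}"
    and G1: "connected (D \<union> (B1 - (A1 \<union> A2)))" and G3: "connected (D \<union> (B3 - (A1 \<union> A2)))"
    and B23: "B1 \<inter> B2 = {}" "B2 \<inter> B3 = {}"
    and q: "q \<notin> A1 \<union> A2 \<union> B1 \<union> B2 \<union> B3"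
    and n3: "\<not> connected_component (- (A1 \<union> A2 \<union> B1 \<union> B2)) p q"
    and n1: "\<not> connected_component (- (A1 \<union> A2 \<union> B2 \<union> B3)) p q"
  shows False
proof -
  define C3 C1 where "C3 = A1 \<union> A2 \<union> B1 \<union> B2" and "C1 = A1 \<union> A2 \<union> B2 \<union> B3"
  define K3 K1 where "K3 = connected_component_set (- C3) q" and "K1 = connected_component_set (- C1) q"
  \<comment> \<open>\<open>D\<close> with the remainder of \<open>B\<close> is a connected set
    through \<open>p\<close> that avoids \<open>C\<close>, so a component without \<open>p\<close>
    cannot reach \<open>B\<close>. Hence \<open>K3\<close> misses \<open>B3\<close> and
    \<open>K1\<close> misses \<open>B1\<close>, which makes the two components equal.\<close>
  have miss: "connected_component_set (- C) q \<inter> B = {}"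
    if C: "\<not> connected_component (- C) p q" and G: "connected (D \<union> (B - (A1 \<union> A2)))"
      and sub: "D \<union> (B - (A1 \<union> A2)) \<subseteq> - C" "A1 \<union> A2 \<subseteq> C" for C B
  proof (rule ccontr)
    assume "connected_component_set (- C) q \<inter> B \<noteq> {}"
    then obtain z where z: "connected_component (- C) q z" "z \<in> B" by auto
    then have "z \<in> - C" using connected_component_in by blast
    then have "z \<in> B - (A1 \<union> A2)" using z sub by auto
    then have "connected_component (- C) p z"
      using G sub p connected_component_def by (metis Un_iff)
    then show False using z C connected_component_sym connected_component_trans by metis
  qed
  have "K3 \<inter> B3 = {}" unfolding K3_def C3_def
    by (rule miss) (use n3 G3 D B13 B23 in auto)
  moreover have "K3 \<subseteq> - C3" unfolding K3_def by (rule connected_component_subset)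
  ultimately have s3: "K3 \<subseteq> - C1" unfolding C3_def C1_def by auto
  have "K1 \<inter> B1 = {}" unfolding K1_def C1_def
    by (rule miss) (use n1 G1 D B13 B23 in auto)
  moreover have "K1 \<subseteq> - C1" unfolding K1_def by (rule connected_component_subset)
  ultimately have s1: "K1 \<subseteq> - C3" unfolding C3_def C1_def by auto
  have q3: "q \<in> K3" and q1: "q \<in> K1" unfolding K1_def K3_def
    using q by (auto simp: C1_def C3_def intro!: connected_component_refl)
  have "K3 \<subseteq> K1" unfolding K1_def
    by (rule connected_component_maximal) (use q3 s3 in \<open>auto simp: K3_def\<close>)
  moreover have "K1 \<subseteq> K3" unfolding K3_def
    by (rule connected_component_maximal) (use q1 s1 in \<open>auto simp: K1_def\<close>)
  ultimately have K: "K1 = K3" by auto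
  have clC: "closed C3" "closed C1" using cl by (auto simp: C1_def C3_def)
  have "frontier K3 \<subseteq> C3" unfolding K3_def
    using frontier_of_connected_component_subset[of "- C3" q] clC(1)
    by (metis frontier_complement frontier_subset_eq order_trans)
  moreover have "frontier K1 \<subseteq> C1" unfolding K1_def
    using frontier_of_connected_component_subset[of "- C1" q] clC(2)
    by (metis frontier_complement frontier_subset_eq order_trans)
  \<comment> \<open>The common component has its frontier in both \<open>C3\<close> and
    \<open>C1\<close>, where \<open>B1\<close> and \<open>B3\<close> drop out. But the complement of
    \<open>A1 \<union> A2 \<union> B2\<close> is connected and contains \<open>q\<close> inside and
    \<open>p\<close> outside of \<open>K3\<close>.\<close>
  ultimately have fr: "frontier K3 \<subseteq> A1 \<union> A2 \<union> B2" using K B13 unfolding C1_def C3_def by auto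
  have "p \<notin> K3" using n3 unfolding K3_def C3_def by (auto dest: connected_component_sym)
  then have "- (A1 \<union> A2 \<union> B2) \<inter> frontier K3 \<noteq> {}"
    by (intro connected_Int_frontier[OF ns]) (use q q3 p D in auto)
  with fr show False by auto
qed

text \<open>\<open>D\<close> stands for the third vertex on the side of the \<open>A\<close>s,
  stripped of its contact points. The ring \<open>A1 \<union> A2 \<union> B1 \<union> B2\<close>
  separates \<open>p\<close> in \<open>D\<close> from some \<open>q\<close>. By
  \<open>separating_cells_coincide\<close> the two rings through \<open>B3\<close> do not separate
  them, and these rings meet in the connected set \<open>A1 \<union> A2 \<union> B3\<close>. By
  Janiszewski's theorem their union does not separate \<open>p\<close> from \<open>q\<close> either,
  although it contains the first ring.\<close>

lemma no_plane_K33: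
  fixes A1 A2 B1 B2 B3 D :: "complex set"
  assumes cp: "compact A1" "compact A2" "compact B1" "compact B2" "compact B3"
    and cn: "connected A1" "connected A2" "connected B1" "connected B2" "connected B3"
    and ns: "connected (- A1)" "connected (- A2)" "connected (- B1)" "connected (- B2)"
    and dA: "A1 \<inter> A2 = {}" and dB: "B1 \<inter> B2 = {}" "B1 \<inter> B3 = {}" "B2 \<inter> B3 = {}"
    and m: "A1 \<inter> B1 = {m11}" "A1 \<inter> B2 = {m12}" "A1 \<inter> B3 = {m13}"
           "A2 \<inter> B1 = {m21}" "A2 \<inter> B2 = {m22}" "A2 \<inter> B3 = {m23}"
    and D: "D \<noteq> {}" "D \<inter> (A1 \<union> A2 \<union> B1 \<union> B2 \<union> B3) = {}"
    and G: "\<And>B. B \<in> {B1, B2, B3} \<Longrightarrow> connected (D \<union> (B - (A1 \<union> A2)))"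
  shows False
proof -
  obtain p where p: "p \<in> D" using D by auto
  note cl = cp[THEN compact_imp_closed]
  have s: "m12 \<noteq> m22" using m dA by auto
  have conA: "connected (A1 \<union> A2 \<union> B)" if "connected B" "A1 \<inter> B = {x}" "A2 \<inter> B = {y}" for B x y
  proof -
    have "connected (A1 \<union> B)" using that cn by (intro connected_Un) auto
    then have "connected (A2 \<union> (A1 \<union> B))" by (rule connected_Un[OF cn(2)]) (use that in auto)
    then show ?thesis by (simp add: Un_ac)
  qed
  have nsA: "connected (- (A1 \<union> A2 \<union> B))"
    if "compact B" "connected (- B)" "A1 \<inter> B = {x}" "A2 \<inter> B = {y}" for B x y
  proof -
    have "connected (- (A1 \<union> B))"
      by (rule Janiszewski_connected) (use that cp ns compact_imp_closed[OF that(1)] in auto)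
    moreover have "A2 \<inter> (A1 \<union> B) = {y}" using that dA by auto
    ultimately have "connected (- (A2 \<union> (A1 \<union> B)))"
      by (intro Janiszewski_connected) (use that cp cl ns compact_imp_closed[OF that(1)] in \<open>auto simp del: Compl_Un\<close>)
    then show ?thesis by (simp add: Un_ac)
  qed
  \<comment> \<open>The ring closes up: two connected sets that meet in exactly the two points
    \<open>m12\<close> and \<open>m22\<close>.\<close>
  have "\<not> connected (- ((A1 \<union> A2 \<union> B1) \<union> B2))"
  proof
    assume "connected (- ((A1 \<union> A2 \<union> B1) \<union> B2))"
    then have "connected ((A1 \<union> A2 \<union> B1) \<inter> B2)"
      by (intro Janiszewski_dual) (use cp cn conA m in auto)
    moreover have "(A1 \<union> A2 \<union> B1) \<inter> B2 = {m12, m22}" using m dB by auto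
    ultimately show False using s connected_finite_iff_sing[of "{m12, m22}"] by auto
  qed
  then obtain q where q: "q \<notin> A1 \<union> A2 \<union> B1 \<union> B2"
    "\<not> connected_component (- (A1 \<union> A2 \<union> B1 \<union> B2)) p q"
    using connected_iff_connected_component_eq p D
    by (smt (verit, best) Compl_iff connected_component_eq connected_component_sym mem_Collect_eq
        connected_component_trans connected_iff_connected_component)
  have q3: "q \<notin> B3"
  proof
    assume "q \<in> B3"
    then have "q \<in> D \<union> (B3 - (A1 \<union> A2))" using q by auto
    moreover have "D \<union> (B3 - (A1 \<union> A2)) \<subseteq> - (A1 \<union> A2 \<union> B1 \<union> B2)" using D dB by auto
    ultimately have "connected_component (- (A1 \<union> A2 \<union> B1 \<union> B2)) p q"
      using G[of B3] p unfolding connected_component_def by blast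
    with q show False by auto
  qed
  have dB': "B2 \<inter> B1 = {}" using dB by auto
  have sw: "A1 \<union> A2 \<union> B2 \<union> B1 = A1 \<union> A2 \<union> B1 \<union> B2" by auto
  have "connected_component (- (A1 \<union> A2 \<union> B2 \<union> B3)) p q"
    using separating_cells_coincide[of A1 A2 B1 B2 B3 p D q] cl dB nsA[OF cp(4) ns(4) m(2) m(5)]
      p D G q q3 by auto
  moreover have "connected_component (- (A1 \<union> A2 \<union> B1 \<union> B3)) p q"
    using separating_cells_coincide[of A1 A2 B2 B1 B3 p D q] cl dB nsA[OF cp(3) ns(3) m(1) m(4)]
      p D G q q3 dB' sw by auto
  moreover have "(A1 \<union> A2 \<union> B2 \<union> B3) \<inter> (A1 \<union> A2 \<union> B1 \<union> B3) = A1 \<union> A2 \<union> B3" using dB by auto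
  ultimately have "connected_component (- ((A1 \<union> A2 \<union> B2 \<union> B3) \<union> (A1 \<union> A2 \<union> B1 \<union> B3))) p q"
    using conA[OF cn(5) m(3) m(6)] cp cl
      Janiszewski[of "A1 \<union> A2 \<union> B2 \<union> B3" "A1 \<union> A2 \<union> B1 \<union> B3" p q] by (simp add: closed_Un compact_Un del: Compl_Un)
  then have "connected_component (- (A1 \<union> A2 \<union> B1 \<union> B2)) p q"
    by (rule connected_component_of_subset) auto
  with q show False by auto
qed

lemma arc_halves:
  fixes g :: "real \<Rightarrow> complex"
  assumes g: "arc g"
  defines "m \<equiv> g (1/2)" and "h0 \<equiv> g ` {0..1/2}" and "h1 \<equiv> g ` {1/2..1}"
  shows "compact h0" "connected h0" "connected (- h0)" "connected (h0 - {m})"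
    "compact h1" "connected h1" "connected (- h1)" "connected (h1 - {m})"
    "h0 \<inter> h1 = {m}" "h0 \<union> h1 = path_image g" "m \<noteq> pathstart g" "m \<noteq> pathfinish g"
    "pathstart g \<in> h0" "pathfinish g \<in> h1" "pathfinish g \<notin> h0" "pathstart g \<notin> h1"
proof -
  have inj: "inj_on g {0..1}" and cont: "continuous_on {0..1} g"
    using g by (auto simp: arc_def path_def)
  have e0: "h0 = path_image (subpath 0 (1/2) g)" and e1: "h1 = path_image (subpath (1/2) 1 g)"
    by (simp_all add: path_image_subpath h0_def h1_def)
  have a0: "arc (subpath 0 (1/2) g)" and a1: "arc (subpath (1/2) 1 g)"
    using g by (auto intro!: arc_subpath_arc)
  show "compact h0" "connected h0" "compact h1" "connected h1" unfolding e0 e1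
    using a0 a1 by (auto intro: compact_arc_image connected_arc_image)
  show "connected (- h0)" "connected (- h1)" unfolding e0 e1
    using a0 a1 by (auto intro!: connected_arc_complement)
  have inj': "g x = g y \<longleftrightarrow> x = y" if "x \<in> {0..1}" "y \<in> {0..1}" for x y
    using inj that by (auto simp: inj_on_def)
  have D: "h0 - {m} = g ` ({0..1/2} - {1/2})" "h1 - {m} = g ` ({1/2..1} - {1/2})"
    unfolding h0_def h1_def m_def
    using inj_on_image_set_diff[OF inj, of "{0..1/2}" "{1/2}"] inj_on_image_set_diff[OF inj, of "{1/2..1}" "{1/2}"]
    by (auto simp: inj')
  have "{0..1/2} - {1/2} = {0..<1/2::real}" "{1/2..1} - {1/2} = {1/2<..1::real}" by auto
  then show "connected (h0 - {m})" "connected (h1 - {m})" unfolding D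
    by (auto intro!: connected_continuous_image[OF continuous_on_subset[OF cont]])
  have "g ` ({0..1/2} \<inter> {1/2..1}) = h0 \<inter> h1" unfolding h0_def h1_def
    by (rule inj_on_image_Int[OF inj]) auto
  moreover have "{0..1/2} \<inter> {1/2..1} = {1/2::real}" by auto
  ultimately show "h0 \<inter> h1 = {m}" by (simp add: m_def)
  have "{0..1/2} \<union> {1/2..1} = {0..1::real}" by auto
  then show "h0 \<union> h1 = path_image g"
    unfolding h0_def h1_def path_image_def by (metis image_Un)
  show "m \<noteq> pathstart g" "m \<noteq> pathfinish g"
    unfolding m_def pathstart_def pathfinish_def by (simp_all add: inj')
  show "pathstart g \<in> h0" "pathfinish g \<in> h1"
    unfolding h0_def h1_def pathstart_def pathfinish_def by auto
  show "pathfinish g \<notin> h0" "pathstart g \<notin> h1"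
    unfolding h0_def h1_def pathstart_def pathfinish_def by (auto simp: inj')
qed

text \<open>Vertices are continua rather than points so that the class is closed under contraction:
  the merged vertex is the union of two old ones and an arc. Their complements are connected because
  Janiszewski's theorems are applied to sets that do not separate the plane. Edges at a common
  vertex may share an endpoint, so arcs may meet inside the vertex sets.\<close>

definition plane_model :: "nat set \<Rightarrow> nat set set \<Rightarrow> bool" where
  "plane_model V E \<longleftrightarrow> (\<exists>(T :: nat \<Rightarrow> complex set) (\<gamma> :: nat set \<Rightarrow> real \<Rightarrow> complex).
     (\<forall>v\<in>V. compact (T v) \<and> connected (T v) \<and> connected (- T v) \<and> T v \<noteq> {}) \<and>
     (\<forall>u\<in>V. \<forall>v\<in>V. u \<noteq> v \<longrightarrow> T u \<inter> T v = {}) \<and>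
     (\<forall>e\<in>E. \<exists>u\<in>V. \<exists>w\<in>V. u \<noteq> w \<and> e = {u, w} \<and> arc (\<gamma> e) \<and>
        path_image (\<gamma> e) \<inter> T u = {pathstart (\<gamma> e)} \<and> path_image (\<gamma> e) \<inter> T w = {pathfinish (\<gamma> e)}) \<and>
     (\<forall>e\<in>E. \<forall>x\<in>V. x \<notin> e \<longrightarrow> path_image (\<gamma> e) \<inter> T x = {}) \<and>
     (\<forall>e\<in>E. \<forall>e'\<in>E. e \<noteq> e' \<longrightarrow> path_image (\<gamma> e) \<inter> path_image (\<gamma> e') \<subseteq> \<Union> (T ` V)))"

text \<open>Cutting every edge at an interior point \<open>m e\<close> turns the model into a touching family of
  nonseparating continua.\<close>

lemma plane_model_stars:
  assumes "plane_model V E" and "finite E"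
  obtains S :: "nat \<Rightarrow> complex set" and m :: "nat set \<Rightarrow> complex" where
    "\<And>x. x \<in> V \<Longrightarrow> compact (S x) \<and> connected (S x) \<and> connected (- S x)"
    "\<And>x y. x \<in> V \<Longrightarrow> y \<in> V \<Longrightarrow> x \<noteq> y \<Longrightarrow> S x \<inter> S y = (if {x, y} \<in> E then {m {x, y}} else {})"
    "\<And>x Z. x \<in> V \<Longrightarrow> Z \<subseteq> E \<Longrightarrow> connected (S x - m ` Z) \<and> S x - m ` Z \<noteq> {}"
    "inj_on m E"
proof -
  from assms(1)[unfolded plane_model_def] obtain T :: "nat \<Rightarrow> complex set"
    and \<gamma> :: "nat set \<Rightarrow> real \<Rightarrow> complex" where
    T: "\<And>v. v \<in> V \<Longrightarrow> compact (T v) \<and> connected (T v) \<and> connected (- T v) \<and> T v \<noteq> {}"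
    and TT: "\<And>u v. u \<in> V \<Longrightarrow> v \<in> V \<Longrightarrow> u \<noteq> v \<Longrightarrow> T u \<inter> T v = {}"
    and \<gamma>: "\<And>e. e \<in> E \<Longrightarrow> \<exists>u\<in>V. \<exists>w\<in>V. u \<noteq> w \<and> e = {u, w} \<and> arc (\<gamma> e) \<and>
        path_image (\<gamma> e) \<inter> T u = {pathstart (\<gamma> e)} \<and> path_image (\<gamma> e) \<inter> T w = {pathfinish (\<gamma> e)}"
    and \<gamma>T: "\<And>e x. e \<in> E \<Longrightarrow> x \<in> V \<Longrightarrow> x \<notin> e \<Longrightarrow> path_image (\<gamma> e) \<inter> T x = {}"
    and \<gamma>\<gamma>: "\<And>e e'. e \<in> E \<Longrightarrow> e' \<in> E \<Longrightarrow> e \<noteq> e' \<Longrightarrow> path_image (\<gamma> e) \<inter> path_image (\<gamma> e') \<subseteq> \<Union> (T ` V)"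
    apply (elim exE conjE)
    subgoal premises prems for T \<gamma>
      by (rule prems(1)[OF prems(2)[rule_format] prems(3)[rule_format] prems(4)[rule_format]
            prems(5)[rule_format] prems(6)[rule_format]])
    done
  define ok where "ok e x m H \<longleftrightarrow> compact H \<and> connected H \<and> connected (- H) \<and>
         connected (H - {m}) \<and> H \<subseteq> path_image (\<gamma> e) \<and> m \<in> H \<and>
         (\<exists>s. H \<inter> T x = {s}) \<and> (\<forall>y\<in>V. y \<noteq> x \<longrightarrow> H \<inter> T y = {})" for e x m H
  have "\<forall>e\<in>E. \<exists>m h. e \<subseteq> V \<and> m \<notin> \<Union> (T ` V) \<and> (\<forall>x\<in>e. ok e x m (h x)) \<and>
      (\<forall>x\<in>e. \<forall>y\<in>e. x \<noteq> y \<longrightarrow> h x \<inter> h y = {m})"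
  proof
    fix e assume e: "e \<in> E"
    obtain u w where uw: "u \<in> V" "w \<in> V" "u \<noteq> w" "e = {u, w}" and a: "arc (\<gamma> e)"
        "path_image (\<gamma> e) \<inter> T u = {pathstart (\<gamma> e)}" "path_image (\<gamma> e) \<inter> T w = {pathfinish (\<gamma> e)}"
      using \<gamma>[OF e] by blast
    define m h0 h1 where "m = \<gamma> e (1/2)" and "h0 = \<gamma> e ` {0..1/2}" and "h1 = \<gamma> e ` {1/2..1}"
    note h = arc_halves[OF a(1), folded m_def h0_def h1_def]
    have mT: "m \<notin> \<Union> (T ` V)"
    proof
      assume "m \<in> \<Union> (T ` V)"
      then obtain y where y: "y \<in> V" "m \<in> T y" by auto
      have mi: "m \<in> path_image (\<gamma> e)" using h by blast
      then have "y \<in> {u, w}" using \<gamma>T[OF e] y uw by blast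
      then have "m \<in> {pathstart (\<gamma> e), pathfinish (\<gamma> e)}" using y a(2,3) mi by blast
      then show False using h(11,12) by blast
    qed
    have hsub: "h0 \<subseteq> path_image (\<gamma> e)" "h1 \<subseteq> path_image (\<gamma> e)" using h(10) by auto
    have other: "h0 \<inter> T y = {}" "h1 \<inter> T y = {}" if "y \<in> V" "y \<noteq> u" "y \<noteq> w" for y
      using \<gamma>T[OF e, of y] that uw hsub by auto
    have i: "h0 \<inter> T u = {pathstart (\<gamma> e)}" "h0 \<inter> T w = {}" "h1 \<inter> T w = {pathfinish (\<gamma> e)}" "h1 \<inter> T u = {}"
    proof -
      have "h0 \<inter> T w \<subseteq> {pathfinish (\<gamma> e)}" "h1 \<inter> T u \<subseteq> {pathstart (\<gamma> e)}"
        "h0 \<inter> T u \<subseteq> {pathstart (\<gamma> e)}" "h1 \<inter> T w \<subseteq> {pathfinish (\<gamma> e)}"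
        using a(2,3) hsub by auto
      then show "h0 \<inter> T u = {pathstart (\<gamma> e)}" "h0 \<inter> T w = {}" "h1 \<inter> T w = {pathfinish (\<gamma> e)}" "h1 \<inter> T u = {}"
        using h(13-16) a(2,3) by auto
    qed
    have "\<forall>y\<in>V. y \<noteq> u \<longrightarrow> h0 \<inter> T y = {}" "\<forall>y\<in>V. y \<noteq> w \<longrightarrow> h1 \<inter> T y = {}"
      using i(2,4) other by metis+
    moreover have "m \<in> h0" "m \<in> h1" using h(9) by auto
    ultimately have "ok e u m h0" "ok e w m h1" unfolding ok_def using h(1-8) hsub i(1,3) by simp_all
    moreover have "h0 \<inter> h1 = {m}" "h1 \<inter> h0 = {m}" using h(9) by auto
    ultimately have "e \<subseteq> V \<and> m \<notin> \<Union> (T ` V) \<and> (\<forall>x\<in>e. ok e x m (if x = u then h0 else h1)) \<and>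
      (\<forall>x\<in>e. \<forall>y\<in>e. x \<noteq> y \<longrightarrow> (if x = u then h0 else h1) \<inter> (if y = u then h0 else h1) = {m})"
      using mT uw by simp
    then show "\<exists>m h. e \<subseteq> V \<and> m \<notin> \<Union> (T ` V) \<and> (\<forall>x\<in>e. ok e x m (h x)) \<and>
      (\<forall>x\<in>e. \<forall>y\<in>e. x \<noteq> y \<longrightarrow> h x \<inter> h y = {m})" by (intro exI[of _ m] exI[of _ "\<lambda>x. if x = u then h0 else h1"])
  qed
  then obtain m h where mh: "\<forall>e\<in>E. e \<subseteq> V \<and> m e \<notin> \<Union> (T ` V) \<and> (\<forall>x\<in>e. ok e x (m e) (h e x)) \<and>
      (\<forall>x\<in>e. \<forall>y\<in>e. x \<noteq> y \<longrightarrow> h e x \<inter> h e y = {m e})"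
    by (metis (no_types, lifting))
  have eV: "\<And>e. e \<in> E \<Longrightarrow> e \<subseteq> V" and mT: "\<And>e. e \<in> E \<Longrightarrow> m e \<notin> \<Union> (T ` V)"
    and okx: "\<And>e x. e \<in> E \<Longrightarrow> x \<in> e \<Longrightarrow> ok e x (m e) (h e x)"
    using mh by simp_all
  have hm: "h e x \<inter> h e y = {m e}" if "e \<in> E" "x \<in> e" "y \<in> e" "x \<noteq> y" for e x y
    using mh that by simp
  have h: "compact (h e x) \<and> connected (h e x) \<and> connected (- h e x) \<and>
         connected (h e x - {m e}) \<and> h e x \<subseteq> path_image (\<gamma> e) \<and> m e \<in> h e x \<and>
         (\<exists>s. h e x \<inter> T x = {s})" if "e \<in> E" "x \<in> e" for e x
    using okx[OF that] unfolding ok_def by simp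
  have hT: "h e x \<inter> T y = {}" if "e \<in> E" "x \<in> e" "y \<in> V" "y \<noteq> x" for e x y
    using okx[OF that(1,2)] that(3,4) unfolding ok_def by simp
  have hh: "h e x \<inter> h e' y \<subseteq> T x \<inter> T y" if "e \<in> E" "e' \<in> E" "x \<in> e" "y \<in> e'" "e \<noteq> e'" for e e' x y
  proof
    fix z assume z: "z \<in> h e x \<inter> h e' y"
    then have "z \<in> \<Union> (T ` V)" using \<gamma>\<gamma>[OF that(1,2,5)] h that by blast
    then obtain v where v: "v \<in> V" "z \<in> T v" by auto
    then have "v = x" "v = y" using hT that z by blast+
    then show "z \<in> T x \<inter> T y" using v by auto
  qed
  have mh': "m e \<notin> h e' x" if A: "e \<in> E" "e' \<in> E" "x \<in> e'" "e \<noteq> e'" for e e' x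
  proof
    assume a: "m e \<in> h e' x"
    obtain y where y: "y \<in> e" using \<gamma>[OF A(1)] by auto
    then have "m e \<in> h e y" using h A by blast
    then have "m e \<in> T x" using hh[OF A(1,2) y A(3,4)] a by auto
    then show False using mT[OF A(1)] eV[OF A(2)] A by auto
  qed
  define St where "St x F = T x \<union> (\<Union>e\<in>F. h e x)" for x and F :: "nat set set"
  define I where "I x = {e\<in>E. x \<in> e}" for x
  define S where "S x = St x (I x)" for x
  have finI: "finite (I x)" for x using assms(2) by (auto simp: I_def)
  \<comment> \<open>Two half-edges at \<open>x\<close> meet only inside \<open>T x\<close>, so each
    new one meets the star built so far in its foot alone, and Janiszewski's theorem keeps the
    complement connected.\<close>
  have St: "compact (St x F) \<and> connected (- St x F)" if "finite F" "F \<subseteq> I x" "x \<in> V" for x F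
    using that
  proof (induction F)
    case empty then show ?case using T by (auto simp: St_def)
  next
    case (insert e F)
    have e: "e \<in> E" "x \<in> e" using insert by (auto simp: I_def)
    obtain s where s: "h e x \<inter> T x = {s}" using h e by blast
    have "h e x \<inter> h e' x \<subseteq> T x" if "e' \<in> F" for e'
      using hh[of e e' x x] e that insert by (auto simp: I_def)
    then have "St x F \<inter> h e x = {s}" using s unfolding St_def by blast
    then have "connected (St x F \<inter> h e x)" by simp
    moreover have "St x (insert e F) = St x F \<union> h e x" unfolding St_def by auto
    moreover have "compact (St x F)" "connected (- St x F)" using insert by auto
    ultimately show ?case
      using h[OF e] Janiszewski_connected[of "St x F" "h e x"] compact_imp_closed[of "h e x"]
      by (simp add: compact_Un del: Compl_Un)
  qed
  have con: "connected (S x - m ` Z)" "S x - m ` Z \<noteq> {}" if x: "x \<in> V" and Z: "Z \<subseteq> E" for x Z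
  proof -
    define k where "k e = T x \<union> (h e x - m ` Z)" for e
    have Tm: "T x \<inter> m ` Z = {}" using mT Z x by auto
    have S: "S x - m ` Z = \<Union> (insert (T x) (k ` I x))" unfolding S_def St_def k_def using Tm by auto
    obtain t where t: "t \<in> T x" using T x by blast
    have ke: "connected (k e)" if "e \<in> I x" for e
    proof -
      have e: "e \<in> E" "x \<in> e" using that by (auto simp: I_def)
      have "m e' \<notin> h e x" if "e' \<in> Z" "e' \<noteq> e" for e'
        using mh'[of e' e x] e Z that by auto
      then have "h e x - m ` Z = (if e \<in> Z then h e x - {m e} else h e x)"
        by (auto simp: image_iff)
      then have "connected (h e x - m ` Z)" using h[OF e] by (auto split: if_splits)
      moreover have "T x \<inter> (h e x - m ` Z) \<noteq> {}" using h[OF e] Tm by blast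
      ultimately show ?thesis unfolding k_def using T[OF x] by (intro connected_Un) auto
    qed
    show "connected (S x - m ` Z)" unfolding S
      by (rule connected_Union) (use T[OF x] ke t in \<open>auto simp: k_def\<close>)
    show "S x - m ` Z \<noteq> {}" unfolding S using t by auto
  qed
  show ?thesis
  proof (rule that[of S m])
    fix x assume "x \<in> V"
    then show "compact (S x) \<and> connected (S x) \<and> connected (- S x)"
      using St[of "I x" x] finI con(1)[of x "{}"] by (auto simp: S_def)
  next
    fix x y assume xy: "x \<in> V" "y \<in> V" "x \<noteq> y"
    have "z \<in> S x \<inter> S y \<longleftrightarrow> {x, y} \<in> E \<and> z = m {x, y}" for z
    proof
      assume "z \<in> S x \<inter> S y"
      then have zx: "z \<in> T x \<or> (\<exists>e\<in>I x. z \<in> h e x)" and zy: "z \<in> T y \<or> (\<exists>e\<in>I y. z \<in> h e y)"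
        by (auto simp: S_def St_def)
      have "z \<notin> T x" using zy TT[of x y] hT[of _ y x] xy by (auto simp: I_def)
      moreover have "z \<notin> T y" using zx TT[of x y] hT[of _ x y] xy by (auto simp: I_def)
      ultimately obtain e e' where e: "e \<in> E" "e' \<in> E" "x \<in> e" "y \<in> e'" "z \<in> h e x" "z \<in> h e' y"
        using zx zy by (auto simp: I_def)
      then have "e = e'" using hh[of e e' x y] TT[of x y] xy by blast
      then have "e = {x, y}" using \<gamma>[OF e(1)] e xy by blast
      then show "{x, y} \<in> E \<and> z = m {x, y}" using hm[of e x y] e xy \<open>e = e'\<close> by auto
    next
      assume "{x, y} \<in> E \<and> z = m {x, y}"
      then show "z \<in> S x \<inter> S y" using h[of "{x,y}"] by (auto simp: S_def St_def I_def)
    qed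
    then show "S x \<inter> S y = (if {x, y} \<in> E then {m {x, y}} else {})" by auto
  next
    fix x Z assume "x \<in> V" "Z \<subseteq> E"
    then show "connected (S x - m ` Z) \<and> S x - m ` Z \<noteq> {}" using con by auto
  next
    show "inj_on m E"
    proof (rule inj_onI, rule ccontr)
      fix e e' assume e: "e \<in> E" "e' \<in> E" "m e = m e'" "e \<noteq> e'"
      obtain y where y: "y \<in> e'" using \<gamma>[OF e(2)] by auto
      then show False using mh'[OF e(1,2) y e(4)] h[OF e(2) y] e by auto
    qed
  qed
qed

lemma plane_model_no_K33:
  assumes P: "plane_model V E" and d: "distinct [a1, a2, a3, b1, b2, b3]"
    and V: "set [a1, a2, a3, b1, b2, b3] \<subseteq> V"
    and E: "E = (\<lambda>(a, b). {a, b}) ` ({a1, a2, a3} \<times> {b1, b2, b3})"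
  shows False
proof -
  have fin: "finite E" unfolding E by auto
  obtain S :: "nat \<Rightarrow> complex set" and m :: "nat set \<Rightarrow> complex" where
    S: "\<And>x. x \<in> V \<Longrightarrow> compact (S x) \<and> connected (S x) \<and> connected (- S x)"
    and SS: "\<And>x y. x \<in> V \<Longrightarrow> y \<in> V \<Longrightarrow> x \<noteq> y \<Longrightarrow> S x \<inter> S y = (if {x, y} \<in> E then {m {x, y}} else {})"
    and SZ: "\<And>x Z. x \<in> V \<Longrightarrow> Z \<subseteq> E \<Longrightarrow> connected (S x - m ` Z) \<and> S x - m ` Z \<noteq> {}"
    and inj: "inj_on m E"
    apply (rule plane_model_stars[OF P fin])
    subgoal premises prems for S m by (rule prems(1)[OF prems(2-5)])
    done
  have inE: "{a, b} \<in> E" if "a \<in> {a1, a2, a3}" "b \<in> {b1, b2, b3}" for a b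
    unfolding E by (rule image_eqI[of _ _ "(a, b)"], simp, intro SigmaI that)
  have ab: "S a \<inter> S b = {m {a, b}}" if "a \<in> {a1, a2, a3}" "b \<in> {b1, b2, b3}" for a b
  proof -
    have "a \<in> V" "b \<in> V" "a \<noteq> b" using that d V by auto
    then show ?thesis using SS[of a b] inE[OF that] by simp
  qed
  have aa: "S a \<inter> S b = {}" if "{a, b} \<subseteq> {a1, a2, a3} \<or> {a, b} \<subseteq> {b1, b2, b3}" "a \<noteq> b" for a b
  proof -
    have "{a1, a2, a3} \<inter> {b1, b2, b3} = {}" using d by auto
    moreover have "\<exists>x\<in>{a1, a2, a3}. \<exists>y\<in>{b1, b2, b3}. {a, b} = {x, y}" if "{a, b} \<in> E"
    proof -
      have "\<exists>z\<in>{a1, a2, a3} \<times> {b1, b2, b3}. {a, b} = (\<lambda>(a, b). {a, b}) z"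
        using that unfolding E image_iff .
      then show ?thesis by (metis (no_types, lifting) SigmaE case_prod_conv)
    qed
    ultimately have "{a, b} \<notin> E" using that(1) by blast
    moreover have "a \<in> V" "b \<in> V" using that V by auto
    ultimately show ?thesis using SS[of a b] that(2) by simp
  qed
  \<comment> \<open>Without its cut points the star of \<open>a3\<close> is disjoint from the other
    five stars, as \<open>no_plane_K33\<close> demands of \<open>D\<close>.\<close>
  define D where "D = S a3 - m ` E"
  have Va: "a1 \<in> V" "a2 \<in> V" "a3 \<in> V" "b1 \<in> V" "b2 \<in> V" "b3 \<in> V" using V by auto
  have "D \<inter> S b = {}" if "b \<in> {b1, b2, b3}" for b
    using ab[of a3 b] that inE[of a3 b] unfolding D_def by auto
  moreover have "D \<inter> S a1 = {}" "D \<inter> S a2 = {}" using aa[of a3 a1] aa[of a3 a2] d unfolding D_def by auto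
  ultimately have D0: "D \<inter> (S a1 \<union> S a2 \<union> S b1 \<union> S b2 \<union> S b3) = {}" by auto
  have G: "connected (D \<union> (S b - (S a1 \<union> S a2)))" if b: "b \<in> {b1, b2, b3}" for b
  proof -
    let ?e = "{a3, b}"
    have ne: "?e \<noteq> {a1, b}" "?e \<noteq> {a2, b}" using d by (auto simp: doubleton_eq_iff)
    have e: "?e \<in> E" "{a1, b} \<in> E" "{a2, b} \<in> E" using inE b by auto
    have m3: "m ?e \<in> S a3 \<inter> S b" using ab[of a3 b] b by auto
    have m12: "S a1 \<inter> S b = {m {a1, b}}" "S a2 \<inter> S b = {m {a2, b}}" using ab b by auto
    have "m ?e \<notin> m ` (E - {?e})" using inj e by (auto simp: inj_on_def)
    moreover have "m ?e \<notin> m ` {{a1, b}, {a2, b}}" using inj e ne by (auto simp: inj_on_def)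
    \<comment> \<open>Only the cut point of \<open>?e\<close> is put back into \<open>D\<close>. It
      glues the two pieces, and as it lies in \<open>S b\<close> anyway the union does not
      change.\<close>
    ultimately have i: "m ?e \<in> (S a3 - m ` (E - {?e})) \<inter> (S b - m ` {{a1, b}, {a2, b}})" using m3 by auto
    then have "connected ((S a3 - m ` (E - {?e})) \<union> (S b - m ` {{a1, b}, {a2, b}}))"
      using SZ[of a3 "E - {?e}"] SZ[of b "{{a1, b}, {a2, b}}"] e Va b
      by (intro connected_Un) auto
    moreover have "(S a3 - m ` (E - {?e})) \<union> (S b - m ` {{a1, b}, {a2, b}}) = D \<union> (S b - (S a1 \<union> S a2))"
      using m12 i e unfolding D_def by auto
    ultimately show ?thesis by simp
  qed
  show False
    by (rule no_plane_K33[of "S a1" "S a2" "S b1" "S b2" "S b3" "m {a1,b1}" "m {a1,b2}" "m {a1,b3}"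
          "m {a2,b1}" "m {a2,b2}" "m {a2,b3}" D])
      (use S Va aa ab d D0 G SZ[of a3 E] in \<open>auto simp: D_def\<close>)
qed

lemma planar_imp_plane_model:
  assumes "planar N E" and "E \<subseteq> all_edges N"
  shows "plane_model {..<N} E"
proof -
  from assms(1)[unfolded planar_def] obtain pos :: "nat \<Rightarrow> complex" and \<gamma> :: "nat set \<Rightarrow> real \<Rightarrow> complex" where
    inj: "inj_on pos {..<N}" and
    \<gamma>: "\<forall>e\<in>E. \<exists>u w. e = {u, w} \<and> arc (\<gamma> e) \<and> pathstart (\<gamma> e) = pos u \<and> pathfinish (\<gamma> e) = pos w" and
    mem: "\<forall>e\<in>E. \<forall>x<N. pos x \<in> path_image (\<gamma> e) \<longrightarrow> x \<in> e" and
    cross: "\<forall>e\<in>E. \<forall>e'\<in>E. e \<noteq> e' \<longrightarrow> path_image (\<gamma> e) \<inter> path_image (\<gamma> e') \<subseteq> pos ` (e \<inter> e')"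
    by (elim exE conjE)
  have eN: "e \<subseteq> {..<N}" if "e \<in> E" for e using assms(2) that by (auto simp: all_edges_def)
  have "\<exists>u\<in>{..<N}. \<exists>w\<in>{..<N}. u \<noteq> w \<and> e = {u, w} \<and> arc (\<gamma> e) \<and>
      path_image (\<gamma> e) \<inter> {pos u} = {pathstart (\<gamma> e)} \<and> path_image (\<gamma> e) \<inter> {pos w} = {pathfinish (\<gamma> e)}"
    if e: "e \<in> E" for e
  proof -
    obtain u w where uw: "e = {u, w}" "arc (\<gamma> e)" "pathstart (\<gamma> e) = pos u" "pathfinish (\<gamma> e) = pos w"
      using \<gamma> e by blast
    have "u \<noteq> w" using uw by (auto dest: arc_distinct_ends)
    moreover have "pos u \<in> path_image (\<gamma> e)" "pos w \<in> path_image (\<gamma> e)"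
      using uw by (metis pathstart_in_path_image pathfinish_in_path_image)+
    moreover have "u < N" "w < N" using eN[OF e] uw(1) by auto
    ultimately show ?thesis using uw by (intro bexI[of _ u] bexI[of _ w]) simp_all
  qed
  moreover have "path_image (\<gamma> e) \<inter> {pos x} = {}" if "e \<in> E" "x < N" "x \<notin> e" for e x
  proof -
    have "pos x \<notin> path_image (\<gamma> e)" using mem[rule_format, OF that(1,2)] that(3) by metis
    then show ?thesis by simp
  qed
  moreover have "path_image (\<gamma> e) \<inter> path_image (\<gamma> e') \<subseteq> (\<Union>x<N. {pos x})"
    if "e \<in> E" "e' \<in> E" "e \<noteq> e'" for e e'
    using cross[rule_format, OF that] eN[OF that(1)] by fastforce
  moreover have "connected (- {z})" for z :: complex
    by (rule connected_punctured_universe) simp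
  ultimately show ?thesis unfolding plane_model_def
    using inj by (intro exI[of _ "\<lambda>x. {pos x}"] exI[of _ \<gamma>] conjI) (simp_all add: inj_on_eq_iff)
qed

section \<open>Closure of plane models under minors\<close>

lemma plane_model_mono:
  assumes "plane_model V E" and V: "V' \<subseteq> V" and E: "E' \<subseteq> E" "\<And>e. e \<in> E' \<Longrightarrow> e \<subseteq> V'"
  shows "plane_model V' E'"
proof -
  from assms(1)[unfolded plane_model_def] obtain T :: "nat \<Rightarrow> complex set"
    and \<gamma> :: "nat set \<Rightarrow> real \<Rightarrow> complex" where
    T: "\<forall>v\<in>V. compact (T v) \<and> connected (T v) \<and> connected (- T v) \<and> T v \<noteq> {}" and
    TT: "\<forall>u\<in>V. \<forall>v\<in>V. u \<noteq> v \<longrightarrow> T u \<inter> T v = {}" and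
    \<gamma>: "\<forall>e\<in>E. \<exists>u\<in>V. \<exists>w\<in>V. u \<noteq> w \<and> e = {u, w} \<and> arc (\<gamma> e) \<and>
        path_image (\<gamma> e) \<inter> T u = {pathstart (\<gamma> e)} \<and> path_image (\<gamma> e) \<inter> T w = {pathfinish (\<gamma> e)}" and
    \<gamma>T: "\<forall>e\<in>E. \<forall>x\<in>V. x \<notin> e \<longrightarrow> path_image (\<gamma> e) \<inter> T x = {}" and
    \<gamma>\<gamma>: "\<forall>e\<in>E. \<forall>e'\<in>E. e \<noteq> e' \<longrightarrow> path_image (\<gamma> e) \<inter> path_image (\<gamma> e') \<subseteq> \<Union> (T ` V)"
    by (elim exE conjE)
  have 1: "\<exists>u\<in>V'. \<exists>w\<in>V'. u \<noteq> w \<and> e = {u, w} \<and> arc (\<gamma> e) \<and>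
        path_image (\<gamma> e) \<inter> T u = {pathstart (\<gamma> e)} \<and> path_image (\<gamma> e) \<inter> T w = {pathfinish (\<gamma> e)}"
    if e: "e \<in> E'" for e
  proof -
    obtain u w where "u \<noteq> w \<and> e = {u, w} \<and> arc (\<gamma> e) \<and>
        path_image (\<gamma> e) \<inter> T u = {pathstart (\<gamma> e)} \<and> path_image (\<gamma> e) \<inter> T w = {pathfinish (\<gamma> e)}"
      using \<gamma> subsetD[OF E(1) e] by blast
    then show ?thesis using E(2)[OF e] by auto
  qed
  have 2: "path_image (\<gamma> e) \<inter> path_image (\<gamma> e') \<subseteq> \<Union> (T ` V')"
    if e: "e \<in> E'" "e' \<in> E'" "e \<noteq> e'" for e e'
  proof
    fix z assume z: "z \<in> path_image (\<gamma> e) \<inter> path_image (\<gamma> e')"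
    then have "z \<in> \<Union> (T ` V)" using \<gamma>\<gamma> subsetD[OF E(1) e(1)] subsetD[OF E(1) e(2)] e(3) by blast
    then obtain x where x: "x \<in> V" "z \<in> T x" by auto
    then have "x \<in> e" using \<gamma>T subsetD[OF E(1) e(1)] z by blast
    then show "z \<in> \<Union> (T ` V')" using x E(2)[OF e(1)] by auto
  qed
  show ?thesis unfolding plane_model_def
  proof (intro exI[of _ T] exI[of _ \<gamma>] conjI)
    show "\<forall>v\<in>V'. compact (T v) \<and> connected (T v) \<and> connected (- T v) \<and> T v \<noteq> {}"
      "\<forall>u\<in>V'. \<forall>v\<in>V'. u \<noteq> v \<longrightarrow> T u \<inter> T v = {}"
      using T TT V by auto
    show "\<forall>e\<in>E'. \<forall>x\<in>V'. x \<notin> e \<longrightarrow> path_image (\<gamma> e) \<inter> T x = {}"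
      using \<gamma>T V E(1) by (meson subsetD)
  qed (use 1 2 in blast)+
qed

definition contract :: "nat \<Rightarrow> nat \<Rightarrow> nat set set \<Rightarrow> nat set set" where
  "contract u v E = {e \<in> E. v \<notin> e} \<union> {{u, w} | w. {v, w} \<in> E \<and> w \<noteq> u}"

lemma plane_model_contract:
  assumes "plane_model V E" and c: "{u, v} \<in> E" and uv: "u \<noteq> v"
  shows "plane_model (V - {v}) (contract u v E)"
proof -
  from assms(1)[unfolded plane_model_def] obtain T :: "nat \<Rightarrow> complex set"
    and \<gamma> :: "nat set \<Rightarrow> real \<Rightarrow> complex" where
    T: "\<forall>v\<in>V. compact (T v) \<and> connected (T v) \<and> connected (- T v) \<and> T v \<noteq> {}" and
    TT: "\<forall>u\<in>V. \<forall>v\<in>V. u \<noteq> v \<longrightarrow> T u \<inter> T v = {}" and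
    \<gamma>: "\<forall>e\<in>E. \<exists>u\<in>V. \<exists>w\<in>V. u \<noteq> w \<and> e = {u, w} \<and> arc (\<gamma> e) \<and>
        path_image (\<gamma> e) \<inter> T u = {pathstart (\<gamma> e)} \<and> path_image (\<gamma> e) \<inter> T w = {pathfinish (\<gamma> e)}" and
    \<gamma>T: "\<forall>e\<in>E. \<forall>x\<in>V. x \<notin> e \<longrightarrow> path_image (\<gamma> e) \<inter> T x = {}" and
    \<gamma>\<gamma>: "\<forall>e\<in>E. \<forall>e'\<in>E. e \<noteq> e' \<longrightarrow> path_image (\<gamma> e) \<inter> path_image (\<gamma> e') \<subseteq> \<Union> (T ` V)"
    by (elim exE conjE)
  define C where "C = T u \<union> path_image (\<gamma> {u, v}) \<union> T v"
  obtain a b where ab: "a \<in> V" "b \<in> V" "a \<noteq> b" "{u, v} = {a, b}" "arc (\<gamma> {u, v})"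
    "path_image (\<gamma> {u, v}) \<inter> T a = {pathstart (\<gamma> {u, v})}"
    "path_image (\<gamma> {u, v}) \<inter> T b = {pathfinish (\<gamma> {u, v})}"
    using \<gamma> c by blast
  have uvV: "u \<in> V" "v \<in> V" using ab by (auto simp: doubleton_eq_iff)
  let ?A = "path_image (\<gamma> {u, v})"
  have C': "C = T a \<union> ?A \<union> T b" using ab(4) unfolding C_def by (auto simp: doubleton_eq_iff)
  have A: "compact ?A" "connected ?A" "connected (- ?A)"
    using ab(5) by (auto simp: compact_arc_image connected_arc_image intro!: connected_arc_complement)
  have i1: "T a \<inter> ?A = {pathstart (\<gamma> {u, v})}" using ab(6) by (simp add: Int_commute)
  have i2: "(T a \<union> ?A) \<inter> T b = {pathfinish (\<gamma> {u, v})}"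
    using ab(7) TT[rule_format, OF ab(1-3)] by (simp add: Int_Un_distrib2)
  have Ta: "compact (T a)" "connected (T a)" "connected (- T a)" "T a \<noteq> {}"
    and Tb: "compact (T b)" "connected (T b)" "connected (- T b)" using T[rule_format, OF ab(1)] T[rule_format, OF ab(2)] by simp_all
  have "connected (T a \<union> ?A)" using Ta A i1 by (intro connected_Un) auto
  then have "connected C" unfolding C'
    by (rule connected_Un) (use Tb i2 in simp_all)
  moreover have "compact C" unfolding C' using Ta Tb A by (intro compact_Un)
  moreover have "connected (- (T a \<union> ?A))"
    using Janiszewski_connected[of "T a" ?A] Ta A i1 by (simp add: compact_imp_closed del: Compl_Un)
  then have "connected (- C)"
    using Janiszewski_connected[of "T a \<union> ?A" "T b"] Ta Tb A i2 unfolding C'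
    by (simp add: compact_imp_closed compact_Un del: Compl_Un)
  moreover have "C \<noteq> {}" using Ta unfolding C' by auto
  ultimately have C: "compact C \<and> connected C \<and> connected (- C) \<and> C \<noteq> {}" by auto
  have AT: "?A \<inter> T x = {}" if "x \<in> V" "x \<noteq> u" "x \<noteq> v" for x 
    using \<gamma>T[rule_format, OF c that(1)] that(2,3) by simp
  have CT: "C \<inter> T x = {}" if "x \<in> V" "x \<noteq> u" "x \<noteq> v" for x
    using AT[OF that] TT[rule_format, OF uvV(1) that(1)] TT[rule_format, OF uvV(2) that(1)] that(2,3)
    unfolding C_def by (simp add: Int_Un_distrib2)
  \<comment> \<open>Edges from \<open>u\<close> and from \<open>v\<close> to the same
    \<open>w\<close> become one. \<open>\<phi>\<close> selects the old arc that draws a new edge: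
    the edge itself if it is an old one, otherwise the edge from \<open>v\<close>.\<close>
  define \<phi> where "\<phi> e = (if e \<in> E \<and> v \<notin> e then e else insert v (e - {u}))" for e
  define T' where "T' x = (if x = u then C else T x)" for x
  have \<phi>: "\<phi> e \<in> E" "\<phi> e \<noteq> {u, v}" "e = (if v \<in> \<phi> e then insert u (\<phi> e - {v}) else \<phi> e)"
    if ee: "e \<in> contract u v E" for e
  proof -
    have "\<phi> e \<in> E \<and> \<phi> e \<noteq> {u, v} \<and> e = (if v \<in> \<phi> e then insert u (\<phi> e - {v}) else \<phi> e)"
    proof (cases "e \<in> E \<and> v \<notin> e")
      case True then show ?thesis by (auto simp: \<phi>_def)
    next
      case False
      then obtain w where w: "e = {u, w}" "{v, w} \<in> E" "w \<noteq> u" using ee by (auto simp: contract_def)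
      have "v \<noteq> w" using \<gamma>[rule_format, OF w(2)] by (elim bexE conjE) (auto simp: doubleton_eq_iff)
      then have "\<phi> e = {v, w}" using False w uv by (auto simp: \<phi>_def)
      then show ?thesis using w uv \<open>v \<noteq> w\<close> by (auto simp: doubleton_eq_iff)
    qed
    then show "\<phi> e \<in> E" "\<phi> e \<noteq> {u, v}" "e = (if v \<in> \<phi> e then insert u (\<phi> e - {v}) else \<phi> e)" by auto
  qed
  \<comment> \<open>Arcs meet only in vertex sets, and the contracted arc meets no vertex sets but
    those of \<open>u\<close> and \<open>v\<close>. So passing from \<open>T u \<union> T v\<close>
    to \<open>C\<close> creates no new contact with another arc.\<close>
  have PC: "path_image (\<gamma> f) \<inter> C = path_image (\<gamma> f) \<inter> (T u \<union> T v)" if "f \<in> E" "f \<noteq> {u, v}" for f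
  proof -
    have "path_image (\<gamma> f) \<inter> ?A \<subseteq> \<Union> (T ` V)" using \<gamma>\<gamma>[rule_format, OF that(1) c that(2)] .
    then have "path_image (\<gamma> f) \<inter> ?A \<subseteq> T u \<union> T v" using AT by blast
    then show ?thesis unfolding C_def by auto
  qed
  have ends: "path_image (\<gamma> f) \<inter> T' (if a = v then u else a) = path_image (\<gamma> f) \<inter> T a"
    if f: "f \<in> E" "f \<noteq> {u, v}" "f = {a, b}" "a \<noteq> b" "a \<in> V" for f a b
  proof (cases "a \<in> {u, v}")
    case True
    then obtain d where d: "{u, v} = {a, d}" "d \<in> V" "d \<noteq> a" using uvV uv by auto
    then have "d \<notin> f" using f by auto
    then have "path_image (\<gamma> f) \<inter> T d = {}" using \<gamma>T[rule_format, OF f(1) d(2)] by simp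
    moreover have "T u \<union> T v = T a \<union> T d" using d(1) by (auto simp: doubleton_eq_iff)
    ultimately have "path_image (\<gamma> f) \<inter> (T u \<union> T v) = path_image (\<gamma> f) \<inter> T a"
      by (simp add: Int_Un_distrib)
    then show ?thesis using True PC[OF f(1,2)] by (auto simp: T'_def)
  next
    case False then show ?thesis by (simp add: T'_def)
  qed
  have 1: "\<exists>x\<in>V - {v}. \<exists>y\<in>V - {v}. x \<noteq> y \<and> e = {x, y} \<and> arc (\<gamma> (\<phi> e)) \<and>
        path_image (\<gamma> (\<phi> e)) \<inter> T' x = {pathstart (\<gamma> (\<phi> e))} \<and>
        path_image (\<gamma> (\<phi> e)) \<inter> T' y = {pathfinish (\<gamma> (\<phi> e))}"
    if e: "e \<in> contract u v E" for e
  proof -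
    obtain a b where ab: "a \<in> V" "b \<in> V" "a \<noteq> b" "\<phi> e = {a, b}" "arc (\<gamma> (\<phi> e))"
        "path_image (\<gamma> (\<phi> e)) \<inter> T a = {pathstart (\<gamma> (\<phi> e))}"
        "path_image (\<gamma> (\<phi> e)) \<inter> T b = {pathfinish (\<gamma> (\<phi> e))}"
      using \<gamma>[rule_format, OF \<phi>(1)[OF e]] by blast
    have ba: "\<phi> e = {b, a}" "b \<noteq> a" using ab by auto
    have ne: "{a, b} \<noteq> {u, v}" using \<phi>(2)[OF e] ab by simp
    define x y where "x = (if a = v then u else a)" and "y = (if b = v then u else b)"
    have "x \<noteq> y" using ab ne by (auto simp: x_def y_def)
    moreover have "e = {x, y}" using \<phi>(3)[OF e] ab by (auto simp: x_def y_def split: if_splits)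
    moreover have "x \<in> V - {v}" "y \<in> V - {v}" using ab uvV uv by (auto simp: x_def y_def)
    moreover note ends[OF \<phi>(1)[OF e] \<phi>(2)[OF e] ab(4,3,1), folded x_def]
      ends[OF \<phi>(1)[OF e] \<phi>(2)[OF e] ba ab(2), folded y_def]
    ultimately show ?thesis using ab(5,6,7) by (intro bexI[of _ x] bexI[of _ y]) simp_all
  qed
  have 2: "path_image (\<gamma> (\<phi> e)) \<inter> T' x = {}"
    if e: "e \<in> contract u v E" and x: "x \<in> V - {v}" "x \<notin> e" for e x
  proof (cases "x = u")
    case True
    then have "u \<notin> \<phi> e" "v \<notin> \<phi> e" using \<phi>(3)[OF e] x by (auto split: if_splits)
    then show ?thesis using True PC[OF \<phi>(1)[OF e] \<phi>(2)[OF e]] uvV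
        \<gamma>T[rule_format, OF \<phi>(1)[OF e], of u] \<gamma>T[rule_format, OF \<phi>(1)[OF e], of v]
      by (simp add: T'_def Int_Un_distrib)
  next
    case False
    then have "x \<notin> \<phi> e" using \<phi>(3)[OF e] x by (auto split: if_splits)
    then show ?thesis using False \<gamma>T x \<phi>(1)[OF e] by (auto simp: T'_def)
  qed
  have 3: "path_image (\<gamma> (\<phi> e)) \<inter> path_image (\<gamma> (\<phi> e')) \<subseteq> \<Union> (T' ` (V - {v}))"
    if e: "e \<in> contract u v E" "e' \<in> contract u v E" "e \<noteq> e'" for e e'
  proof -
    have "\<phi> e \<noteq> \<phi> e'" using \<phi>(3)[OF e(1)] \<phi>(3)[OF e(2)] e(3) by metis
    then have "path_image (\<gamma> (\<phi> e)) \<inter> path_image (\<gamma> (\<phi> e')) \<subseteq> \<Union> (T ` V)"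
      using \<gamma>\<gamma> \<phi>(1)[OF e(1)] \<phi>(1)[OF e(2)] by simp
    also have "\<dots> \<subseteq> \<Union> (T' ` (V - {v}))"
    proof
      fix z assume "z \<in> \<Union> (T ` V)"
      then obtain x where "x \<in> V" "z \<in> T x" by auto
      then have "z \<in> T' (if x = v then u else x)" "(if x = v then u else x) \<in> V - {v}"
        using uvV uv by (auto simp: T'_def C_def)
      then show "z \<in> \<Union> (T' ` (V - {v}))" by blast
    qed
    finally show ?thesis .
  qed
  have 4: "\<forall>x\<in>V - {v}. compact (T' x) \<and> connected (T' x) \<and> connected (- T' x) \<and> T' x \<noteq> {}"
    using C T by (auto simp: T'_def)
  have 5: "\<forall>x\<in>V - {v}. \<forall>y\<in>V - {v}. x \<noteq> y \<longrightarrow> T' x \<inter> T' y = {}"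
    using CT TT by (auto simp: T'_def Int_commute)
  show ?thesis unfolding plane_model_def
    by (rule exI[of _ T'], rule exI[of _ "\<lambda>e. \<gamma> (\<phi> e)"]) (use 1 2 3 4 5 in meson)
qed

section \<open>Counting graphs in a minor-closed class\<close>

definition nbr :: "nat set set \<Rightarrow> nat \<Rightarrow> nat set" where
  "nbr E v = {w. {v, w} \<in> E}"

definition pairs :: "nat set \<Rightarrow> nat set set" where
  "pairs V = {{u, w} | u w. u \<in> V \<and> w \<in> V \<and> u \<noteq> w}"

text \<open>Kept abstract in \<open>P\<close> because the density argument passes from a class to a
  second one, \<open>apex P\<close>.\<close>

locale minor_class =
  fixes P :: "nat set \<Rightarrow> nat set set \<Rightarrow> bool"
  assumes edge: "P V E \<Longrightarrow> e \<in> E \<Longrightarrow> e \<in> pairs V"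
    and mono: "P V E \<Longrightarrow> V' \<subseteq> V \<Longrightarrow> E' \<subseteq> E \<Longrightarrow> (\<And>e. e \<in> E' \<Longrightarrow> e \<subseteq> V') \<Longrightarrow> P V' E'"
    and contract: "P V E \<Longrightarrow> {u, v} \<in> E \<Longrightarrow> u \<noteq> v \<Longrightarrow> P (V - {v}) (contract u v E)"
begin

lemma edge_mem: "P V E \<Longrightarrow> {u, v} \<in> E \<Longrightarrow> u \<in> V \<and> v \<in> V \<and> u \<noteq> v"
  using edge[of V E "{u, v}"] by (auto simp: pairs_def doubleton_eq_iff)

lemma edge_sub: "P V E \<Longrightarrow> e \<in> E \<Longrightarrow> e \<subseteq> V"
  using edge[of V E e] by (auto simp: pairs_def)

lemma edges_Pow: "P V E \<Longrightarrow> E \<subseteq> Pow V"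
  using edge_sub by auto

lemma finite_edges: "P V E \<Longrightarrow> finite V \<Longrightarrow> finite E"
  by (rule finite_subset[OF edges_Pow]) auto

lemma nbr_sub: "P V E \<Longrightarrow> nbr E v \<subseteq> V"
  using edge_mem by (auto simp: nbr_def)

lemma finite_nbr: "P V E \<Longrightarrow> finite V \<Longrightarrow> finite (nbr E v)"
  by (rule finite_subset[OF nbr_sub])

lemma nbr_irrefl: "P V E \<Longrightarrow> v \<notin> nbr E v"
  using edge_mem[of V E v v] by (auto simp: nbr_def)

lemma handshake:
  assumes "P V E" "finite V"
  shows "(\<Sum>v\<in>V. card (nbr E v)) \<le> 2 * card E"
proof -
  have fE: "finite E" using finite_edges assms .
  have "card (nbr E v) \<le> card {e \<in> E. v \<in> e}" for v
    by (rule card_inj_on_le[of "\<lambda>w. {v, w}"]) (auto simp: nbr_def inj_on_def doubleton_eq_iff fE)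
  then have "(\<Sum>v\<in>V. card (nbr E v)) \<le> (\<Sum>v\<in>V. card {e \<in> E. v \<in> e})"
    by (rule sum_mono)
  also have "\<dots> = 2 * card E"
  proof (rule sum_multicount[OF assms(2) fE])
    show "\<forall>e\<in>E. card {v \<in> V. v \<in> e} = 2"
    proof
      fix e assume e: "e \<in> E"
      then obtain u w where "e = {u, w}" "u \<noteq> w" using edge[OF assms(1) e] by (auto simp: pairs_def)
      moreover have "{v \<in> V. v \<in> e} = e" using edge_sub[OF assms(1) e] by auto
      ultimately show "card {v \<in> V. v \<in> e} = 2" by auto
    qed
  qed
  finally show ?thesis .
qed

text \<open>Contraction loses \<open>{u, v}\<close> itself and, for each common neighbour, one of
  two edges that become parallel; all other edges survive.\<close>

lemma contract_card:
  assumes "P V E" "finite V" "{u, v} \<in> E"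
  shows "card E \<le> card (contract u v E) + 1 + card (nbr E u \<inter> nbr E v)"
proof -
  define E0 W where "E0 = {e \<in> E. v \<notin> e}" and "W = nbr E v - {u}"
  have fin: "finite E" "finite W" "finite E0"
    using finite_edges finite_nbr assms by (auto simp: E0_def W_def)
  have uv: "u \<noteq> v" using edge_mem assms by blast
  have "E \<subseteq> E0 \<union> ({{u, v}} \<union> (\<lambda>w. {v, w}) ` W)"
  proof
    fix e assume e: "e \<in> E"
    show "e \<in> E0 \<union> ({{u, v}} \<union> (\<lambda>w. {v, w}) ` W)"
    proof (cases "v \<in> e")
      case True
      obtain a b where "e = {a, b}" using edge[OF assms(1) e] by (auto simp: pairs_def)
      then obtain w where "e = {v, w}" using True by auto
      then show ?thesis using e by (auto simp: W_def nbr_def insert_commute)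
    qed (use e in \<open>auto simp: E0_def\<close>)
  qed
  then have "card E \<le> card (E0 \<union> ({{u, v}} \<union> (\<lambda>w. {v, w}) ` W))"
    using fin by (intro card_mono) auto
  also have "\<dots> \<le> card E0 + (1 + card W)"
    using card_Un_le[of E0 "{{u, v}} \<union> (\<lambda>w. {v, w}) ` W"]
      card_Un_le[of "{{u, v}}" "(\<lambda>w. {v, w}) ` W"] card_image_le[OF fin(2), of "\<lambda>w. {v, w}"]
    by simp
  also have "card W \<le> card (W - nbr E u) + card (nbr E u \<inter> nbr E v)"
  proof -
    have "card W \<le> card ((W - nbr E u) \<union> (nbr E u \<inter> nbr E v))"
      using fin finite_nbr[OF assms(1,2)] by (intro card_mono) (auto simp: W_def)
    also have "\<dots> \<le> card (W - nbr E u) + card (nbr E u \<inter> nbr E v)" by (rule card_Un_le)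
    finally show ?thesis .
  qed
  also have "card E0 + (1 + (card (W - nbr E u) + card (nbr E u \<inter> nbr E v)))
      \<le> card (contract u v E) + 1 + card (nbr E u \<inter> nbr E v)"
  proof -
    have inj: "inj_on (\<lambda>w. {u, w}) (W - nbr E u)" by (auto simp: inj_on_def doubleton_eq_iff)
    have "E0 \<inter> (\<lambda>w. {u, w}) ` (W - nbr E u) = {}" by (auto simp: E0_def nbr_def)
    then have "card E0 + card (W - nbr E u) = card (E0 \<union> (\<lambda>w. {u, w}) ` (W - nbr E u))"
      using fin card_image[OF inj] by (subst card_Un_disjoint) auto
    also have "\<dots> \<le> card (contract u v E)"
    proof (rule card_mono)
      show "finite (contract u v E)" using finite_edges contract assms uv by blast
      show "E0 \<union> (\<lambda>w. {u, w}) ` (W - nbr E u) \<subseteq> contract u v E"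
        by (auto simp: E0_def W_def contract_def nbr_def)
    qed
    finally show ?thesis by simp
  qed
  finally show ?thesis by simp
qed

end

text \<open>The class of links: graphs that stay in \<open>P\<close> after a new vertex joined to
  everything is added. If \<open>P\<close> omits the complete graph on \<open>t + 2\<close>
  vertices, this class omits the one on \<open>t + 1\<close>, which is the induction step of the
  density bound.\<close>

definition apex :: "(nat set \<Rightarrow> nat set set \<Rightarrow> bool) \<Rightarrow> nat set \<Rightarrow> nat set set \<Rightarrow> bool" where
  "apex P V E \<longleftrightarrow> (\<exists>x. x \<notin> V \<and> E \<subseteq> pairs V \<and> P (insert x V) (E \<union> (\<lambda>v. {x, v}) ` V))"

lemma minor_class_apex:
  assumes "minor_class P"
  shows "minor_class (apex P)"
proof -
  interpret minor_class P by fact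
  show ?thesis
  proof
    fix V E e assume "apex P V E" "e \<in> E"
    then show "e \<in> pairs V" by (auto simp: apex_def)
  next
    fix V E V' E' assume a: "apex P V E" and s: "V' \<subseteq> V" "E' \<subseteq> E" "\<And>e. e \<in> E' \<Longrightarrow> e \<subseteq> V'"
    obtain x where x: "x \<notin> V" "E \<subseteq> pairs V" "P (insert x V) (E \<union> (\<lambda>v. {x, v}) ` V)"
      using a by (auto simp: apex_def)
    have "P (insert x V') (E' \<union> (\<lambda>v. {x, v}) ` V')"
      by (rule mono[OF x(3)]) (use s in auto)
    moreover have "E' \<subseteq> pairs V'"
    proof
      fix e assume e: "e \<in> E'"
      then have "e \<in> pairs V" using s x by auto
      then show "e \<in> pairs V'" using s(3)[OF e] by (auto simp: pairs_def)
    qed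
    ultimately show "apex P V' E'" using x s by (auto simp: apex_def)
  next
    fix V E u v assume a: "apex P V E" and uv: "{u, v} \<in> E" "u \<noteq> v"
    obtain x where x: "x \<notin> V" "E \<subseteq> pairs V" "P (insert x V) (E \<union> (\<lambda>v. {x, v}) ` V)"
      using a by (auto simp: apex_def)
    let ?S = "(\<lambda>v. {x, v}) ` V"
    have uvV: "u \<in> V" "v \<in> V" using uv x(2) by (auto simp: pairs_def doubleton_eq_iff)
    have "P (insert x V - {v}) (contract u v (E \<union> ?S))"
      using contract[OF x(3), of u v] uv by auto
    moreover have cs: "contract u v E \<subseteq> pairs (V - {v})"
    proof
      fix e assume "e \<in> contract u v E"
      then consider "e \<in> E" "v \<notin> e" | w where "e = {u, w}" "{v, w} \<in> E" "w \<noteq> u"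
        by (auto simp: contract_def)
      then show "e \<in> pairs (V - {v})"
      proof cases
        case 1
        then have "e \<in> pairs V" using x(2) by auto
        then show ?thesis using 1 by (fastforce simp: pairs_def)
      next
        case 2
        then have "{v, w} \<in> pairs V" using x(2) by auto
        then have "w \<in> V" "w \<noteq> v" by (auto simp: pairs_def doubleton_eq_iff)
        then show ?thesis using 2 uvV uv by (auto simp: pairs_def)
      qed
    qed
    ultimately have "P (insert x (V - {v})) (contract u v E \<union> (\<lambda>w. {x, w}) ` (V - {v}))"
    proof (elim mono)
      show "insert x (V - {v}) \<subseteq> insert x V - {v}" using x uvV by auto
      have "contract u v E \<subseteq> contract u v (E \<union> ?S)" by (auto simp: contract_def)
      moreover have "(\<lambda>w. {x, w}) ` (V - {v}) \<subseteq> contract u v (E \<union> ?S)"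
        using x uvV by (auto simp: contract_def)
      ultimately show "contract u v E \<union> (\<lambda>w. {x, w}) ` (V - {v}) \<subseteq> contract u v (E \<union> ?S)" by blast
      show "e \<subseteq> insert x (V - {v})" if "e \<in> contract u v E \<union> (\<lambda>w. {x, w}) ` (V - {v})" for e
        using that cs by (fastforce simp: pairs_def)
    qed
    then show "apex P (V - {v}) (contract u v E)" using x cs by (auto simp: apex_def)
  qed
qed

text \<open>In closed form \<open>2 ^ t - 1\<close>. With \<open>d = 2 * mader t + 1\<close>,
  minimum degree \<open>d\<close> in a link gives it more than \<open>mader t\<close> edges per
  vertex.\<close>

fun mader :: "nat \<Rightarrow> nat" where
  "mader 0 = 0" | "mader (Suc t) = 2 * mader t + 1"

text \<open>Mader's argument: contract an edge lying in few triangles; if there is none, the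
  neighbourhood of a vertex is too dense for the class of its links.\<close>

theorem minor_class_density:
  assumes "minor_class P" and "\<And>V. P V (pairs V) \<Longrightarrow> card V \<noteq> Suc t"
    and "P V E" and "finite V"
  shows "card E \<le> mader t * card V"
  using assms
proof (induction t arbitrary: P V E)
  case 0
  interpret minor_class P by fact
  have "E = {}"
  proof (rule ccontr)
    assume "E \<noteq> {}"
    then obtain e where "e \<in> E" by auto
    then obtain u where "u \<in> V" using edge[OF 0(3)] by (auto simp: pairs_def)
    then have "P {u} {}" by (intro mono[OF 0(3)]) auto
    moreover have "pairs {u} = {}" by (auto simp: pairs_def)
    ultimately show False using 0(2)[of "{u}"] by auto
  qed
  then show ?case by simp
next
  case (Suc t)
  interpret minor_class P by fact
  interpret A: minor_class "apex P" by (rule minor_class_apex) fact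
  define d where "d = mader (Suc t)"
  have link: "card E' \<le> mader t * card V'" if "apex P V' E'" "finite V'" for V' E'
  proof (rule Suc.IH[OF A.minor_class_axioms _ that])
    fix V assume "apex P V (pairs V)"
    then obtain x where x: "x \<notin> V" "P (insert x V) (pairs V \<union> (\<lambda>v. {x, v}) ` V)"
      by (auto simp: apex_def)
    have "pairs (insert x V) = pairs V \<union> (\<lambda>v. {x, v}) ` V"
      using x(1) by (auto simp: pairs_def insert_commute)
    then have "card (insert x V) \<noteq> Suc (Suc t)" using Suc.prems(2)[of "insert x V"] x by simp
    then show "card V \<noteq> Suc t" using x(1) by (metis card.infinite card_insert_disjoint nat.distinct(1))
  qed
  have "card E \<le> d * card V" if "P V E" "finite V" for V E
    using that
  proof (induction "card V" arbitrary: V E rule: less_induct)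
    case less
    note P = less.prems
    show ?case
    proof (cases "\<exists>u v. {u, v} \<in> E \<and> card (nbr E u \<inter> nbr E v) < d")
      case True
      then obtain u v where uv: "{u, v} \<in> E" "card (nbr E u \<inter> nbr E v) < d" by auto
      have m: "u \<in> V" "v \<in> V" "u \<noteq> v" using edge_mem[OF P(1) uv(1)] by auto
      have c: "card V = Suc (card (V - {v}))" using m P by (metis card_Suc_Diff1)
      have "card (contract u v E) \<le> d * card (V - {v})"
        by (rule less.hyps) (use contract[OF P(1) uv(1) m(3)] c P in auto)
      then show ?thesis using contract_card[OF P uv(1)] uv(2) c by simp
    next
      case False
      show ?thesis
      proof (cases "E = {}")
        case nE: False
        then obtain x y where xy: "{x, y} \<in> E" using edge[OF P(1)] by (fastforce simp: pairs_def)
        define N where "N = nbr E x"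
        define EN where "EN = {e \<in> E. e \<subseteq> N}"
        have fN: "finite N" unfolding N_def using finite_nbr P by auto
        have yN: "y \<in> N" using xy by (auto simp: N_def nbr_def)
        have xN: "x \<notin> N" using nbr_irrefl[OF P(1)] by (auto simp: N_def)
        have PN: "P N EN" using nbr_sub[OF P(1)] by (intro mono[OF P(1)]) (auto simp: N_def EN_def)
        have "P (insert x N) (EN \<union> (\<lambda>v. {x, v}) ` N)"
          using nbr_sub[OF P(1)] edge_mem[OF P(1) xy]
          by (intro mono[OF P(1)]) (auto simp: N_def EN_def nbr_def)
        then have "apex P N EN" using xN edge[OF PN] by (auto simp: apex_def)
        then have up: "card EN \<le> mader t * card N" using link fN by auto
        have "d \<le> card (nbr EN z)" if z: "z \<in> N" for z
        proof -
          have "{x, z} \<in> E" using z by (auto simp: N_def nbr_def)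
          then have "d \<le> card (nbr E x \<inter> nbr E z)" using False by (meson not_le)
          also have "nbr E x \<inter> nbr E z \<subseteq> nbr EN z" using z by (auto simp: EN_def N_def nbr_def)
          then have "card (nbr E x \<inter> nbr E z) \<le> card (nbr EN z)"
            using finite_nbr[OF PN fN] by (intro card_mono) auto
          finally show ?thesis .
        qed
        then have "card N * d \<le> (\<Sum>z\<in>N. card (nbr EN z))"
          using sum_mono[of N "\<lambda>_. d" "\<lambda>z. card (nbr EN z)"] by simp
        also have "\<dots> \<le> 2 * (mader t * card N)" using handshake[OF PN fN] up by linarith
        finally have "card N * d \<le> card N * (2 * mader t)" by (simp add: mult_ac)
        moreover have "card N > 0" using yN fN by (auto simp: card_gt_0_iff)
        ultimately have "d \<le> 2 * mader t" by simp
        then show ?thesis by (simp add: d_def)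
      qed simp
    qed
  qed
  then show ?case using Suc.prems d_def by auto
qed

section \<open>Cliques, twins and bounded degrees in a sparse class\<close>

locale sparse_minor_class = minor_class +
  fixes d :: nat
  assumes density: "P V E \<Longrightarrow> finite V \<Longrightarrow> card E \<le> d * card V"
begin

lemma low_degree_vertex:
  assumes "P V E" "finite V" "V \<noteq> {}"
  shows "\<exists>v\<in>V. card (nbr E v) \<le> 2 * d"
proof (rule ccontr)
  assume "\<not> (\<exists>v\<in>V. card (nbr E v) \<le> 2 * d)"
  then have "(\<Sum>v\<in>V. 2 * d) < (\<Sum>v\<in>V. card (nbr E v))" using assms by (intro sum_strict_mono) auto
  then show False using handshake[OF assms(1,2)] density[OF assms(1,2)] by (simp add: mult_ac)
qed

definition cliques :: "nat set \<Rightarrow> nat set set \<Rightarrow> nat set set" where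
  "cliques V E = {C. C \<subseteq> V \<and> pairs C \<subseteq> E}"

text \<open>Delete a vertex of degree at most \<open>2 * d\<close>: a clique through it is
  determined by a subset of its neighbourhood, which leaves at most \<open>4 ^ d\<close> of them.
  The summand 1 is the empty clique.\<close>

lemma card_cliques:
  assumes "P V E" "finite V"
  shows "card (cliques V E) \<le> 4 ^ d * card V + 1"
  using assms
proof (induction "card V" arbitrary: V E)
  case 0
  then have "cliques V E \<subseteq> {{}}" by (auto simp: cliques_def)
  then have "card (cliques V E) \<le> card {{} :: nat set}" by (intro card_mono) auto
  then show ?case by simp
next
  case (Suc n)
  then have "V \<noteq> {}" by auto
  then obtain v where v: "v \<in> V" "card (nbr E v) \<le> 2 * d" using low_degree_vertex Suc.prems by blast
  define E' where "E' = {e \<in> E. v \<notin> e}"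
  have P': "P (V - {v}) E'"
    using edge_sub[OF Suc.prems(1)] by (intro mono[OF Suc.prems(1)]) (auto simp: E'_def)
  have "n = card (V - {v})" using Suc v by simp
  then have IH: "card (cliques (V - {v}) E') \<le> 4 ^ d * n + 1" using Suc(1)[OF _ P'] Suc.prems by auto
  have "cliques V E \<subseteq> cliques (V - {v}) E' \<union> insert v ` Pow (nbr E v)"
  proof
    fix C assume C: "C \<in> cliques V E"
    show "C \<in> cliques (V - {v}) E' \<union> insert v ` Pow (nbr E v)"
    proof (cases "v \<in> C")
      case True
      have "C - {v} \<subseteq> nbr E v"
      proof
        fix w assume "w \<in> C - {v}"
        then have "{v, w} \<in> pairs C" using True by (auto simp: pairs_def)
        then show "w \<in> nbr E v" using C by (auto simp: cliques_def nbr_def)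
      qed
      moreover have "C = insert v (C - {v})" using True by auto
      ultimately show ?thesis by blast
    next
      case False
      then have "pairs C \<subseteq> E'" using C by (auto simp: cliques_def pairs_def E'_def)
      then show ?thesis using False C by (auto simp: cliques_def)
    qed
  qed
  moreover have fN: "finite (nbr E v)" using finite_nbr Suc.prems by blast
  moreover have "finite (cliques (V - {v}) E')"
    by (rule finite_subset[of _ "Pow V"]) (use Suc.prems in \<open>auto simp: cliques_def\<close>)
  ultimately have "card (cliques V E) \<le> card (cliques (V - {v}) E' \<union> insert v ` Pow (nbr E v))"
    by (intro card_mono) auto
  also have "\<dots> \<le> card (cliques (V - {v}) E') + card (insert v ` Pow (nbr E v))" by (rule card_Un_le)
  also have "card (insert v ` Pow (nbr E v)) \<le> 2 ^ card (nbr E v)"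
    using card_image_le[of "Pow (nbr E v)" "insert v"] fN by (simp add: card_Pow)
  also have "(2::nat) ^ card (nbr E v) \<le> 2 ^ (2 * d)" using v by (intro power_increasing) auto
  also have "(2::nat) ^ (2 * d) = 4 ^ d" by (simp add: power_mult)
  finally have "card (cliques V E) \<le> 4 ^ d * n + 1 + 4 ^ d" using IH by simp
  then show ?case unfolding Suc(2)[symmetric] by simp
qed

text \<open>Contract a vertex of \<open>B\<close> into \<open>X\<close> as long as this creates a new edge; in the end all
  neighbourhoods are cliques, and a degenerate graph has few cliques.\<close>

lemma card_distinct_nbrs:
  assumes "P V E" "finite X" "finite B" "V = X \<union> B" "X \<inter> B = {}"
    "\<And>b. b \<in> B \<Longrightarrow> nbr E b \<subseteq> X" "inj_on (nbr E) B"
  shows "card B + card {e \<in> E. e \<subseteq> X} \<le> (d + 4 ^ d) * card X + 1"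
  using assms
proof (induction "card B" arbitrary: B V E rule: less_induct)
  case less
  note P = less.prems
  have fV: "finite V" using P by auto
  have fE: "finite E" using finite_edges P fV by blast
  show ?case
  proof (cases "\<exists>b\<in>B. \<exists>y\<in>nbr E b. \<exists>z\<in>nbr E b. y \<noteq> z \<and> {y, z} \<notin> E")
    case True
    \<comment> \<open>Contracting \<open>b\<close> into \<open>y\<close> creates
      \<open>{y, z}\<close>: \<open>B\<close> loses one vertex and \<open>X\<close> gains at least
      one edge, so the quantity to be bounded does not decrease. The other vertices of
      \<open>B\<close> keep their neighbourhoods because \<open>B\<close> is independent.\<close>
    then obtain b y z where b: "b \<in> B" "{b, y} \<in> E" "{b, z} \<in> E" "y \<noteq> z" "{y, z} \<notin> E"
      by (auto simp: nbr_def)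
    define E' where "E' = contract y b E"
    have yz: "y \<in> X" "z \<in> X" using P(6)[OF b(1)] b by (auto simp: nbr_def)
    have nb: "y \<noteq> b" using edge_mem[OF P(1) b(2)] by auto
    have yb: "{y, b} \<in> E" using b by (simp add: insert_commute)
    have P': "P (V - {b}) E'" unfolding E'_def by (rule contract[OF P(1) yb nb])
    have nbrE': "nbr E' c = nbr E c" if c: "c \<in> B - {b}" for c
    proof -
      have "b \<notin> nbr E c" using P(5) P(6)[of c] b c by auto
      moreover have "c \<notin> X" using P(5) c by auto
      moreover have "w \<in> X" if "{b, w} \<in> E" for w using that P(6)[OF b(1)] by (auto simp: nbr_def)
      ultimately show ?thesis using c yz nb by (auto simp: nbr_def E'_def contract_def doubleton_eq_iff)
    qed
    have "card (B - {b}) + card {e \<in> E'. e \<subseteq> X} \<le> (d + 4 ^ d) * card X + 1"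
    proof (rule less.hyps[OF _ P'])
      show "card (B - {b}) < card B" using b P by (metis card_Diff1_less)
      show "V - {b} = X \<union> (B - {b})" using P b by auto
      show "inj_on (nbr E') (B - {b})" using P(7) nbrE' by (auto simp: inj_on_def)
      show "finite X" "finite (B - {b})" "X \<inter> (B - {b}) = {}" using P(2,3,5) by auto
      show "nbr E' c \<subseteq> X" if "c \<in> B - {b}" for c using P(6)[of c] nbrE'[OF that] that by simp
    qed
    moreover have "card {e \<in> E. e \<subseteq> X} + 1 \<le> card {e \<in> E'. e \<subseteq> X}"
    proof -
      have "insert {y, z} {e \<in> E. e \<subseteq> X} \<subseteq> {e \<in> E'. e \<subseteq> X}"
        using P(5) b yz by (auto simp: E'_def contract_def)
      then have "card (insert {y, z} {e \<in> E. e \<subseteq> X}) \<le> card {e \<in> E'. e \<subseteq> X}"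
        using finite_edges[OF P'] fV by (intro card_mono) auto
      then show ?thesis using b(5) fE by simp
    qed
    moreover have "card B = card (B - {b}) + 1"
      using b(1) P(3) by (metis Suc_eq_plus1 card_Suc_Diff1)
    ultimately show ?thesis by linarith
  next
    case False
    define FX where "FX = {e \<in> E. e \<subseteq> X}"
    have PFX: "P X FX" using P by (intro mono[OF P(1)]) (auto simp: FX_def)
    have "nbr E ` B \<subseteq> cliques X FX"
    proof
      fix C assume "C \<in> nbr E ` B"
      then obtain b where b: "b \<in> B" "C = nbr E b" by auto
      then show "C \<in> cliques X FX" using False P(6)[OF b(1)] by (auto simp: cliques_def pairs_def FX_def)
    qed
    moreover have "finite (cliques X FX)"
      by (rule finite_subset[of _ "Pow X"]) (use P in \<open>auto simp: cliques_def\<close>)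
    ultimately have "card B \<le> card (cliques X FX)" using card_inj_on_le[OF P(7)] by auto
    then show ?thesis using card_cliques[OF PFX P(2)] density[OF PFX P(2)]
      unfolding FX_def by (simp add: algebra_simps)
  qed
qed


text \<open>The average degree is at most \<open>2 * d\<close>, so with this value at most
  \<open>card V / (4 * (1 + d + 4 ^ d))\<close> vertices have degree above \<open>big\<close>. The
  factor matches the coefficient \<open>d + 4 ^ d\<close> in
  \<open>card_distinct_nbrs\<close>.\<close>

definition big :: nat where "big = 8 * (d + 1) * (1 + d + 4 ^ d)"

text \<open>The two situations in which the graph is recovered from one on \<open>V - {v}\<close> at
  bounded cost: after deleting a twin, or after contracting an edge between vertices of bounded
  degree.\<close>

definition good :: "nat set \<Rightarrow> nat set set \<Rightarrow> nat \<Rightarrow> nat \<Rightarrow> bool" where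
  "good V E u v \<longleftrightarrow> (u \<in> V \<and> u \<noteq> v \<and> nbr E u = nbr E v) \<or>
     ({u, v} \<in> E \<and> card (nbr E u) \<le> big \<and> card (nbr E v) \<le> big)"

text \<open>A vertex of degree at most \<open>big\<close> that is not good has all its neighbours in
  \<open>X\<close> and no twin, so \<open>card_distinct_nbrs\<close> bounds \<open>B\<close> in
  terms of the few vertices of \<open>X\<close>. Together \<open>X\<close> and \<open>B\<close> have
  at most \<open>card V / 4 + 1\<close> elements, at most half of \<open>V\<close> once
  \<open>card V\<close> is at least 4.\<close>

lemma many_good:
  assumes "P V E" "finite V" "4 \<le> card V"
  shows "card V \<le> 2 * card {v \<in> V. \<exists>u. good V E u v}"
proof -
  define s where "s = 1 + d + 4 ^ d"
  define X B G where "X = {v \<in> V. big < card (nbr E v)}"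
    and "B = {v \<in> V - X. \<nexists>u. good V E u v}" and "G = {v \<in> V. \<exists>u. good V E u v}"
  have fin: "finite X" "finite B" "finite G" using assms by (auto simp: X_def B_def G_def)
  have "card X * big \<le> (\<Sum>v\<in>X. card (nbr E v))"
    using sum_mono[of X "\<lambda>_. big" "\<lambda>v. card (nbr E v)"] by (simp add: X_def)
  also have "\<dots> \<le> (\<Sum>v\<in>V. card (nbr E v))"
    using assms(2) by (intro sum_mono2) (auto simp: X_def)
  also have "\<dots> \<le> 2 * (d * card V)"
    using handshake[OF assms(1,2)] density[OF assms(1,2)] by linarith
  also have "\<dots> \<le> 2 * ((d + 1) * card V)" by simp
  finally have "card X * big \<le> (2 * (d + 1)) * card V" by (simp add: mult_ac)
  moreover have "card X * big = (2 * (d + 1)) * (4 * (s * card X))"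
    by (simp add: big_def s_def algebra_simps)
  ultimately have "(2 * (d + 1)) * (4 * (s * card X)) \<le> (2 * (d + 1)) * card V" by simp
  then have X: "4 * (s * card X) \<le> card V" by (subst (asm) mult_le_cancel1) simp
  define E1 where "E1 = {e \<in> E. e \<subseteq> X \<union> B}"
  have nX: "nbr E b \<subseteq> X" if b: "b \<in> B" for b
  proof
    fix w assume w: "w \<in> nbr E b"
    then have e: "{w, b} \<in> E" by (simp add: nbr_def insert_commute)
    then have "w \<in> V" using edge_mem[OF assms(1)] by auto
    moreover have "\<not> good V E w b" using b by (auto simp: B_def)
    ultimately show "w \<in> X" using e b by (auto simp: good_def X_def B_def)
  qed
  have n1: "nbr E1 b = nbr E b" if "b \<in> B" for b using nX[OF that] that by (auto simp: nbr_def E1_def)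
  have "card B + card {e \<in> E1. e \<subseteq> X} \<le> (d + 4 ^ d) * card X + 1"
  proof (rule card_distinct_nbrs[of "X \<union> B"])
    show "P (X \<union> B) E1" by (rule mono[OF assms(1)]) (auto simp: X_def B_def E1_def)
    show "inj_on (nbr E1) B" using n1 by (auto simp: inj_on_def B_def good_def)
    show "nbr E1 b \<subseteq> X" if "b \<in> B" for b using n1 nX that by simp
    show "finite X" "finite B" "X \<inter> B = {}" using fin by (auto simp: B_def)
  qed simp
  then have "card X + card B \<le> s * card X + 1" by (simp add: s_def)
  moreover have "card V \<le> card (G \<union> (X \<union> B))"
    using fin by (intro card_mono) (auto simp: G_def B_def)
  moreover have "card (G \<union> (X \<union> B)) \<le> card G + (card X + card B)"
    using card_Un_le[of G "X \<union> B"] card_Un_le[of X B] by linarith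
  ultimately have "card V \<le> 2 * card G" using X assms(3) by linarith
  then show ?thesis by (simp add: G_def)
qed

lemma finite_class: "finite V \<Longrightarrow> finite {E. P V E}"
proof -
  assume "finite V"
  moreover have "{E. P V E} \<subseteq> Pow (Pow V)" 
  proof
    fix E assume "E \<in> {E. P V E}"
    then show "E \<in> Pow (Pow V)" using edges_Pow[of V E] by simp
  qed
  ultimately show ?thesis by (meson finite_Pow_iff finite_subset)
qed

text \<open>Twins are not adjacent, so deleting \<open>v\<close> leaves the neighbourhood of
  \<open>u\<close> intact, and that of \<open>v\<close> is copied back from it.\<close>

lemma card_twin_graphs:
  assumes "finite V"
  shows "card {E. P V E \<and> u \<in> V \<and> u \<noteq> v \<and> nbr E u = nbr E v} \<le> card {E. P (V - {v}) E}"
proof (rule card_inj_on_le[of "\<lambda>E. {e \<in> E. v \<notin> e}"])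
  show "finite {E. P (V - {v}) E}" using assms finite_class by auto
  show "(\<lambda>E. {e \<in> E. v \<notin> e}) ` {E. P V E \<and> u \<in> V \<and> u \<noteq> v \<and> nbr E u = nbr E v} \<subseteq> {E. P (V - {v}) E}"
  proof clarsimp
    fix E assume E: "P V E" "nbr E u = nbr E v"
    show "P (V - {v}) {e \<in> E. v \<notin> e}" using edge_sub[OF E(1)] by (intro mono[OF E(1)]) auto
  qed
  show "inj_on (\<lambda>E. {e \<in> E. v \<notin> e}) {E. P V E \<and> u \<in> V \<and> u \<noteq> v \<and> nbr E u = nbr E v}"
  proof (rule inj_on_inverseI[where g = "\<lambda>F. F \<union> (\<lambda>w. {v, w}) ` {w. {u, w} \<in> F}"])
    fix E assume "E \<in> {E. P V E \<and> u \<in> V \<and> u \<noteq> v \<and> nbr E u = nbr E v}"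
    then have E: "P V E" "u \<noteq> v" and n: "\<And>w. {u, w} \<in> E \<longleftrightarrow> {v, w} \<in> E" by (auto simp: nbr_def)
    have "e \<in> (\<lambda>w. {v, w}) ` {w. {u, w} \<in> {e \<in> E. v \<notin> e}}" if e: "e \<in> E" "v \<in> e" for e
    proof -
      obtain a b where "e = {a, b}" using edge[OF E(1) e(1)] by (auto simp: pairs_def)
      then obtain w where w: "e = {v, w}" using e(2) by auto
      then have "w \<noteq> v" using edge_mem[OF E(1), of v w] e by auto
      then show ?thesis using w e n E by auto
    qed
    then show "{e \<in> E. v \<notin> e} \<union> (\<lambda>w. {v, w}) ` {w. {u, w} \<in> {e \<in> E. v \<notin> e}} = E"
      using n by auto
  qed
qed

text \<open>The graph is recovered from its contraction and the two old neighbourhoods. Both are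
  contained in the new neighbourhood of \<open>u\<close> together with \<open>u\<close> and
  \<open>v\<close>, a set of at most \<open>2 * big + 2\<close> elements; two subsets of it can be
  chosen in at most \<open>16 ^ (big + 1)\<close> ways.\<close>

lemma card_contractible_graphs:
  assumes "finite V"
  shows "card {E. P V E \<and> {u, v} \<in> E \<and> card (nbr E u) \<le> big \<and> card (nbr E v) \<le> big}
    \<le> card {E. P (V - {v}) E} * 16 ^ (big + 1)" (is "card ?S \<le> _")
proof -
  define R where "R E = Pow (nbr E u \<union> {u, v}) \<times> Pow (nbr E u \<union> {u, v})" for E
  define T where "T = {E. P (V - {v}) E \<and> card (nbr E u) \<le> 2 * big}"
  have fT: "finite T" using assms finite_class[of "V - {v}"] by (auto simp: T_def)
  have fn: "finite (nbr E u)" if "E \<in> T" for E using finite_nbr that assms by (auto simp: T_def)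
  have cn: "nbr (contract u v E) u = (nbr E u \<union> nbr E v) - {u, v}" if "P V E" "{u, v} \<in> E" for E
    using edge_mem[OF that(1), of u u] edge_mem[OF that(1), of v v] edge_mem[OF that]
    by (auto simp: nbr_def contract_def doubleton_eq_iff)
  have "card ?S \<le> card (Sigma T R)"
  proof (rule card_inj_on_le[of "\<lambda>E. (contract u v E, nbr E u, nbr E v)"])
    show "finite (Sigma T R)" using fT fn by (auto simp: R_def)
    show "(\<lambda>E. (contract u v E, nbr E u, nbr E v)) ` ?S \<subseteq> Sigma T R"
    proof clarsimp
      fix E assume E: "P V E" "{u, v} \<in> E" "card (nbr E u) \<le> big" "card (nbr E v) \<le> big"
      have "card (nbr (contract u v E) u) \<le> card (nbr E u \<union> nbr E v)"
        using cn[OF E(1,2)] finite_nbr[OF E(1) assms] by (intro card_mono) auto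
      also have "\<dots> \<le> 2 * big" using card_Un_le[of "nbr E u" "nbr E v"] E by linarith
      finally show "contract u v E \<in> T \<and> (nbr E u, nbr E v) \<in> R (contract u v E)"
        using cn[OF E(1,2)] contract[OF E(1,2)] edge_mem[OF E(1,2)] by (auto simp: T_def R_def)
    qed
    show "inj_on (\<lambda>E. (contract u v E, nbr E u, nbr E v)) ?S"
    proof (rule inj_on_inverseI[where g = "\<lambda>(F, A, B). {e \<in> F. u \<notin> e} \<union> (\<lambda>w. {u, w}) ` A \<union> (\<lambda>w. {v, w}) ` B"])
      fix E assume "E \<in> ?S"
      then have E: "P V E" "{u, v} \<in> E" by auto
      have "e \<in> (\<lambda>w. {u, w}) ` nbr E u \<union> (\<lambda>w. {v, w}) ` nbr E v" if e: "e \<in> E" "u \<in> e \<or> v \<in> e" for e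
      proof -
        obtain a b where "e = {a, b}" using edge[OF E(1) e(1)] by (auto simp: pairs_def)
        then obtain w where "e = {v, w} \<or> e = {u, w}" using e(2) by auto
        then show ?thesis using e by (auto simp: nbr_def)
      qed
      then have "{e \<in> contract u v E. u \<notin> e} \<union> (\<lambda>w. {u, w}) ` nbr E u \<union> (\<lambda>w. {v, w}) ` nbr E v = E"
        by (auto simp: contract_def nbr_def)
      then show "(case (contract u v E, nbr E u, nbr E v) of (F, A, B) \<Rightarrow>
          {e \<in> F. u \<notin> e} \<union> (\<lambda>w. {u, w}) ` A \<union> (\<lambda>w. {v, w}) ` B) = E" by simp
    qed
  qed
  also have "\<dots> = (\<Sum>E\<in>T. card (R E))" using fT fn by (intro card_SigmaI) (auto simp: R_def)
  also have "\<dots> \<le> (\<Sum>E\<in>T. 16 ^ (big + 1))"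
  proof (rule sum_mono)
    fix E assume E: "E \<in> T"
    have "card (nbr E u \<union> {u, v}) \<le> 2 * big + 2"
      using card_Un_le[of "nbr E u" "{u, v}"] E card_insert_le_m1[of 2 "{v}" u] by (auto simp: T_def)
    then have "(2::nat) ^ card (nbr E u \<union> {u, v}) \<le> 2 ^ (2 * big + 2)" by (intro power_increasing) auto
    then have "card (R E) \<le> 2 ^ (2 * big + 2) * 2 ^ (2 * big + 2)"
      using fn[OF E] unfolding R_def by (simp only: card_cartesian_product card_Pow finite_Un finite_insert finite.emptyI mult_le_mono)
    also have "\<dots> = 16 ^ (big + 1)"
    proof -
      have "(2::nat) ^ (2 * big + 2) = 4 ^ (big + 1)" by (simp add: power_mult)
      then show ?thesis by (simp only: flip: power_mult_distrib) simp
    qed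
    finally show "card (R E) \<le> 16 ^ (big + 1)" .
  qed
  also have "\<dots> \<le> card {E. P (V - {v}) E} * 16 ^ (big + 1)"
    using assms finite_class[of "V - {v}"] by (auto simp: T_def intro!: card_mono)
  finally show ?thesis .
qed

text \<open>\<open>256 = 2 ^ 2 ^ 3\<close> covers at most three vertices. The other summand is twice
  the cost of undoing a deletion or a contraction, the factor 2 because at least half of the
  vertices are good.\<close>

definition growth :: nat where "growth = 256 + 2 * (1 + 16 ^ (big + 1))"

text \<open>Double counting of graphs against good pairs \<open>(u, v)\<close>. In each graph at
  least half of the \<open>Suc n\<close> vertices occur as \<open>v\<close>, and each of the
  \<open>Suc n * Suc n\<close> pairs is good in at most \<open>c * a\<close> graphs. One factor
  \<open>Suc n\<close> cancels; the other builds the factorial.\<close>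

theorem card_class:
  assumes "finite V"
  shows "card {E. P V E} \<le> growth ^ card V * fact (card V)"
  using assms
proof (induction "card V" arbitrary: V)
  case 0
  then have "V = {}" by simp
  have "E = {}" if "P V E" for E
    using edge[OF that] \<open>V = {}\<close> by (auto simp: pairs_def)
  then have "{E. P V E} \<subseteq> {{}}" by auto
  then have "card {E. P V E} \<le> card {{} :: nat set set}" by (intro card_mono) auto
  then show ?case using 0 by simp
next
  case (Suc n)
  define a where "a = growth ^ n * (fact n :: nat)"
  define c :: nat where "c = 1 + 16 ^ (big + 1)"
  have IH: "card {E. P (V - {v}) E} \<le> a" if "v \<in> V" for v
  proof -
    have n: "n = card (V - {v})" using Suc that by simp
    have "card {E. P (V - {v}) E} \<le> growth ^ card (V - {v}) * fact (card (V - {v}))"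
      by (rule Suc(1)[OF n]) (use Suc.prems in simp)
    then show ?thesis unfolding a_def by (simp only: flip: n)
  qed
  have fin: "finite {E. P V E}" using finite_class Suc by auto
  have "card {E. P V E} \<le> growth * (Suc n * a)"
  proof (cases "4 \<le> Suc n")
    case False
    have "card {E. P V E} \<le> card (Pow (Pow V))"
      using edges_Pow Suc by (intro card_mono) auto
    also have "\<dots> = 2 ^ 2 ^ Suc n" using Suc by (simp add: card_Pow)
    also have "\<dots> \<le> (2::nat) ^ 2 ^ 3" using False by (intro power_increasing) auto
    also have "\<dots> \<le> growth" by (simp add: growth_def)
    also have "\<dots> \<le> growth * (Suc n * a)"
    proof -
      have "0 < a" by (simp add: a_def growth_def)
      then have "1 \<le> Suc n * a" by simp
      then show ?thesis using mult_le_mono2[of 1 "Suc n * a" growth] by simp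
    qed
    finally show ?thesis .
  next
    case True
    have uv: "card {E. P V E \<and> good V E u v} \<le> c * a" if "u \<in> V" "v \<in> V" for u v
    proof -
      have eq: "{E. P V E \<and> good V E u v} = {E. P V E \<and> u \<in> V \<and> u \<noteq> v \<and> nbr E u = nbr E v} \<union>
        {E. P V E \<and> {u, v} \<in> E \<and> card (nbr E u) \<le> big \<and> card (nbr E v) \<le> big}"
        by (auto simp: good_def)
      have "card {E. P V E \<and> good V E u v} \<le> card {E. P (V - {v}) E} + card {E. P (V - {v}) E} * 16 ^ (big + 1)"
        unfolding eq
        by (rule order_trans[OF card_Un_le add_mono[OF card_twin_graphs[OF Suc.prems] card_contractible_graphs[OF Suc.prems]]])
      also have "\<dots> = c * card {E. P (V - {v}) E}" by (simp add: c_def)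
      also have "\<dots> \<le> c * a" using IH[OF that(2)] by simp
      finally show ?thesis .
    qed
    have "Suc n * card {E. P V E} = (\<Sum>E\<in>{E. P V E}. Suc n)" by simp
    also have "\<dots> \<le> (\<Sum>E\<in>{E. P V E}. 2 * card {v \<in> V. \<exists>u. good V E u v})"
    proof (rule sum_mono)
      fix E assume "E \<in> {E. P V E}"
      then show "Suc n \<le> 2 * card {v \<in> V. \<exists>u. good V E u v}"
        using many_good[of V E] Suc.prems True unfolding Suc(2) by blast
    qed
    also have "\<dots> = 2 * (\<Sum>E\<in>{E. P V E}. card {v \<in> V. \<exists>u. good V E u v})" by (rule sum_distrib_left[symmetric])
    also have "(\<Sum>E\<in>{E. P V E}. card {v \<in> V. \<exists>u. good V E u v})
        \<le> (\<Sum>E\<in>{E. P V E}. card {z \<in> V \<times> V. good V E (fst z) (snd z)})"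
    proof (rule sum_mono)
      fix E assume E: "E \<in> {E. P V E}"
      have "{v \<in> V. \<exists>u. good V E u v} \<subseteq> snd ` {z \<in> V \<times> V. good V E (fst z) (snd z)}"
      proof
        fix v assume "v \<in> {v \<in> V. \<exists>u. good V E u v}"
        then obtain u where "v \<in> V" "good V E u v" by auto
        moreover from this have "u \<in> V" using edge_mem[of V E u v] E by (auto simp: good_def)
        ultimately show "v \<in> snd ` {z \<in> V \<times> V. good V E (fst z) (snd z)}"
          by (intro image_eqI[of _ _ "(u, v)"]) auto
      qed
      moreover have f: "finite {z \<in> V \<times> V. good V E (fst z) (snd z)}" using Suc.prems by simp
      ultimately have "card {v \<in> V. \<exists>u. good V E u v} \<le> card (snd ` {z \<in> V \<times> V. good V E (fst z) (snd z)})"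
        by (intro card_mono) auto
      also have "\<dots> \<le> card {z \<in> V \<times> V. good V E (fst z) (snd z)}" by (rule card_image_le[OF f])
      finally show "card {v \<in> V. \<exists>u. good V E u v} \<le> card {z \<in> V \<times> V. good V E (fst z) (snd z)}" .
    qed
    also have "\<dots> = (\<Sum>z\<in>V \<times> V. card {E \<in> {E. P V E}. good V E (fst z) (snd z)})"
      by (rule sum_multicount_gen[OF fin]) (use Suc.prems in simp_all)
    also have "\<dots> \<le> (\<Sum>z\<in>V \<times> V. c * a)" using uv by (intro sum_mono) auto
    also have "\<dots> = Suc n * Suc n * (c * a)" unfolding Suc(2) by (simp add: card_cartesian_product)
    finally have "Suc n * card {E. P V E} \<le> Suc n * (2 * c * (Suc n * a))" by (simp add: algebra_simps)
    then have "card {E. P V E} \<le> 2 * c * (Suc n * a)" by (simp only: Suc_mult_le_cancel1)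
    also have "\<dots> \<le> growth * (Suc n * a)"
      by (rule mult_le_mono1) (simp only: growth_def c_def le_add2)
    finally show ?thesis .
  qed
  then show ?case unfolding Suc(2)[symmetric] by (simp add: a_def algebra_simps)
qed

end

section \<open>Thresholds for spread families\<close>

lemma power_le_exp_fact:
  fixes x :: real
  assumes "0 \<le> x"
  shows "x ^ n \<le> exp x * fact n"
proof -
  have "(\<Sum>k\<in>{n}. x ^ k /\<^sub>R fact k) \<le> (\<Sum>k. x ^ k /\<^sub>R fact k)"
    by (rule sum_le_suminf[OF summable_exp_generic]) (use assms in auto)
  then have "x ^ n /\<^sub>R fact n \<le> exp x" by (simp add: exp_def)
  then show ?thesis by (simp add: field_simps)
qed

text \<open>\<open>ex p S f\<close> is the expectation of \<open>f W\<close> for a \<open>p\<close>-random subset \<open>W\<close> of \<open>S\<close>.\<close>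

definition ex :: "real \<Rightarrow> 'a set \<Rightarrow> ('a set \<Rightarrow> real) \<Rightarrow> real" where
  "ex p S f = (\<Sum>W\<in>Pow S. p ^ card W * (1 - p) ^ (card S - card W) * f W)"

lemma ex_empty [simp]: "ex p {} f = f {}"
  by (simp add: ex_def)

lemma ex_insert:
  assumes "finite S" "x \<notin> S"
  shows "ex p (insert x S) f = p * ex p S (\<lambda>W. f (insert x W)) + (1 - p) * ex p S f"
proof -
  define w where "w W = p ^ card W * (1 - p) ^ (Suc (card S) - card W) * f W" for W
  have "ex p (insert x S) f = sum w (Pow S) + sum w (insert x ` Pow S)"
    unfolding ex_def Pow_insert w_def using assms
    by (subst sum.union_disjoint) auto
  also have "sum w (insert x ` Pow S) = (\<Sum>W\<in>Pow S. w (insert x W))"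
    by (rule sum.reindex_cong[OF _ refl refl]) (use assms(2) in \<open>auto simp: inj_on_def\<close>)
  also have "\<dots> = p * ex p S (\<lambda>W. f (insert x W))"
    unfolding ex_def sum_distrib_left
  proof (rule sum.cong[OF refl])
    fix W assume "W \<in> Pow S"
    then have "card (insert x W) = Suc (card W)"
      using assms by (metis Pow_iff card_insert_disjoint finite_subset subsetD)
    then show "w (insert x W) = p * (p ^ card W * (1 - p) ^ (card S - card W) * f (insert x W))"
      by (simp add: w_def mult_ac)
  qed
  also have "sum w (Pow S) = (1 - p) * ex p S f"
    unfolding ex_def sum_distrib_left
  proof (rule sum.cong[OF refl])
    fix W assume "W \<in> Pow S"
    then have "Suc (card S) - card W = Suc (card S - card W)"
      using card_mono[OF assms(1), of W] by auto
    then show "w W = (1 - p) * (p ^ card W * (1 - p) ^ (card S - card W) * f W)"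
      by (simp add: w_def mult_ac)
  qed
  finally show ?thesis by simp
qed

lemma ex_const: "finite S \<Longrightarrow> ex p S (\<lambda>_. c) = c"
  by (induction rule: finite_induct) (simp_all add: ex_insert algebra_simps)

lemma ex_add: "ex p S (\<lambda>W. f W + g W) = ex p S f + ex p S g"
  unfolding ex_def by (simp add: algebra_simps sum.distrib)

lemma ex_cmult: "ex p S (\<lambda>W. c * f W) = c * ex p S f"
  unfolding ex_def by (simp add: algebra_simps sum_distrib_left)

lemma ex_sum: "ex p S (\<lambda>W. \<Sum>i\<in>I. f i W) = (\<Sum>i\<in>I. ex p S (f i))"
  unfolding ex_def by (simp add: sum_distrib_left) (rule sum.swap)

lemma ex_mono:
  assumes "0 \<le> p" "p \<le> 1" "\<And>W. W \<subseteq> S \<Longrightarrow> f W \<le> g W"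
  shows "ex p S f \<le> ex p S g"
  unfolding ex_def using assms by (intro sum_mono mult_left_mono) auto

lemma ex_superset:
  assumes "finite S" "H \<subseteq> S"
  shows "ex p S (\<lambda>W. of_bool (H \<subseteq> W)) = p ^ card H"
  using assms
proof (induction S arbitrary: H rule: finite_induct)
  case (insert x S)
  show ?case
  proof (cases "x \<in> H")
    case True
    have fH: "finite H" using insert finite_subset by blast
    have "ex p S (\<lambda>W. of_bool (H \<subseteq> insert x W)) = ex p S (\<lambda>W. of_bool (H - {x} \<subseteq> W))"
      by (simp add: subset_insert_iff True)
    also have "\<dots> = p ^ card (H - {x})" by (rule insert.IH) (use insert.prems in auto)
    moreover have "ex p S (\<lambda>W. of_bool (H \<subseteq> W)) = ex p S (\<lambda>_. 0)"
      unfolding ex_def using insert True by (intro sum.cong) auto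
    moreover have "card H = Suc (card (H - {x}))" using True fH by (metis card_Suc_Diff1)
    ultimately show ?thesis using insert by (simp add: ex_insert ex_const)
  next
    case False
    then have "ex p S (\<lambda>W. of_bool (H \<subseteq> insert x W)) = ex p S (\<lambda>W. of_bool (H \<subseteq> W))"
      by (simp add: subset_insert)
    moreover have "ex p S (\<lambda>W. of_bool (H \<subseteq> W)) = p ^ card H"
      using False insert.prems by (intro insert.IH) auto
    ultimately show ?thesis using insert by (simp add: ex_insert algebra_simps)
  qed
qed simp

text \<open>Lets one random set be exposed in independent rounds: an element is missed by both with
  probability \<open>(1 - p) * (1 - q)\<close>.\<close>

lemma ex_union:
  assumes "finite S"
  shows "ex p S (\<lambda>W. ex q S (\<lambda>W'. f (W \<union> W'))) = ex (p + q - p * q) S f"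
  using assms
proof (induction S arbitrary: f rule: finite_induct)
  case (insert x S)
  let ?a = "ex (p + q - p * q) S (\<lambda>W. f (insert x W))" and ?b = "ex (p + q - p * q) S f"
  have i: "insert x W \<union> W' = insert x (W \<union> W')" "W \<union> insert x W' = insert x (W \<union> W')" for W W'
    by auto
  have "ex p (insert x S) (\<lambda>W. ex q (insert x S) (\<lambda>W'. f (W \<union> W'))) =
     p * (q * ?a + (1 - q) * ?a) + (1 - p) * (q * ?a + (1 - q) * ?b)"
    using insert(1,2) insert.IH[of f] insert.IH[of "\<lambda>W. f (insert x W)"]
    by (simp add: ex_insert i ex_add ex_cmult) (simp add: algebra_simps)
  also have "\<dots> = ex (p + q - p * q) (insert x S) f"
    using insert(1,2) by (simp add: ex_insert algebra_simps)
  finally show ?case .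
qed simp

lemma ex_mono_prob:
  assumes "finite S" "0 \<le> p" "p \<le> q" "q \<le> 1"
    and "\<And>W W'. W \<subseteq> W' \<Longrightarrow> f W \<le> f W'"
  shows "ex p S f \<le> ex q S f"
  using assms(1,5)
proof (induction S arbitrary: f rule: finite_induct)
  case (insert x S)
  let ?a = "ex p S (\<lambda>W. f (insert x W))" and ?b = "ex p S f"
  have ab: "?b \<le> ?a"
  proof (rule ex_mono)
    show "f W \<le> f (insert x W)" for W by (rule insert.prems) auto
  qed (use assms in auto)
  have 1: "?a \<le> ex q S (\<lambda>W. f (insert x W))" by (intro insert.IH insert.prems) auto
  have 2: "?b \<le> ex q S f" by (intro insert.IH insert.prems)
  have "p * ?a + (1 - p) * ?b \<le> q * ?a + (1 - q) * ?b"
  proof -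
    have "0 \<le> (q - p) * (?a - ?b)" using ab assms by simp
    then show ?thesis by (simp add: algebra_simps)
  qed
  also have "\<dots> \<le> q * ex q S (\<lambda>W. f (insert x W)) + (1 - q) * ex q S f"
    using 1 2 assms by (intro add_mono mult_left_mono) auto
  finally show ?case using insert(1,2) by (simp add: ex_insert)
qed simp

lemma finite_all_edges: "finite (all_edges N)"
  by (rule finite_subset[of _ "Pow {..<N}"]) (auto simp: all_edges_def)

lemma Gnp_prob_eq_ex: "Gnp_prob N p P = ex p (all_edges N) (\<lambda>E. of_bool (P E))"
  unfolding Gnp_prob_def ex_def
  by (rule sum.mono_neutral_cong_left) (auto simp: finite_all_edges)

text \<open>Spreadness of a uniformly random index rather than of a random set, since many
  permutations may give the same copy. The slack \<open>K\<close> pays for the indices discarded in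
  a round.\<close>

definition spread :: "real \<Rightarrow> real \<Rightarrow> 'a set \<Rightarrow> 'i set \<Rightarrow> ('i \<Rightarrow> 'a set) \<Rightarrow> bool" where
  "spread K \<kappa> X I S \<longleftrightarrow> finite X \<and> finite I \<and> I \<noteq> {} \<and> (\<forall>i\<in>I. S i \<subseteq> X) \<and>
     (\<forall>B\<subseteq>X. real (card {i \<in> I. B \<subseteq> S i}) \<le> K * (1 / \<kappa>) ^ card B * card I)"

text \<open>The missing part of a cheapest member covered by \<open>W \<union> S i\<close>. Adding
  it to \<open>W\<close> completes some member of the family, which may differ from
  \<open>S i\<close>.\<close>

definition fragment :: "'i set \<Rightarrow> ('i \<Rightarrow> 'a set) \<Rightarrow> 'a set \<Rightarrow> 'i \<Rightarrow> 'a set" where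
  "fragment I S W i = S (arg_min (\<lambda>j. card (S j - W)) (\<lambda>j. j \<in> I \<and> S j \<subseteq> W \<union> S i)) - W"

lemma fragment:
  assumes "i \<in> I"
  obtains j where "j \<in> I" "S j \<subseteq> W \<union> S i" "fragment I S W i = S j - W"
    "\<And>j'. j' \<in> I \<Longrightarrow> S j' \<subseteq> W \<union> S i \<Longrightarrow> card (fragment I S W i) \<le> card (S j' - W)"
proof -
  define j where "j = arg_min (\<lambda>j. card (S j - W)) (\<lambda>j. j \<in> I \<and> S j \<subseteq> W \<union> S i)"
  have i: "i \<in> I \<and> S i \<subseteq> W \<union> S i" using assms by auto
  have "j \<in> I \<and> S j \<subseteq> W \<union> S i" unfolding j_def 
    by (rule arg_min_natI[of "\<lambda>j. j \<in> I \<and> S j \<subseteq> W \<union> S i" i, OF i])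
  moreover have "card (S j - W) \<le> card (S j' - W)" if "j' \<in> I" "S j' \<subseteq> W \<union> S i" for j'
    unfolding j_def by (rule arg_min_nat_le) (use that in auto)
  moreover have "fragment I S W i = S j - W" by (simp add: fragment_def j_def)
  ultimately show ?thesis using that by auto
qed

lemma fragment_subset: "i \<in> I \<Longrightarrow> fragment I S W i \<subseteq> S i - W"
  by (rule fragment[of i I S W]) auto

text \<open>Let \<open>T\<close> be the fragment and \<open>Z = W \<union> T\<close>.  By minimality \<open>T\<close> lies in whichever member of the
  family inside \<open>Z\<close> one fixes beforehand, so \<open>Z\<close> leaves few choices for \<open>T\<close>, and the spread
  property leaves few choices for \<open>i\<close>.\<close>

lemma expected_fragments_of_size:
  assumes sp: "spread K \<kappa> X I S" and p: "0 < p" "p < 1" and \<kappa>: "0 < \<kappa>" and K: "0 \<le> K"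
    and L: "\<And>i. i \<in> I \<Longrightarrow> card (S i) \<le> L"
  shows "ex p X (\<lambda>W. card {i \<in> I. card (fragment I S W i) = t}) \<le> real (L choose t) * K * (1 / (p * \<kappa>)) ^ t * card I"
proof -
  have fin: "finite X" "finite I" "I \<noteq> {}" and SX: "\<And>i. i \<in> I \<Longrightarrow> S i \<subseteq> X"
    and B: "\<And>B. B \<subseteq> X \<Longrightarrow> real (card {i \<in> I. B \<subseteq> S i}) \<le> K * (1 / \<kappa>) ^ card B * card I"
    using sp by (auto simp: spread_def)
  define w where "w W = p ^ card W * (1 - p) ^ (card X - card W)" for W :: "'a set"
  define T where "T = fragment I S"
  \<comment> \<open>If no member lies in \<open>Z\<close>, this is an arbitrary index, so
    \<open>J Z\<close> is in \<open>I\<close> throughout. It depends on \<open>Z\<close> alone, and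
    that is why only subsets of the one set \<open>S (J Z)\<close> have to be counted.\<close>
  define J where "J Z = (SOME j. j \<in> I \<and> ((\<exists>j\<in>I. S j \<subseteq> Z) \<longrightarrow> S j \<subseteq> Z))" for Z
  have "\<exists>j. j \<in> I \<and> ((\<exists>j\<in>I. S j \<subseteq> Z) \<longrightarrow> S j \<subseteq> Z)" for Z using fin(3) by auto
  then have J: "J Z \<in> I \<and> ((\<exists>j\<in>I. S j \<subseteq> Z) \<longrightarrow> S (J Z) \<subseteq> Z)" for Z
    unfolding J_def by (rule someI_ex)
  define A where "A = (SIGMA W : Pow X. {i \<in> I. card (T W i) = t})"
  define C where "C = (SIGMA Z : Pow X. SIGMA U : {U. U \<subseteq> S (J Z) \<and> card U = t}. {i \<in> I. U \<subseteq> S i})"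
  \<comment> \<open>The fragment is disjoint from \<open>W\<close>, so \<open>W\<close> is recovered
    from the pair as \<open>Z - U\<close>.\<close>
  define \<phi> where "\<phi> = (\<lambda>(W, i). (W \<union> T W i, T W i, i))"
  have fS: "finite (S j)" if "j \<in> I" for j using SX[OF that] fin finite_subset by blast
  have finC: "finite {U. U \<subseteq> S (J Z) \<and> card U = t}" for Z
    by (rule finite_subset[of _ "Pow (S (J Z))"]) (use fS J in auto)
  have TW: "T W i \<subseteq> S i" "T W i \<inter> W = {}" if "i \<in> I" for W i
    using fragment_subset[OF that, of S W] by (auto simp: T_def)
  have inj: "inj_on \<phi> A"
  proof (rule inj_on_inverseI[where g = "\<lambda>(Z, U, i). (Z - U, i)"])
    fix a assume "a \<in> A"
    then obtain W i where a: "a = (W, i)" "i \<in> I" by (auto simp: A_def)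
    have "W \<union> T W i - T W i = W" using TW(2)[OF a(2), of W] by auto
    then show "(case \<phi> a of (Z, U, i) \<Rightarrow> (Z - U, i)) = a" using a by (simp add: \<phi>_def)
  qed
  have img: "\<phi> ` A \<subseteq> C"
  proof
    fix c assume "c \<in> \<phi> ` A"
    then obtain W i where a: "W \<subseteq> X" "i \<in> I" "card (T W i) = t" "c = (W \<union> T W i, T W i, i)"
      by (auto simp: A_def \<phi>_def)
    define Z where "Z = W \<union> T W i"
    obtain j where j: "j \<in> I" "S j \<subseteq> W \<union> S i" "T W i = S j - W"
      "\<And>j'. j' \<in> I \<Longrightarrow> S j' \<subseteq> W \<union> S i \<Longrightarrow> card (T W i) \<le> card (S j' - W)"
      using fragment[OF a(2), of S W] unfolding T_def by metis
    have "S j \<subseteq> Z" using j(3) by (auto simp: Z_def)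
    then have JZ: "J Z \<in> I" "S (J Z) \<subseteq> Z" using J[of Z] j(1) by auto
    have "S (J Z) \<subseteq> W \<union> S i" using JZ(2) TW(1)[OF a(2), of W] by (auto simp: Z_def)
    then have "card (T W i) \<le> card (S (J Z) - W)" using j(4) JZ by auto
    moreover have "S (J Z) - W \<subseteq> T W i" using JZ(2) by (auto simp: Z_def)
    moreover have "finite (T W i)" using j fS by auto
    ultimately have "S (J Z) - W = T W i" by (metis card_seteq)
    then have "T W i \<subseteq> S (J Z)" by auto
    moreover have "Z \<subseteq> X" using a(1) TW(1)[OF a(2), of W] SX[OF a(2)] by (auto simp: Z_def)
    ultimately show "c \<in> C" using a TW(1)[OF a(2), of W] by (auto simp: C_def Z_def)
  qed
  \<comment> \<open>Adding \<open>t\<close> elements to \<open>W\<close> multiplies its weight by at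
    least \<open>p ^ t\<close>, since the exponent of \<open>1 - p\<close> only falls.\<close>
  have wle: "w W \<le> w (W \<union> T W i) * (1 / p) ^ t" if a: "W \<subseteq> X" "i \<in> I" "card (T W i) = t" for W i
  proof -
    have f: "finite W" "finite (T W i)" using a TW[OF a(2), of W] fS fin finite_subset by blast+
    have c: "card (W \<union> T W i) = card W + t" using TW(2)[OF a(2), of W] f a(3) by (subst card_Un_disjoint) auto
    have "W \<union> T W i \<subseteq> X" using a TW(1)[OF a(2), of W] SX[OF a(2)] by auto
    then have "card W + t \<le> card X" using c card_mono[OF fin(1)] by metis
    then have "(1 - p) ^ (card X - card W) \<le> (1 - p) ^ (card X - (card W + t))"
      using p by (intro power_decreasing) auto
    then have "w W \<le> p ^ card W * (1 - p) ^ (card X - (card W + t))" unfolding w_def using p by simp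
    also have "\<dots> = w (W \<union> T W i) * (1 / p) ^ t" unfolding w_def c using p
      by (simp add: power_add field_simps)
    finally show ?thesis .
  qed
  have "ex p X (\<lambda>W. card {i \<in> I. card (T W i) = t}) = (\<Sum>W\<in>Pow X. \<Sum>i\<in>{i \<in> I. card (T W i) = t}. w W)"
    unfolding ex_def w_def by (simp add: mult_ac)
  also have "\<dots> = (\<Sum>a\<in>A. w (fst a))"
    unfolding A_def using fin by (subst sum.Sigma) (auto simp: case_prod_beta)
  also have "\<dots> \<le> (\<Sum>a\<in>A. w (fst (\<phi> a)) * (1 / p) ^ t)"
    by (rule sum_mono) (use wle in \<open>auto simp: A_def \<phi>_def\<close>)
  also have "\<dots> = (\<Sum>c\<in>\<phi> ` A. w (fst c) * (1 / p) ^ t)" by (subst sum.reindex[OF inj]) simp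
  also have "\<dots> \<le> (\<Sum>c\<in>C. w (fst c) * (1 / p) ^ t)"
    using fin finC p by (intro sum_mono2[OF _ img]) (auto simp: C_def w_def)
  also have "\<dots> = (\<Sum>Z\<in>Pow X. \<Sum>U\<in>{U. U \<subseteq> S (J Z) \<and> card U = t}. \<Sum>i\<in>{i \<in> I. U \<subseteq> S i}. w Z * (1 / p) ^ t)"
  proof -
    have 1: "(\<Sum>c\<in>C. w (fst c) * (1 / p) ^ t) = (\<Sum>Z\<in>Pow X. \<Sum>c\<in>(SIGMA U : {U. U \<subseteq> S (J Z) \<and> card U = t}. {i \<in> I. U \<subseteq> S i}). w Z * (1 / p) ^ t)"
      unfolding C_def using fin finC by (subst sum.Sigma) (auto simp: case_prod_beta)
    show ?thesis unfolding 1
      by (rule sum.cong[OF refl]) (use fin finC in \<open>subst sum.Sigma, auto simp: case_prod_beta\<close>)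
  qed
  also have "\<dots> \<le> (\<Sum>Z\<in>Pow X. w Z * (real (L choose t) * (1 / p) ^ t * (K * (1 / \<kappa>) ^ t * card I)))"
  proof (rule sum_mono)
    fix Z assume "Z \<in> Pow X"
    have wZ: "0 \<le> w Z * (1 / p) ^ t" using p by (simp add: w_def)
    have "(\<Sum>U\<in>{U. U \<subseteq> S (J Z) \<and> card U = t}. \<Sum>i\<in>{i \<in> I. U \<subseteq> S i}. w Z * (1 / p) ^ t)
      \<le> (\<Sum>U\<in>{U. U \<subseteq> S (J Z) \<and> card U = t}. (w Z * (1 / p) ^ t) * (K * (1 / \<kappa>) ^ t * card I))"
    proof (rule sum_mono)
      fix U assume U: "U \<in> {U. U \<subseteq> S (J Z) \<and> card U = t}"
      then have "U \<subseteq> X" using SX J by blast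
      then have "real (card {i \<in> I. U \<subseteq> S i}) \<le> K * (1 / \<kappa>) ^ t * card I" using B[of U] U by auto
      then have "(w Z * (1 / p) ^ t) * real (card {i \<in> I. U \<subseteq> S i}) \<le> (w Z * (1 / p) ^ t) * (K * (1 / \<kappa>) ^ t * card I)"
        using wZ by (rule mult_left_mono)
      then show "(\<Sum>i\<in>{i \<in> I. U \<subseteq> S i}. w Z * (1 / p) ^ t) \<le> (w Z * (1 / p) ^ t) * (K * (1 / \<kappa>) ^ t * card I)"
        by (simp add: mult_ac)
    qed
    also have "\<dots> = real (card (S (J Z)) choose t) * ((w Z * (1 / p) ^ t) * (K * (1 / \<kappa>) ^ t * card I))"
      using n_subsets[OF fS, of "J Z" t] J by simp
    also have "\<dots> \<le> real (L choose t) * ((w Z * (1 / p) ^ t) * (K * (1 / \<kappa>) ^ t * card I))"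
    proof (rule mult_right_mono)
      show "real (card (S (J Z)) choose t) \<le> real (L choose t)"
        using binomial_right_mono[OF L[of "J Z"], of t] J by simp
      show "0 \<le> (w Z * (1 / p) ^ t) * (K * (1 / \<kappa>) ^ t * card I)"
        using wZ K \<kappa> by (intro mult_nonneg_nonneg[OF wZ] mult_nonneg_nonneg) auto
    qed
    finally show "(\<Sum>U\<in>{U. U \<subseteq> S (J Z) \<and> card U = t}. \<Sum>i\<in>{i \<in> I. U \<subseteq> S i}. w Z * (1 / p) ^ t)
      \<le> w Z * (real (L choose t) * (1 / p) ^ t * (K * (1 / \<kappa>) ^ t * card I))" by (simp add: mult_ac)
  qed
  also have "\<dots> = ex p X (\<lambda>_. real (L choose t) * (1 / p) ^ t * (K * (1 / \<kappa>) ^ t * card I))"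
    unfolding ex_def w_def by simp
  also have "\<dots> = real (L choose t) * K * (1 / (p * \<kappa>)) ^ t * card I"
    using fin p \<kappa> by (simp add: ex_const power_divide field_simps)
  finally show ?thesis by (simp add: T_def)
qed

lemma sum_power_le_twice:
  fixes x :: real
  assumes "0 \<le> x" "x \<le> 1 / 2"
  shows "(\<Sum>t = 1..n. x ^ t) \<le> 2 * x"
proof -
  have "(\<Sum>t = 1..n. x ^ t) + 2 * x ^ Suc n \<le> 2 * x"
  proof (induction n)
    case (Suc n)
    have "x * x ^ Suc n \<le> (1 / 2) * x ^ Suc n" using assms by (intro mult_right_mono) auto
    then show ?case using Suc by simp
  qed simp
  moreover have "0 \<le> 2 * x ^ Suc n" using assms by simp
  ultimately show ?thesis by linarith
qed

lemma binomial_le_exp_power: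
  assumes "0 < t"
  shows "real (L choose t) \<le> (exp 1 * L / t) ^ t"
proof -
  have "real t ^ t \<le> exp 1 ^ t * fact t" using power_le_exp_fact[of "real t" t] exp_of_nat_mult[of t "1::real"] by simp
  then have "real (L choose t) * real t ^ t \<le> real (L choose t) * (exp 1 ^ t * fact t)"
    by (intro mult_left_mono) auto
  also have "\<dots> = exp 1 ^ t * real ((L choose t) * fact t)" by (simp add: mult_ac)
  also have "\<dots> \<le> exp 1 ^ t * real (L ^ t)"
    using binomial_fact_pow[of L t] by (intro mult_left_mono) (simp_all del: of_nat_mult of_nat_power)
  finally show ?thesis using assms by (simp add: power_divide power_mult_distrib field_simps)
qed

text \<open>For sizes \<open>t > L / M\<close>, \<open>binomial_le_exp_power\<close> gives at most
  \<open>(exp 1 * L / (t * p * \<kappa>)) ^ t\<close>, and \<open>L / t < M\<close> with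
  \<open>M ^ 2 \<le> p * \<kappa>\<close> turns this into \<open>(exp 1 / M) ^ t\<close>. The
  condition \<open>2 * exp 1 \<le> M\<close> makes the ratio of the geometric sum at most
  1/2.\<close>

lemma expected_large_fragments:
  assumes sp: "spread K \<kappa> X I S" and p: "0 < p" "p < 1" and \<kappa>: "0 < \<kappa>" and K: "0 \<le> K"
    and L: "\<And>i. i \<in> I \<Longrightarrow> card (S i) \<le> L" and M: "2 * exp 1 \<le> M" "M ^ 2 \<le> p * \<kappa>"
  shows "ex p X (\<lambda>W. card {i \<in> I. L / M < card (fragment I S W i)}) \<le> 2 * exp 1 / M * K * card I"
proof -
  have M0: "0 < M" using M(1) by (meson exp_gt_zero less_le_trans mult_pos_pos zero_less_numeral)
  have fin: "finite X" "finite I" using sp by (auto simp: spread_def)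
  have fS: "finite (S i)" if "i \<in> I" for i using that sp finite_subset by (auto simp: spread_def)
  define R where "R = {t \<in> {1..L}. L / M < real t}"
  have "card {i \<in> I. L / M < card (fragment I S W i)} = (\<Sum>t\<in>R. card {i \<in> I. card (fragment I S W i) = t})" for W
  proof -
    have "{i \<in> I. L / M < card (fragment I S W i)} = (\<Union>t\<in>R. {i \<in> I. card (fragment I S W i) = t})"
    proof (rule set_eqI, rule iffI)
      fix i assume i: "i \<in> {i \<in> I. L / M < card (fragment I S W i)}"
      have "0 \<le> L / M" using M0 by simp
      then have "card (fragment I S W i) \<noteq> 0" using i by auto
      moreover have "card (fragment I S W i) \<le> card (S i)"
        using fragment_subset[of i I S W] i fS by (intro card_mono) auto
      ultimately show "i \<in> (\<Union>t\<in>R. {i \<in> I. card (fragment I S W i) = t})"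
        using i L[of i] by (auto simp: R_def)
    qed (auto simp: R_def)
    then show ?thesis using fin by (simp add: card_UN_disjoint R_def disjoint_iff)
  qed
  then have "ex p X (\<lambda>W. card {i \<in> I. L / M < card (fragment I S W i)})
      = (\<Sum>t\<in>R. ex p X (\<lambda>W. card {i \<in> I. card (fragment I S W i) = t}))"
    by (simp add: ex_sum)
  also have "\<dots> \<le> (\<Sum>t\<in>R. (exp 1 / M) ^ t * (K * card I))"
  proof (rule sum_mono)
    fix t assume t: "t \<in> R"
    then have t0: "0 < t" "L < t * M" using M0 by (auto simp: R_def field_simps)
    have pk: "0 < p * \<kappa>" using p \<kappa> by simp
    have "real (L choose t) * (1 / (p * \<kappa>)) ^ t \<le> (exp 1 * L / t) ^ t * (1 / (p * \<kappa>)) ^ t"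
      using binomial_le_exp_power[OF t0(1), of L] pk by (intro mult_right_mono) auto
    also have "\<dots> = (exp 1 * (L / (t * (p * \<kappa>)))) ^ t" by (simp add: power_mult_distrib power_divide)
    also have "\<dots> \<le> (exp 1 * (1 / M)) ^ t"
    proof (intro power_mono mult_left_mono)
      have "L * M \<le> (t * M) * M" using t0 M0 by (intro mult_right_mono) auto
      also have "\<dots> \<le> t * (p * \<kappa>)" using M(2) by (simp add: power2_eq_square mult.assoc mult_left_mono)
      finally have "L \<le> (t * (p * \<kappa>)) / M" using M0 by (simp add: pos_le_divide_eq)
      then show "L / (t * (p * \<kappa>)) \<le> 1 / M" by (intro mult_imp_div_pos_le) (use t0 pk in auto)
    qed (use pk in auto)
    finally have *: "real (L choose t) * (1 / (p * \<kappa>)) ^ t \<le> (exp 1 / M) ^ t" by simp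
    have "ex p X (\<lambda>W. card {i \<in> I. card (fragment I S W i) = t})
        \<le> (real (L choose t) * (1 / (p * \<kappa>)) ^ t) * (K * card I)"
      using expected_fragments_of_size[OF sp p \<kappa> K L, of t] by (simp add: mult_ac)
    also have "\<dots> \<le> (exp 1 / M) ^ t * (K * card I)" using * K by (intro mult_right_mono) auto
    finally show "ex p X (\<lambda>W. card {i \<in> I. card (fragment I S W i) = t}) \<le> (exp 1 / M) ^ t * (K * card I)" .
  qed
  also have "\<dots> \<le> (\<Sum>t = 1..L. (exp 1 / M) ^ t * (K * card I))"
    using M0 K by (intro sum_mono2) (auto simp: R_def)
  also have "\<dots> = (\<Sum>t = 1..L. (exp 1 / M) ^ t) * (K * card I)" by (simp add: sum_distrib_right)
  also have "\<dots> \<le> (2 * (exp 1 / M)) * (K * card I)"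
    using M M0 K by (intro mult_right_mono sum_power_le_twice) (auto simp: field_simps)
  finally show ?thesis by (simp add: mult_ac)
qed

text \<open>One round exposes \<open>W\<close>. If at least half of the indices have fragments of
  size at most \<open>L / M\<close>, these fragments are a spread family with constant
  \<open>2 * K\<close>, and covering one of them completes a member of the old family. The failure
  bound obeys \<open>b (r + 1) K \<le> 4 * exp 1 / M * K + b r (2 * K)\<close>, whence the factor
  \<open>r * 2 ^ r\<close>.\<close>

theorem spread_family_threshold:
  assumes "spread K \<kappa> X I S" and p: "0 < p" "p < 1" and \<kappa>: "0 < \<kappa>" and "0 \<le> K"
    and "\<And>i. i \<in> I \<Longrightarrow> card (S i) \<le> L" and M: "2 * exp 1 \<le> M" "M ^ 2 \<le> p * \<kappa>" and "L < M ^ r"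
  shows "ex (1 - (1 - p) ^ r) X (\<lambda>W. of_bool (\<not> (\<exists>i\<in>I. S i \<subseteq> W))) \<le> r * 2 ^ r * (4 * exp 1 / M) * K"
  using assms(1,5,6,9)
proof (induction r arbitrary: I S K L)
  case 0
  then obtain i where i: "i \<in> I" "finite (S i)" unfolding spread_def by (metis all_not_in_conv finite_subset)
  \<comment> \<open>When no round is left, \<open>L < 1\<close>, so the member is empty.\<close>
  have "card (S i) = 0" using 0(3)[OF i(1)] 0(4) by simp
  then have "\<exists>i\<in>I. S i \<subseteq> W" for W using i by auto
  then have "ex (1 - (1 - p) ^ 0) X (\<lambda>W. of_bool (\<not> (\<exists>i\<in>I. S i \<subseteq> W))) = ex (1 - (1 - p) ^ 0) X (\<lambda>W. 0)" by simp
  then show ?case using 0(1) by (simp add: ex_const spread_def)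
next
  case (Suc r)
  note sp = Suc.prems(1) and K = Suc.prems(2)
  have M0: "0 < M" using M(1) by (meson exp_gt_zero less_le_trans mult_pos_pos zero_less_numeral)
  have fin: "finite X" "finite I" "I \<noteq> {}" and SX: "\<And>i. i \<in> I \<Longrightarrow> S i \<subseteq> X"
    and B: "\<And>B. B \<subseteq> X \<Longrightarrow> real (card {i \<in> I. B \<subseteq> S i}) \<le> K * (1 / \<kappa>) ^ card B * card I"
    using sp by (auto simp: spread_def)
  define q where "q = 1 - (1 - p) ^ r"
  have q: "0 \<le> q" "q \<le> 1" using p by (auto simp: q_def power_le_one)
  define F :: "'a set \<Rightarrow> real" where "F W = of_bool (\<not> (\<exists>i\<in>I. S i \<subseteq> W))" for W
  define G where "G W = {i \<in> I. \<not> L / M < card (fragment I S W i)}" for W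
  define c where "c = real r * 2 ^ r * (4 * exp 1 / M) * (2 * K)"
  have c0: "0 \<le> c" using K M0 by (simp add: c_def)
  have cI: "0 < card I" using fin by (simp add: card_gt_0_iff)
  \<comment> \<open>The first summand is Markov's inequality in pointwise form: it is at least 1
    whenever too few short fragments remain for the induction hypothesis.\<close>
  have inner: "ex q X (\<lambda>W'. F (W \<union> W')) \<le> 2 / card I * card {i \<in> I. L / M < card (fragment I S W i)} + c"
    if W: "W \<subseteq> X" for W
  proof (cases "card I \<le> 2 * card (G W)")
    case False
    define H where "H = {i \<in> I. L / M < card (fragment I S W i)}"
    have "I = G W \<union> H" by (auto simp: G_def H_def)
    then have "card I \<le> card (G W) + card H" by (metis card_Un_le)
    then have "card I \<le> 2 * card H" using False by linarith
    then have "real (card I) \<le> 2 * real (card H)" by linarith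
    then have "1 \<le> 2 * real (card H) / real (card I)" using cI by (simp only: le_divide_eq_1_pos of_nat_0_less_iff)
    then have "1 \<le> 2 / card I * card {i \<in> I. L / M < card (fragment I S W i)}" by (simp add: H_def)
    moreover have "ex q X (\<lambda>W'. F (W \<union> W')) \<le> ex q X (\<lambda>_. 1)" by (intro ex_mono q) (simp add: F_def)
    ultimately show ?thesis using c0 fin by (simp add: ex_const)
  next
    case True
    have sp': "spread (2 * K) \<kappa> X (G W) (fragment I S W)"
      unfolding spread_def
    proof (intro conjI allI impI ballI)
      have "card (G W) \<noteq> 0" using True cI by linarith
      then show "G W \<noteq> {}" by auto
      show "finite X" "finite (G W)" using fin by (auto simp: G_def)
      show "fragment I S W i \<subseteq> X" if "i \<in> G W" for i
        using fragment_subset[of i I S W] SX[of i] that by (auto simp: G_def)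
      fix U assume U: "U \<subseteq> X"
      have "{i \<in> G W. U \<subseteq> fragment I S W i} \<subseteq> {i \<in> I. U \<subseteq> S i}"
        using fragment_subset[of _ I S W] by (auto simp: G_def)
      then have "real (card {i \<in> G W. U \<subseteq> fragment I S W i}) \<le> real (card {i \<in> I. U \<subseteq> S i})"
        using fin by (intro of_nat_mono card_mono) auto
      also have "\<dots> \<le> K * (1 / \<kappa>) ^ card U * card I" by (rule B[OF U])
      also have "\<dots> \<le> K * (1 / \<kappa>) ^ card U * (2 * card (G W))"
        using True K \<kappa> by (intro mult_left_mono) auto
      finally show "real (card {i \<in> G W. U \<subseteq> fragment I S W i}) \<le> 2 * K * (1 / \<kappa>) ^ card U * card (G W)"
        by (simp add: mult_ac)
    qed
    define L' where "L' = nat \<lfloor>L / M\<rfloor>"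
    have small: "card (fragment I S W i) \<le> L'" if "i \<in> G W" for i
      using that M0 by (simp add: G_def L'_def le_nat_floor)
    have "real L' \<le> L / M" using M0 by (simp add: L'_def)
    also have "\<dots> < M ^ r" using Suc.prems(4) M0 by (simp add: field_simps)
    finally have "real L' < M ^ r" .
    then have IH: "ex q X (\<lambda>W'. of_bool (\<not> (\<exists>i\<in>G W. fragment I S W i \<subseteq> W'))) \<le> c"
      unfolding q_def c_def by (intro Suc.IH[OF sp' _ small]) (use K in auto)
    have "ex q X (\<lambda>W'. F (W \<union> W')) \<le> ex q X (\<lambda>W'. of_bool (\<not> (\<exists>i\<in>G W. fragment I S W i \<subseteq> W')))"
    proof (rule ex_mono[OF q])
      fix W' assume "W' \<subseteq> X"
      have "\<exists>j\<in>I. S j \<subseteq> W \<union> W'" if i: "i \<in> G W" "fragment I S W i \<subseteq> W'" for i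
      proof -
        have "i \<in> I" using i by (simp add: G_def)
        then obtain j where "j \<in> I" "fragment I S W i = S j - W" by (rule fragment)
        then show ?thesis using i(2) by auto
      qed
      then show "F (W \<union> W') \<le> of_bool (\<not> (\<exists>i\<in>G W. fragment I S W i \<subseteq> W'))"
        by (auto simp: F_def)
    qed
    also have "\<dots> \<le> c" by (rule IH)
    also have "\<dots> \<le> 2 / card I * card {i \<in> I. L / M < card (fragment I S W i)} + c" by simp
    finally show ?thesis .
  qed
  have "1 - (1 - p) ^ Suc r = p + q - p * q" by (simp add: q_def algebra_simps)
  then have "ex (1 - (1 - p) ^ Suc r) X F = ex p X (\<lambda>W. ex q X (\<lambda>W'. F (W \<union> W')))"
    using fin by (simp add: ex_union)
  also have "\<dots> \<le> ex p X (\<lambda>W. 2 / card I * card {i \<in> I. L / M < card (fragment I S W i)} + c)"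
    using p by (intro ex_mono inner) auto
  also have "\<dots> = 2 / card I * ex p X (\<lambda>W. card {i \<in> I. L / M < card (fragment I S W i)}) + c"
    using fin by (simp only: ex_add ex_cmult ex_const)
  also have "\<dots> \<le> 2 / card I * (2 * exp 1 / M * K * card I) + c"
    using expected_large_fragments[OF sp p \<kappa> K Suc.prems(3) M] by (intro add_right_mono mult_left_mono) auto
  also have "\<dots> = 4 * exp 1 / M * K + c" using cI by simp
  also have "\<dots> \<le> 2 ^ Suc r * (4 * exp 1 / M * K) + c"
  proof -
    have "1 * (4 * exp 1 / M * K) \<le> 2 ^ Suc r * (4 * exp 1 / M * K)"
      by (rule mult_right_mono[OF two_realpow_ge_one]) (use K M0 in simp)
    then show ?thesis by simp
  qed
  also have "\<dots> = real (Suc r) * 2 ^ Suc r * (4 * exp 1 / M) * K"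
    by (simp add: c_def algebra_simps)
  finally show ?case unfolding F_def[abs_def] .
qed

section \<open>The first moment bound\<close>

text \<open>The density bound asks for a missing complete graph, and six vertices are what the
  complete bipartite graph on three and three vertices takes.\<close>

lemma plane_model_pairs_card:
  assumes "plane_model V (pairs V)"
  shows "card V \<noteq> 6"
proof
  assume "card V = 6"
  then have "finite V" by (metis card.infinite zero_neq_numeral)
  then obtain xs where xs: "set xs = V" "distinct xs" using finite_distinct_list by blast
  then have "length xs = 6" using \<open>card V = 6\<close> distinct_card by fastforce
  then obtain a1 a2 a3 b1 b2 b3 where l: "xs = [a1, a2, a3, b1, b2, b3]"
    by (auto simp: numeral_eq_Suc length_Suc_conv)
  define E where "E = (\<lambda>(a, b). {a, b}) ` ({a1, a2, a3} \<times> {b1, b2, b3})"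
  have d: "distinct [a1, a2, a3, b1, b2, b3]" and V: "V = {a1, a2, a3, b1, b2, b3}"
    using xs l by auto
  have E: "\<exists>a b. e = {a, b} \<and> a \<in> V \<and> b \<in> V \<and> a \<noteq> b" if "e \<in> E" for e
  proof -
    from that obtain a b where "e = {a, b}" "a \<in> {a1, a2, a3}" "b \<in> {b1, b2, b3}"
      unfolding E_def by blast
    moreover from this have "a \<in> V" "b \<in> V" "a \<noteq> b" using d V by auto
    ultimately show ?thesis by blast
  qed
  have "E \<subseteq> pairs V" using E unfolding pairs_def by blast
  moreover have "e \<subseteq> V" if "e \<in> E" for e using E[OF that] by auto
  ultimately have "plane_model V E" by (intro plane_model_mono[OF assms]) auto
  then show False by (rule plane_model_no_K33[OF _ d _ E_def]) (use V in auto)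
qed

lemma plane_model_edge:
  assumes "plane_model V E" and e: "e \<in> E"
  shows "e \<in> pairs V"
proof -
  from assms(1)[unfolded plane_model_def] obtain T :: "nat \<Rightarrow> complex set"
    and \<gamma> :: "nat set \<Rightarrow> real \<Rightarrow> complex" where
    "\<forall>v\<in>V. compact (T v) \<and> connected (T v) \<and> connected (- T v) \<and> T v \<noteq> {}" and
    "\<forall>u\<in>V. \<forall>v\<in>V. u \<noteq> v \<longrightarrow> T u \<inter> T v = {}" and
    \<gamma>: "\<forall>e\<in>E. \<exists>u\<in>V. \<exists>w\<in>V. u \<noteq> w \<and> e = {u, w} \<and> arc (\<gamma> e) \<and>
        path_image (\<gamma> e) \<inter> T u = {pathstart (\<gamma> e)} \<and> path_image (\<gamma> e) \<inter> T w = {pathfinish (\<gamma> e)}" and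
    "\<forall>e\<in>E. \<forall>x\<in>V. x \<notin> e \<longrightarrow> path_image (\<gamma> e) \<inter> T x = {}" and
    "\<forall>e\<in>E. \<forall>e'\<in>E. e \<noteq> e' \<longrightarrow> path_image (\<gamma> e) \<inter> path_image (\<gamma> e') \<subseteq> \<Union> (T ` V)"
    by (elim exE conjE)
  show ?thesis using \<gamma>[rule_format, OF e] unfolding pairs_def by auto
qed

interpretation plane: sparse_minor_class plane_model "mader 5"
proof -
  have m: "minor_class plane_model"
  proof
    fix V E e assume "plane_model V E" "e \<in> E"
    then show "e \<in> pairs V" by (rule plane_model_edge)
  next
    fix V E V' E' assume "plane_model V E" "V' \<subseteq> V" "E' \<subseteq> E" "\<And>e. e \<in> E' \<Longrightarrow> e \<subseteq> V'"
    then show "plane_model V' E'" by (rule plane_model_mono)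
  next
    fix V E u v assume "plane_model V E" "{u, v} \<in> E" "u \<noteq> v"
    then show "plane_model (V - {v}) (contract u v E)" by (rule plane_model_contract)
  qed
  interpret minor_class plane_model by (rule m)
  show "sparse_minor_class plane_model (mader 5)"
  proof
    fix V E assume "plane_model V E" "finite V"
    then show "card E \<le> mader 5 * card V"
      by (intro minor_class_density[OF m]) (use plane_model_pairs_card in auto)
  qed
qed

lemma card_planar_graphs:
  "card {E. E \<subseteq> all_edges N \<and> planar N E} \<le> plane.growth ^ N * fact N"
proof -
  have "card {E. E \<subseteq> all_edges N \<and> planar N E} \<le> card {E. plane_model {..<N} E}"
    by (intro card_mono plane.finite_class) (auto intro: planar_imp_plane_model)
  also have "\<dots> \<le> plane.growth ^ card {..<N} * fact (card {..<N})" by (rule plane.card_class) simp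
  finally show ?thesis by simp
qed

lemma card_maximal_planar_girth:
  assumes "maximal_planar_girth g ((g - 2) * n + 2) H" "3 \<le> g"
  shows "card H = g * n"
proof -
  have "real (card H) * (real g - 2) = real g * (real ((g - 2) * n + 2) - 2)"
    using assms(1) by (simp add: maximal_planar_girth_def)
  also have "real ((g - 2) * n + 2) - 2 = (real g - 2) * real n" using assms(2) by (simp add: of_nat_diff)
  finally have "(real g - 2) * real (card H) = (real g - 2) * (real g * real n)" by (simp add: mult_ac)
  then have "real (card H) = real g * real n" using assms(2) by (subst (asm) mult_left_cancel) auto
  then show ?thesis by (metis of_nat_eq_iff of_nat_mult)
qed

lemma first_moment_bound:
  fixes p :: real
  assumes "3 \<le> g" "0 \<le> p" "p \<le> 1"
  shows "Gnp_prob ((g - 2) * n + 2) p (has_spanning_mpg g ((g - 2) * n + 2))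
    \<le> real (plane.growth * ((g - 2) * n + 2)) ^ ((g - 2) * n + 2) * p ^ (g * n)"
proof -
  define N where "N = (g - 2) * n + 2"
  define M where "M = {H. H \<subseteq> all_edges N \<and> maximal_planar_girth g N H}"
  have fM: "finite M" unfolding M_def by (rule finite_subset[of _ "Pow (all_edges N)"]) (auto simp: finite_all_edges)
  have "Gnp_prob N p (has_spanning_mpg g N) \<le> ex p (all_edges N) (\<lambda>E. \<Sum>H\<in>M. of_bool (H \<subseteq> E))"
    unfolding Gnp_prob_eq_ex
  proof (rule ex_mono[OF assms(2,3)])
    fix E assume E: "E \<subseteq> all_edges N"
    show "of_bool (has_spanning_mpg g N E) \<le> (\<Sum>H\<in>M. of_bool (H \<subseteq> E) :: real)"
    proof (cases "has_spanning_mpg g N E")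
      case True
      then obtain H where H: "H \<in> M" "H \<subseteq> E" using E by (auto simp: has_spanning_mpg_def M_def)
      have "of_bool (H \<subseteq> E) \<le> (\<Sum>H\<in>M. of_bool (H \<subseteq> E) :: real)"
        by (rule member_le_sum) (use H fM in auto)
      then show ?thesis using H True by simp
    qed (simp add: sum_nonneg)
  qed
  also have "\<dots> = (\<Sum>H\<in>M. p ^ card H)"
    unfolding ex_sum by (rule sum.cong) (auto simp: M_def ex_superset finite_all_edges)
  also have "\<dots> = (\<Sum>H\<in>M. p ^ (g * n))"
    by (rule sum.cong) (use card_maximal_planar_girth[of g n] assms in \<open>auto simp: M_def N_def\<close>)
  also have "\<dots> = card M * p ^ (g * n)" by simp
  also have "\<dots> \<le> real (plane.growth * N) ^ N * p ^ (g * n)"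
  proof (rule mult_right_mono)
    have "card M \<le> card {E. E \<subseteq> all_edges N \<and> planar N E}"
      by (intro card_mono) (auto simp: M_def maximal_planar_girth_def finite_all_edges)
    also have "\<dots> \<le> plane.growth ^ N * fact N" by (rule card_planar_graphs)
    also have "\<dots> \<le> plane.growth ^ N * N ^ N" using fact_le_power[of N, where 'a = nat] by simp
    finally have "card M \<le> (plane.growth * N) ^ N" by (simp add: power_mult_distrib)
    then have "real (card M) \<le> real ((plane.growth * N) ^ N)" by (rule of_nat_mono)
    then show "real (card M) \<le> real (plane.growth * N) ^ N" by simp
  qed (use assms in simp)
  finally show ?thesis unfolding N_def .
qed

theorem mpg_below_threshold:
  assumes "3 \<le> g"
  shows "\<exists>c > 0. \<forall>p :: nat \<Rightarrow> real. (\<forall>n. 0 \<le> p n \<and> p n \<le> 1) \<longrightarrow>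
    (\<forall>\<^sub>F n in at_top. p n \<le> (c / real n) powr ((real g - 2) / real g)) \<longrightarrow>
    (\<lambda>n. Gnp_prob ((g - 2) * n + 2) (p n) (has_spanning_mpg g ((g - 2) * n + 2))) \<longlonglongrightarrow> 0"
proof -
  define B :: real where "B = real plane.growth * real g"
  have "1 \<le> real plane.growth" by (simp add: plane.growth_def)
  then have "1 * 1 \<le> real plane.growth * real g" by (rule mult_mono) (use assms in auto)
  then have B: "1 \<le> B" by (simp add: B_def)
  \<comment> \<open>At most \<open>(B * n) ^ (m + 2)\<close> candidates occur with probability at
    most \<open>(c / n) ^ m\<close> each. The product is \<open>(B * n) ^ 2 * (B * c) ^ m\<close>,
    and \<open>B * c\<close> is made 1/2.\<close>
  define c where "c = 1 / (2 * B)"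
  have c: "0 < c" using B by (simp add: c_def)
  show ?thesis
  proof (intro exI[of _ c] conjI c allI impI)
    fix p :: "nat \<Rightarrow> real"
    assume p01: "\<forall>n. 0 \<le> p n \<and> p n \<le> 1"
      and p: "\<forall>\<^sub>F n in at_top. p n \<le> (c / real n) powr ((real g - 2) / real g)"
    define X where "X n = Gnp_prob ((g - 2) * n + 2) (p n) (has_spanning_mpg g ((g - 2) * n + 2))" for n
    \<comment> \<open>This is \<open>B ^ 2 * n ^ 2 / 2 ^ n\<close>, written as a square so that
      \<open>lim_n_over_pown\<close> applies.\<close>
    have lim: "(\<lambda>n. B ^ 2 * (real n / sqrt 2 ^ n) ^ 2) \<longlonglongrightarrow> B ^ 2 * 0 ^ 2"
      by (intro tendsto_intros lim_n_over_pown) simp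
    have "X n \<le> B ^ 2 * (real n / sqrt 2 ^ n) ^ 2"
      if n: "0 < n" and pn: "p n \<le> (c / real n) powr ((real g - 2) / real g)" for n
    proof -
      define m where "m = (g - 2) * n"
      have mn: "n \<le> m" "m + 2 \<le> g * n"
      proof -
        have "1 \<le> g - 2" using assms by arith
        then show "n \<le> m" using mult_le_mono1[of 1 "g - 2" n] by (simp add: m_def)
        have "(g - 2) * n + 2 * n = (g - 2 + 2) * n" by (simp only: add_mult_distrib)
        also have "g - 2 + 2 = g" using assms by simp
        finally have "m + 2 * n = g * n" by (simp add: m_def)
        then show "m + 2 \<le> g * n" using n by simp
      qed
      have q: "0 < c / real n" using c n by simp
      have "p n ^ (g * n) \<le> ((c / real n) powr ((real g - 2) / real g)) ^ (g * n)"
        using pn p01 by (intro power_mono) auto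
      also have "\<dots> = (c / real n) powr (((real g - 2) / real g) * real (g * n))"
        using q c n by (simp add: powr_powr del: of_nat_mult flip: powr_realpow)
      also have "((real g - 2) / real g) * real (g * n) = real m"
        using assms by (simp add: m_def of_nat_diff)
      also have "(c / real n) powr real m = (c / real n) ^ m" using q by (rule powr_realpow)
      finally have 1: "p n ^ (g * n) \<le> (c / real n) ^ m" .
      have "X n \<le> real (plane.growth * (m + 2)) ^ (m + 2) * p n ^ (g * n)"
        using first_moment_bound[OF assms, of "p n" n] p01 by (simp add: X_def m_def)
      also have "\<dots> \<le> (B * n) ^ (m + 2) * (c / real n) ^ m"
      proof (rule mult_mono[OF _ 1])
        have "real (plane.growth * (m + 2)) \<le> real (plane.growth * (g * n))"
          using mn by (intro of_nat_mono mult_le_mono2)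
        then show "real (plane.growth * (m + 2)) ^ (m + 2) \<le> (B * n) ^ (m + 2)"
          by (intro power_mono) (simp_all add: B_def mult_ac)
      qed (use B p01 in auto)
      also have "\<dots> = (B * n) ^ 2 * (B * n * (c / n)) ^ m"
        by (simp add: power_add power_mult_distrib power_divide power2_eq_square mult_ac)
      also have "B * n * (c / n) = 1 / 2" using B n by (simp add: c_def)
      also have "(B * n) ^ 2 * (1 / 2) ^ m \<le> (B * n) ^ 2 * (1 / 2) ^ n"
        using mn by (intro mult_left_mono power_decreasing) auto
      also have "\<dots> = B ^ 2 * (real n / sqrt 2 ^ n) ^ 2"
      proof -
        have "(sqrt 2 ^ n) ^ 2 = (2::real) ^ n" by (metis power_commutes power_even_eq power_mult real_sqrt_pow2 zero_le_numeral)
        then show ?thesis by (simp add: power_mult_distrib power_divide)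
      qed
      finally show ?thesis .
    qed
    then have up: "\<forall>\<^sub>F n in at_top. X n \<le> B ^ 2 * (real n / sqrt 2 ^ n) ^ 2"
      using eventually_conj[OF p eventually_gt_at_top[of 0]] by (auto elim: eventually_mono)
    have "0 \<le> X n" for n
      unfolding X_def Gnp_prob_def using p01 by (intro sum_nonneg) auto
    then have "X \<longlonglongrightarrow> 0"
      using lim up by (intro tendsto_sandwich[OF _ up tendsto_const]) auto
    then show "(\<lambda>n. Gnp_prob ((g - 2) * n + 2) (p n) (has_spanning_mpg g ((g - 2) * n + 2))) \<longlonglongrightarrow> 0"
      unfolding X_def .
  qed
qed

section \<open>Random copies of a graph in which forests are dense\<close>

text \<open>Each new edge has an end \<open>v\<close> not covered so far; \<open>u\<close> may be
  new as well, which opens another component. The count of homomorphisms follows this order of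
  construction.\<close>

inductive forest :: "nat set set \<Rightarrow> bool" where
  empty: "forest {}"
| leaf: "forest T \<Longrightarrow> v \<notin> \<Union> T \<Longrightarrow> u \<noteq> v \<Longrightarrow> forest (insert {u, v} T)"

lemma forest_subset:
  assumes "forest T" "T' \<subseteq> T"
  shows "forest T'"
  using assms
proof (induction arbitrary: T')
  case empty
  then show ?case by (simp add: forest.empty)
next
  case (leaf T v u)
  show ?case
  proof (cases "{u, v} \<in> T'")
    case True
    have "forest (T' - {{u, v}})" using leaf.prems by (intro leaf.IH) auto
    moreover have "v \<notin> \<Union> (T' - {{u, v}})" using leaf by auto
    ultimately have "forest (insert {u, v} (T' - {{u, v}}))" using leaf.hyps by (intro forest.leaf)
    then show ?thesis using True by (simp add: insert_absorb)
  next
    case False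
    then show ?thesis using leaf.prems by (intro leaf.IH) auto
  qed
qed

lemma forest_image:
  assumes "forest T" "inj f"
  shows "forest ((`) f ` T)"
  using assms(1)
proof induction
  case empty
  then show ?case by (simp add: forest.empty)
next
  case (leaf T v u)
  have "f v \<notin> \<Union> ((`) f ` T)" using leaf.hyps assms(2) by (auto simp: inj_def)
  moreover have "f u \<noteq> f v" using leaf.hyps assms(2) by (auto simp: inj_def)
  ultimately show ?case using forest.leaf[OF leaf.IH] by simp
qed

lemma forest_finite: "forest T \<Longrightarrow> finite T \<and> finite (\<Union> T) \<and> card (\<Union> T) \<le> 2 * card T"
proof (induction rule: forest.induct)
  case (leaf T v u)
  have "\<Union> (insert {u, v} T) = {u, v} \<union> \<Union> T" by auto
  then have "card (\<Union> (insert {u, v} T)) \<le> 2 + card (\<Union> T)"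
    using card_Un_le[of "{u, v}" "\<Union> T"] leaf.hyps by simp
  moreover have "{u, v} \<notin> T" using leaf.hyps by auto
  ultimately show ?case using leaf by simp
qed simp

text \<open>General in \<open>Q\<close> because both \<open>forest\<close> and the absence of short
  cycles survive the addition of a leaf. The starting point \<open>x 0\<close> may lie inside or
  outside of \<open>\<Union> T\<close>.\<close>

lemma leaf_path:
  assumes leaf: "\<And>T u v. Q T \<Longrightarrow> v \<notin> \<Union> T \<Longrightarrow> u \<noteq> v \<Longrightarrow> Q (insert {u, v} T)"
    and "Q T" "inj_on x {..m}" "\<And>j. 1 \<le> j \<Longrightarrow> j \<le> m \<Longrightarrow> x j \<notin> \<Union> T"
  shows "Q (T \<union> (\<lambda>j. {x j, x (Suc j)}) ` {..<m})"
  using assms(2-)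
proof (induction m)
  case (Suc m)
  have "Q (T \<union> (\<lambda>j. {x j, x (Suc j)}) ` {..<m})"
    using Suc.prems by (intro Suc.IH) (auto intro: inj_on_subset)
  moreover have "x (Suc m) \<notin> \<Union> (T \<union> (\<lambda>j. {x j, x (Suc j)}) ` {..<m})"
  proof -
    have "x (Suc m) \<noteq> x j" if "j \<le> m" for j using Suc.prems(2) that by (auto dest: inj_onD)
    then show ?thesis using Suc.prems(3)[of "Suc m"] by (auto simp: Suc_le_eq)
  qed
  moreover have "x m \<noteq> x (Suc m)" using Suc.prems(2) by (auto dest: inj_onD)
  ultimately have "Q (insert {x m, x (Suc m)} (T \<union> (\<lambda>j. {x j, x (Suc j)}) ` {..<m}))"
    by (rule leaf)
  then show ?case by (simp add: lessThan_Suc)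
qed simp

definition homs :: "nat \<Rightarrow> nat set set \<Rightarrow> nat set \<Rightarrow> nat set set \<Rightarrow> (nat \<Rightarrow> nat) set" where
  "homs N H V T = {f \<in> V \<rightarrow>\<^sub>E {..<N}. \<forall>e\<in>T. f ` e \<in> H}"

lemma finite_homs: "finite V \<Longrightarrow> finite (homs N H V T)"
  unfolding homs_def by (rule finite_subset[of _ "V \<rightarrow>\<^sub>E {..<N}"]) (auto intro: finite_PiE)

text \<open>The leaf \<open>v\<close> goes to one of at most \<open>\<Delta>\<close> neighbours of
  the image of \<open>u\<close> instead of any of \<open>N\<close> vertices, so each forest edge
  saves a factor \<open>N / \<Delta>\<close>.\<close>

lemma card_forest_homs:
  assumes "forest T" "finite V" "\<Union> T \<subseteq> V" and \<Delta>: "\<And>v. finite (nbr H v) \<and> card (nbr H v) \<le> \<Delta>"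
  shows "card (homs N H V T) * N ^ card T \<le> N ^ card V * \<Delta> ^ card T"
  using assms(1,2,3)
proof (induction arbitrary: V)
  case empty
  then show ?case by (simp add: homs_def card_PiE)
next
  case (leaf T v u)
  have V: "v \<in> V" "u \<in> V" "u \<noteq> v" "\<Union> T \<subseteq> V - {v}" using leaf by auto
  have fT: "finite T" using forest_finite leaf by auto
  have nT: "{u, v} \<notin> T" using leaf.hyps by auto
  let ?R = "SIGMA f : homs N H (V - {v}) T. nbr H (f u)"
  have "card (homs N H V (insert {u, v} T)) \<le> card ?R"
  proof (rule card_inj_on_le[of "\<lambda>f. (restrict f (V - {v}), f v)"])
    show "finite ?R" using finite_homs leaf.prems \<Delta> by auto
    show "inj_on (\<lambda>f. (restrict f (V - {v}), f v)) (homs N H V (insert {u, v} T))"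
    proof (rule inj_onI)
      fix f g assume f: "f \<in> homs N H V (insert {u, v} T)" and g: "g \<in> homs N H V (insert {u, v} T)"
        and e: "(restrict f (V - {v}), f v) = (restrict g (V - {v}), g v)"
      show "f = g"
      proof
        fix x
        have eq: "restrict f (V - {v}) = restrict g (V - {v})" "f v = g v" using e by simp_all
        show "f x = g x"
        proof (cases "x \<in> V - {v}")
          case True
          then show ?thesis using fun_cong[OF eq(1), of x] by simp
        next
          case False
          have "f \<in> V \<rightarrow>\<^sub>E {..<N}" "g \<in> V \<rightarrow>\<^sub>E {..<N}" using f g by (simp_all add: homs_def)
          then show ?thesis using False eq(2) PiE_arb[of f V _ x] PiE_arb[of g V _ x] by (cases "x = v") simp_all
        qed
      qed
    qed
    show "(\<lambda>f. (restrict f (V - {v}), f v)) ` homs N H V (insert {u, v} T) \<subseteq> ?R"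
    proof (rule image_subsetI)
      fix f assume f: "f \<in> homs N H V (insert {u, v} T)"
      have "restrict f (V - {v}) ` e = f ` e" if "e \<in> T" for e using V that by auto
      then have "restrict f (V - {v}) \<in> homs N H (V - {v}) T" using f by (auto simp: homs_def)
      moreover have "f v \<in> nbr H (restrict f (V - {v}) u)" using f V by (auto simp: homs_def nbr_def)
      ultimately show "(restrict f (V - {v}), f v) \<in> ?R" by simp
    qed
  qed
  also have "card ?R \<le> card (homs N H (V - {v}) T) * \<Delta>"
  proof -
    have "card ?R = (\<Sum>f\<in>homs N H (V - {v}) T. card (nbr H (f u)))"
      using \<Delta> finite_homs[of "V - {v}"] leaf.prems by (intro card_SigmaI) auto
    also have "\<dots> \<le> (\<Sum>f\<in>homs N H (V - {v}) T. \<Delta>)" using \<Delta> by (intro sum_mono) simp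
    finally show ?thesis by simp
  qed
  finally have "card (homs N H V (insert {u, v} T)) * (N ^ card T * N)
      \<le> card (homs N H (V - {v}) T) * \<Delta> * (N ^ card T * N)" by (rule mult_le_mono1)
  also have "\<dots> = (card (homs N H (V - {v}) T) * N ^ card T) * (\<Delta> * N)" by (simp add: mult_ac)
  also have "\<dots> \<le> (N ^ card (V - {v}) * \<Delta> ^ card T) * (\<Delta> * N)"
    using leaf.IH[of "V - {v}"] V leaf.prems by (intro mult_le_mono1) auto
  also have "\<dots> = N ^ Suc (card (V - {v})) * \<Delta> ^ Suc (card T)" by (simp add: mult_ac)
  also have "Suc (card (V - {v})) = card V" using V leaf.prems by (metis card_Suc_Diff1)
  finally show ?case using nT fT by (simp add: mult_ac)
qed

text \<open>Composition with the inverse of one such permutation carries all of them into the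
  permutations of \<open>S - V\<close>.\<close>

lemma card_permutations_extending:
  assumes "finite S" "V \<subseteq> S"
  shows "card {\<tau>. \<tau> permutes S \<and> restrict \<tau> V = f} \<le> fact (card S - card V)"
proof (cases "\<exists>\<tau>0. \<tau>0 permutes S \<and> restrict \<tau>0 V = f")
  case True
  then obtain \<tau>0 where \<tau>0: "\<tau>0 permutes S" "restrict \<tau>0 V = f" by auto
  have "card {\<tau>. \<tau> permutes S \<and> restrict \<tau> V = f} \<le> card {\<rho>. \<rho> permutes (S - V)}"
  proof (rule card_inj_on_le[of "\<lambda>\<tau>. inv \<tau>0 \<circ> \<tau>"])
    show "inj_on (\<lambda>\<tau>. inv \<tau>0 \<circ> \<tau>) {\<tau>. \<tau> permutes S \<and> restrict \<tau> V = f}"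
    proof (rule inj_onI)
      fix \<tau> \<tau>' assume "inv \<tau>0 \<circ> \<tau> = inv \<tau>0 \<circ> \<tau>'"
      then have "\<tau>0 \<circ> (inv \<tau>0 \<circ> \<tau>) = \<tau>0 \<circ> (inv \<tau>0 \<circ> \<tau>')" by simp
      then show "\<tau> = \<tau>'" using permutes_inv_o(1)[OF \<tau>0(1)] by (simp add: o_assoc)
    qed
    show "(\<lambda>\<tau>. inv \<tau>0 \<circ> \<tau>) ` {\<tau>. \<tau> permutes S \<and> restrict \<tau> V = f} \<subseteq> {\<rho>. \<rho> permutes (S - V)}"
    proof clarify
      fix \<tau> assume \<tau>: "\<tau> permutes S" "f = restrict \<tau> V"
      have "inv \<tau>0 \<circ> \<tau> permutes S" using \<tau>(1) \<tau>0(1) by (simp add: permutes_compose permutes_inv)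
      moreover have "(inv \<tau>0 \<circ> \<tau>) x = x" if "x \<in> V" for x
      proof -
        have "\<tau> x = \<tau>0 x" using that \<tau>(2) \<tau>0(2) by (metis restrict_apply')
        then show ?thesis using \<tau>0(1) by (simp add: permutes_inverses)
      qed
      ultimately show "inv \<tau>0 \<circ> \<tau> permutes (S - V)" by (auto intro: permutes_superset)
    qed
    show "finite {\<rho>. \<rho> permutes (S - V)}" using assms by (simp add: finite_permutations)
  qed
  also have "\<dots> = fact (card S - card V)"
    using assms by (simp add: card_permutations card_Diff_subset finite_subset)
  finally show ?thesis .
next
  case False
  then have "{\<tau>. \<tau> permutes S \<and> restrict \<tau> V = f} = {}" by auto
  then show ?thesis by (simp only: card.empty le0)
qed

text \<open>The number of injective maps from \<open>v\<close> points is at least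
  \<open>(N / exp 1) ^ v\<close>, so comparing permutations with arbitrary maps costs a factor
  \<open>exp 1\<close> per vertex. It combines \<open>v ^ v \<le> exp 1 ^ v * fact v\<close> with
  \<open>(N / v) ^ v \<le> N choose v\<close>.\<close>

lemma power_fact_diff_le:
  assumes "v \<le> N"
  shows "real N ^ v * fact (N - v) \<le> exp 1 ^ v * fact N"
proof (cases "v = 0")
  case False
  have "real v ^ v \<le> exp 1 ^ v * fact v" using power_le_exp_fact[of "real v" v] exp_of_nat_mult[of v "1::real"] by simp
  moreover have "(real N / real v) ^ v \<le> real (N choose v)"
    using binomial_ge_n_over_k_pow_k[OF assms, where 'a = real] by simp
  ultimately have "real v ^ v * (real N / real v) ^ v \<le> (exp 1 ^ v * fact v) * real (N choose v)"
    by (intro mult_mono) auto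
  moreover have "real v ^ v * (real N / real v) ^ v = real N ^ v" using False by (simp flip: power_mult_distrib)
  ultimately have "real N ^ v * fact (N - v) \<le> (exp 1 ^ v * fact v) * real (N choose v) * fact (N - v)"
    by (intro mult_right_mono) auto
  also have "\<dots> = exp 1 ^ v * (fact v * fact (N - v) * real (N choose v))" by (simp add: mult_ac)
  also have "fact v * fact (N - v) * real (N choose v) = fact N"
    using binomial_fact_lemma[OF assms] by (metis of_nat_fact of_nat_mult)
  finally show ?thesis .
qed simp

text \<open>Permutations are grouped by their restriction to the vertices of \<open>T\<close>, which
  is a homomorphism. A forest covers at most \<open>2 * card T\<close> vertices, so the factor
  \<open>exp 1\<close> per vertex becomes \<open>exp 1 ^ 2\<close> per edge.\<close>

lemma card_forest_permutations:
  assumes T: "forest T" "\<Union> T \<subseteq> {..<N}" and \<Delta>: "\<And>v. finite (nbr H v) \<and> card (nbr H v) \<le> \<Delta>"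
  shows "real (card {\<tau>. \<tau> permutes {..<N} \<and> (\<forall>e\<in>T. \<tau> ` e \<in> H)}) * real N ^ card T
    \<le> (exp 1 ^ 2 * \<Delta>) ^ card T * fact N"
proof -
  define V where "V = \<Union> T"
  have V: "finite V" "card V \<le> 2 * card T" "V \<subseteq> {..<N}" using forest_finite T by (auto simp: V_def)
  have cV: "card V \<le> N" using card_mono[OF _ V(3)] by simp
  let ?P = "{\<tau>. \<tau> permutes {..<N} \<and> (\<forall>e\<in>T. \<tau> ` e \<in> H)}"
  let ?F = "\<lambda>f. {\<tau>. \<tau> permutes {..<N} \<and> restrict \<tau> V = f}"
  have fF: "finite (?F f)" for f by (rule finite_subset[OF _ finite_permutations[of "{..<N}"]]) auto
  have "?P \<subseteq> (\<Union>f\<in>homs N H V T. ?F f)"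
  proof
    fix \<tau> assume \<tau>: "\<tau> \<in> ?P"
    have "restrict \<tau> V ` e = \<tau> ` e" if "e \<in> T" for e using that by (auto simp: V_def)
    moreover have "\<tau> x < N" if "x \<in> V" for x using that V(3) \<tau> permutes_in_image[of \<tau> "{..<N}" x] by auto
    ultimately have "restrict \<tau> V \<in> homs N H V T" using \<tau> by (auto simp: homs_def)
    then show "\<tau> \<in> (\<Union>f\<in>homs N H V T. ?F f)" using \<tau> by auto
  qed
  then have "card ?P \<le> card (\<Union>f\<in>homs N H V T. ?F f)"
    using fF finite_homs V by (intro card_mono) auto
  also have "\<dots> \<le> (\<Sum>f\<in>homs N H V T. card (?F f))" using finite_homs V by (intro card_UN_le) auto
  also have "\<dots> \<le> (\<Sum>f\<in>homs N H V T. fact (N - card V))"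
    using card_permutations_extending[OF finite_lessThan V(3)] by (intro sum_mono) simp
  finally have "card ?P \<le> card (homs N H V T) * fact (N - card V)" by simp
  then have "card ?P * N ^ card T \<le> card (homs N H V T) * fact (N - card V) * N ^ card T" by (rule mult_le_mono1)
  also have "\<dots> = (card (homs N H V T) * N ^ card T) * fact (N - card V)" by (simp add: mult_ac)
  also have "\<dots> \<le> (N ^ card V * \<Delta> ^ card T) * fact (N - card V)"
    using card_forest_homs[OF T(1) V(1) _ \<Delta>] by (intro mult_le_mono1) (simp add: V_def)
  finally have "real (card ?P * N ^ card T) \<le> real (N ^ card V * \<Delta> ^ card T * fact (N - card V))"
    by (rule of_nat_mono)
  also have "\<dots> = (real N ^ card V * fact (N - card V)) * real \<Delta> ^ card T" by (simp add: mult_ac)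
  also have "\<dots> \<le> (exp 1 ^ card V * fact N) * real \<Delta> ^ card T"
    by (rule mult_right_mono[OF power_fact_diff_le[OF cV]]) simp
  also have "\<dots> \<le> (exp 1 ^ (2 * card T) * fact N) * real \<Delta> ^ card T"
    using V(2) by (intro mult_right_mono power_increasing) auto
  also have "\<dots> = (exp 1 ^ 2 * \<Delta>) ^ card T * fact N" by (simp add: power_mult power_mult_distrib)
  finally show ?thesis by simp
qed

text \<open>The copy of \<open>H\<close> under the inverse of \<open>\<tau>\<close>, written as a
  preimage: that a copy contains given edges then means that \<open>\<tau>\<close> maps them into
  \<open>H\<close>, the event counted in \<open>card_forest_permutations\<close>.\<close>

definition pull :: "nat \<Rightarrow> nat set set \<Rightarrow> (nat \<Rightarrow> nat) \<Rightarrow> nat set set" where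
  "pull N H \<tau> = {e \<in> all_edges N. \<tau> ` e \<in> H}"

text \<open>Containing \<open>B\<close> is at most as likely as containing a forest \<open>T\<close>
  in \<open>B\<close>, which has probability at most \<open>(1 / Q) ^ card T\<close>. Since
  \<open>Q \<ge> 1\<close> and \<open>card T\<close> is at least
  \<open>(1 - 1 / k) * card B\<close>, this is at most
  \<open>(1 / \<kappa>) ^ card B\<close>.\<close>

lemma spread_copies:
  assumes H: "H \<subseteq> all_edges N" and \<Delta>: "\<And>v. finite (nbr H v) \<and> card (nbr H v) \<le> \<Delta>" "0 < \<Delta>"
    and k: "0 < k"
    and dense: "\<And>A. A \<subseteq> H \<Longrightarrow> \<exists>T\<subseteq>A. forest T \<and> card A * (k - 1) \<le> k * card T"
    and N: "exp 1 ^ 2 * \<Delta> \<le> real N"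
  shows "spread 1 ((real N / (exp 1 ^ 2 * \<Delta>)) powr ((real k - 1) / real k)) (all_edges N)
    {\<tau>. \<tau> permutes {..<N}} (pull N H)"
  unfolding spread_def
proof (intro conjI ballI allI impI)
  show "finite (all_edges N)" by (rule finite_all_edges)
  show "finite {\<tau>. \<tau> permutes {..<N}}" by (rule finite_permutations) simp
  have "id permutes {..<N}" by (rule permutes_id)
  then show "{\<tau>. \<tau> permutes {..<N}} \<noteq> {}" by blast
  show "pull N H \<tau> \<subseteq> all_edges N" for \<tau> by (auto simp: pull_def)
  fix B assume B: "B \<subseteq> all_edges N"
  define Q where "Q = real N / (exp 1 ^ 2 * \<Delta>)"
  define \<kappa> where "\<kappa> = Q powr ((real k - 1) / real k)"
  have Q: "1 \<le> Q" unfolding Q_def using N \<Delta>(2) by simp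
  have \<kappa>: "0 < \<kappa>" using Q by (simp add: \<kappa>_def)
  define R where "R = {i \<in> {\<tau>. \<tau> permutes {..<N}}. B \<subseteq> pull N H i}"
  have "real (card R) * \<kappa> ^ card B \<le> fact N"
  proof (cases "R = {}")
    case False
    \<comment> \<open>Large forests are available inside \<open>H\<close> only, so some
      \<open>\<sigma>\<close> carries \<open>B\<close> into \<open>H\<close> and the forest found
      there is carried back.\<close>
    then obtain \<sigma> where \<sigma>: "\<sigma> permutes {..<N}" "B \<subseteq> pull N H \<sigma>" by (auto simp: R_def)
    have inj: "inj ((`) \<sigma>)" by (rule injI) (use inj_image_eq_iff[OF permutes_inj[OF \<sigma>(1)]] in blast)
    obtain T' where T': "T' \<subseteq> (`) \<sigma> ` B" "forest T'" "card ((`) \<sigma> ` B) * (k - 1) \<le> k * card T'"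
      using dense[of "(`) \<sigma> ` B"] \<sigma>(2) by (auto simp: pull_def)
    define T where "T = (`) (inv \<sigma>) ` T'"
    have inv: "inv \<sigma> ` \<sigma> ` e = e" for e using permutes_inj[OF \<sigma>(1)] by (simp add: image_inv_f_f)
    have TB: "T \<subseteq> B" using T'(1) inv by (auto simp: T_def)
    have inji: "inj (inv \<sigma>)" using permutes_inj[OF permutes_inv[OF \<sigma>(1)]] .
    have fT: "forest T" unfolding T_def by (rule forest_image[OF T'(2) inji])
    have cT: "card T = card T'"
    proof -
      have "inj ((`) (inv \<sigma>))" by (rule injI) (use inj_image_eq_iff[OF inji] in blast)
      then show ?thesis unfolding T_def by (rule card_image[OF inj_on_subset[OF _ subset_UNIV]])
    qed
    have cB: "card ((`) \<sigma> ` B) = card B" by (rule card_image[OF inj_on_subset[OF inj subset_UNIV]])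
    have "real (card B) * (real k - 1) \<le> real k * real (card T)"
    proof -
      have "real (card B * (k - 1)) \<le> real (k * card T)" using T'(3) cT cB by (intro of_nat_mono) simp
      then show ?thesis using k by (simp add: of_nat_diff)
    qed
    then have e: "(real k - 1) / real k * real (card B) \<le> real (card T)"
      using k by (simp add: divide_le_eq mult_ac)
    have "\<kappa> ^ card B = Q powr ((real k - 1) / real k * real (card B))"
      using \<kappa> Q by (simp add: \<kappa>_def powr_powr flip: powr_realpow)
    also have "\<dots> \<le> Q powr real (card T)" by (rule powr_mono[OF e Q])
    also have "\<dots> = Q ^ card T" using Q by (simp add: powr_realpow)
    finally have \<kappa>B: "\<kappa> ^ card B \<le> Q ^ card T" .
    have "R \<subseteq> {\<tau>. \<tau> permutes {..<N} \<and> (\<forall>e\<in>T. \<tau> ` e \<in> H)}" using TB by (auto simp: R_def pull_def)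
    moreover have "finite {\<tau>. \<tau> permutes {..<N} \<and> (\<forall>e\<in>T. \<tau> ` e \<in> H)}"
      by (rule finite_subset[OF _ finite_permutations[of "{..<N}"]]) auto
    ultimately have "card R \<le> card {\<tau>. \<tau> permutes {..<N} \<and> (\<forall>e\<in>T. \<tau> ` e \<in> H)}" by (intro card_mono)
    then have "real (card R) * Q ^ card T \<le> real (card {\<tau>. \<tau> permutes {..<N} \<and> (\<forall>e\<in>T. \<tau> ` e \<in> H)}) * Q ^ card T"
      using Q by (intro mult_right_mono) auto
    also have "\<dots> = real (card {\<tau>. \<tau> permutes {..<N} \<and> (\<forall>e\<in>T. \<tau> ` e \<in> H)}) * real N ^ card T / (exp 1 ^ 2 * \<Delta>) ^ card T"
      by (simp add: Q_def power_divide)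
    also have "\<dots> \<le> (exp 1 ^ 2 * \<Delta>) ^ card T * fact N / (exp 1 ^ 2 * \<Delta>) ^ card T"
    proof (rule divide_right_mono[OF card_forest_permutations[OF fT _ \<Delta>(1)]])
      show "\<Union> T \<subseteq> {..<N}" using TB B by (auto simp: all_edges_def)
    qed simp
    also have "\<dots> = fact N" using \<Delta>(2) by simp
    finally have "real (card R) * Q ^ card T \<le> fact N" .
    moreover have "real (card R) * \<kappa> ^ card B \<le> real (card R) * Q ^ card T"
      using \<kappa>B by (intro mult_left_mono) auto
    ultimately show ?thesis by linarith
  qed simp
  then have "real (card R) \<le> fact N / \<kappa> ^ card B" using \<kappa> by (simp add: pos_le_divide_eq)
  then show "real (card {i \<in> {\<tau>. \<tau> permutes {..<N}}. B \<subseteq> pull N H i})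
      \<le> 1 * (1 / (real N / (exp 1 ^ 2 * \<Delta>)) powr ((real k - 1) / real k)) ^ card B * card {\<tau>. \<tau> permutes {..<N}}"
    by (simp add: R_def \<kappa>_def Q_def power_divide card_permutations)
qed

section \<open>A maximal planar graph of bounded degree\<close>

lemma cyclic_sum_zero:
  fixes F :: "'a \<Rightarrow> int"
  shows "(\<Sum>i<length vs. F (vs ! ((i + 1) mod length vs)) - F (vs ! i)) = 0"
proof (cases "vs = []")
  case False
  define L where "L = length vs"
  have L: "0 < L" using False by (simp add: L_def)
  have "inj_on (\<lambda>i. (i + 1) mod L) {..<L}"
  proof (rule inj_onI)
    fix i j assume "i \<in> {..<L}" "j \<in> {..<L}" "(i + 1) mod L = (j + 1) mod L"
    then show "i = j" by (cases "Suc i = L"; cases "Suc j = L") auto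
  qed
  moreover have "(\<lambda>i. (i + 1) mod L) ` {..<L} \<subseteq> {..<L}" using L by auto
  ultimately have "bij_betw (\<lambda>i. (i + 1) mod L) {..<L} {..<L}"
    by (simp add: bij_betw_def endo_inj_surj)
  then have "(\<Sum>i<L. F (vs ! ((i + 1) mod L))) = (\<Sum>i<L. F (vs ! i))"
    by (rule sum.reindex_bij_betw)
  then show ?thesis by (simp add: sum_subtractf L_def)
qed simp

text \<open>Around a cycle the increments of \<open>F\<close> sum to zero. Across the new edge
  \<open>F\<close> jumps by at least \<open>g\<close>, while the other edges, at most
  \<open>g - 1\<close> of them, change it by at most one each.\<close>

lemma no_short_cycle_insert:
  fixes F :: "nat \<Rightarrow> int"
  assumes free: "\<And>L. L \<le> g \<Longrightarrow> \<not> has_cycle_of_length E L"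
    and F: "\<And>u w. {u, w} \<in> E \<Longrightarrow> \<bar>F u - F w\<bar> \<le> 1" and ab: "int g \<le> \<bar>F a - F b\<bar>" and L: "L \<le> g"
  shows "\<not> has_cycle_of_length (insert {a, b} E) L"
proof
  assume "has_cycle_of_length (insert {a, b} E) L"
  then obtain vs where vs: "3 \<le> L" "length vs = L" "distinct vs"
    "\<forall>i<L. {vs ! i, vs ! ((i + 1) mod L)} \<in> insert {a, b} E"
    by (auto simp: has_cycle_of_length_def)
  define d where "d i = F (vs ! ((i + 1) mod L)) - F (vs ! i)" for i
  have "\<not> (\<forall>i<L. {vs ! i, vs ! ((i + 1) mod L)} \<in> E)"
    using free[OF L] vs(1-3) unfolding has_cycle_of_length_def by blast
  then obtain i where i: "i < L" "{vs ! i, vs ! ((i + 1) mod L)} = {a, b}" using vs(4) by auto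
  have other: "\<bar>d j\<bar> \<le> 1" if j: "j < L" "j \<noteq> i" for j
  proof -
    have m: "(i + 1) mod L < L" "(j + 1) mod L < L" using vs(1) by auto
    have "{vs ! j, vs ! ((j + 1) mod L)} \<noteq> {vs ! i, vs ! ((i + 1) mod L)}"
    proof
      assume "{vs ! j, vs ! ((j + 1) mod L)} = {vs ! i, vs ! ((i + 1) mod L)}"
      then have "vs ! j = vs ! ((i + 1) mod L)" "vs ! ((j + 1) mod L) = vs ! i"
        using j i(1) vs(2,3) by (auto simp: doubleton_eq_iff nth_eq_iff_index_eq)
      then have "j = (i + 1) mod L" "(j + 1) mod L = i"
        using j i(1) m vs(2,3) by (auto simp: nth_eq_iff_index_eq)
      then show False using vs(1) i(1) by (cases "Suc i = L"; cases "Suc j = L") auto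
    qed
    then have "{vs ! j, vs ! ((j + 1) mod L)} \<in> E" using vs(4) j i by auto
    then show ?thesis using F unfolding d_def by (simp add: abs_minus_commute)
  qed
  have "(\<Sum>j<L. d j) = 0" using cyclic_sum_zero[of F vs] vs(2) by (simp add: d_def)
  then have "d i = - (\<Sum>j\<in>{..<L} - {i}. d j)" using i(1) by (simp add: sum.remove[of _ i])
  then have "\<bar>d i\<bar> \<le> (\<Sum>j\<in>{..<L} - {i}. \<bar>d j\<bar>)" by (simp add: sum_abs)
  also have "\<dots> \<le> (\<Sum>j\<in>{..<L} - {i}. 1)" by (rule sum_mono) (use other in auto)
  also have "\<dots> = int L - 1" using i(1) by (simp add: of_nat_diff)
  finally have "\<bar>d i\<bar> < int g" using L vs(1) by linarith
  moreover have "\<bar>d i\<bar> = \<bar>F a - F b\<bar>" using i(2) by (auto simp: d_def doubleton_eq_iff abs_minus_commute)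
  ultimately show False using ab by linarith
qed

text \<open>The potential that is \<open>g\<close> at \<open>v\<close> and zero elsewhere is
  constant along every old edge.\<close>

lemma no_short_cycle_leaf:
  assumes "\<forall>L\<le>g. \<not> has_cycle_of_length E L" "v \<notin> \<Union> E" "u \<noteq> v"
  shows "\<forall>L\<le>g. \<not> has_cycle_of_length (insert {u, v} E) L"
proof (intro allI impI)
  fix L assume "L \<le> g"
  show "\<not> has_cycle_of_length (insert {u, v} E) L"
    by (rule no_short_cycle_insert[where F = "\<lambda>x. if x = v then int g else 0" and g = g])
      (use assms \<open>L \<le> g\<close> in auto)
qed

text \<open>Start with a cycle of length \<open>2 * k + 1\<close>.  A face with two adjacent boundary vertices and a
  third one opposite to them is cut into three by a new vertex joined to the former two by paths
  of length \<open>k\<close> and to the latter by an edge; one of the new faces is again of this kind.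
  Block \<open>i\<close> consists of the inner vertices \<open>q i 1, \<dots>, q i (2 * k - 1)\<close> of the new path
  from \<open>q i 0\<close> to \<open>q i (2 * k)\<close>, whose middle vertex \<open>q i k\<close> is joined to \<open>tip i\<close>.\<close>

locale nested_faces =
  fixes k :: nat
  assumes k3: "3 \<le> k"
begin

definition st :: "nat \<Rightarrow> nat" where "st i = (2 * k - 1) * i + 2"

text \<open>The ends of path \<open>i + 1\<close> are the vertices \<open>k + 1\<close> and
  \<open>k + 2\<close> of path \<open>i\<close>, and its tip is vertex 1 of path \<open>i\<close>.
  On the cycle of length \<open>2 * k + 1\<close> formed by path \<open>i\<close> and the edge
  between its ends, vertex 1 has distance \<open>k\<close> from both; this cycle bounds the face cut
  next.\<close>

definition q :: "nat \<Rightarrow> nat \<Rightarrow> nat" where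
  "q i j = (if j = 0 then case i of 0 \<Rightarrow> 0 | Suc i \<Rightarrow> st i + k
     else if j = 2 * k then case i of 0 \<Rightarrow> 1 | Suc i \<Rightarrow> st i + Suc k else st i + (j - 1))"

definition tip :: "nat \<Rightarrow> nat" where "tip i = st (i - 1)"

text \<open>Index \<open>2 * k\<close> is reserved for the edge from the middle vertex to the tip,
  or, in block 0, for the edge that closes the initial cycle.\<close>

definition ed :: "nat \<Rightarrow> nat \<Rightarrow> nat set" where
  "ed i j = (if j < 2 * k then {q i j, q i (Suc j)}
     else if i = 0 then {q 0 0, q 0 (2 * k)} else {tip i, q i k})"

definition gr :: "nat \<Rightarrow> nat set set" where "gr n = (\<Union>i<n. ed i ` {..2 * k})"

lemma st_Suc: "st (Suc i) = st i + (2 * k - 1)" by (simp add: st_def)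

lemma st_0: "st 0 = 2" by (simp add: st_def)

lemma st_mono: "i \<le> j \<Longrightarrow> st i \<le> st j" by (simp add: st_def)

lemma q_mid: "0 < j \<Longrightarrow> j < 2 * k \<Longrightarrow> q i j = st i + (j - 1)" by (simp add: q_def)

lemma q_0: "q i 0 < st i" and q_2k: "q i (2 * k) < st i" and q_ends: "q i 0 \<noteq> q i (2 * k)"
  using k3 by (auto simp: q_def st_Suc st_0 split: nat.splits)

lemma q_Suc: "q (Suc i) 0 = q i (k + 1)" "q (Suc i) (2 * k) = q i (k + 2)" "tip (Suc i) = q i 1"
  using k3 by (auto simp: q_def tip_def)

lemma q_inj: "j \<le> 2 * k \<Longrightarrow> j' \<le> 2 * k \<Longrightarrow> q i j = q i j' \<longleftrightarrow> j = j'"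
  using q_0[of i] q_2k[of i] q_ends[of i] q_mid[of j i] q_mid[of j' i]
  by (cases "j = 0"; cases "j = 2 * k"; cases "j' = 0"; cases "j' = 2 * k") auto

lemma q_inj_on: "inj_on (q i) {..2 * k}" by (auto simp: inj_on_def q_inj)

lemma q_less: "j \<le> 2 * k \<Longrightarrow> q i j < st (Suc i)"
  using q_0[of i] q_2k[of i] q_mid[of j i] k3 by (cases "j = 0"; cases "j = 2 * k") (auto simp: st_Suc)

lemma tip_less: "0 < i \<Longrightarrow> tip i < st i"
  using k3 by (cases i) (auto simp: tip_def st_Suc)

lemma tip_ne: "0 < i \<Longrightarrow> j \<le> 2 * k \<Longrightarrow> tip i \<noteq> q i j"
  using k3 tip_less[of i] q_mid[of j i]
  by (cases "j = 0"; cases "j = 2 * k"; cases i) (auto simp: tip_def q_def)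

lemma ed_less: "j \<le> 2 * k \<Longrightarrow> x \<in> ed i j \<Longrightarrow> x < st (Suc i)"
  using q_less[of j i] q_less[of "Suc j" i] q_less[of k i] q_less[of 0 0] q_less[of "2 * k" 0]
    tip_less[of i] st_mono[of i "Suc i"] k3
  by (auto simp: ed_def split: if_splits)

lemma ed_lower: "0 < i \<Longrightarrow> j \<le> 2 * k \<Longrightarrow> x \<in> ed i j \<Longrightarrow> st (i - 1) \<le> x"
proof -
  assume i: "0 < i" and "j \<le> 2 * k" "x \<in> ed i j"
  have "st (i - 1) \<le> q i j" for j using i st_mono[of "i - 1" i] by (cases i) (auto simp: q_def)
  then show ?thesis using \<open>x \<in> ed i j\<close> i by (auto simp: ed_def tip_def split: if_splits)
qed

lemma ed_pair: "j \<le> 2 * k \<Longrightarrow> \<exists>u w. ed i j = {u, w} \<and> u \<noteq> w"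
proof (cases "j < 2 * k")
  case True
  then show ?thesis using q_inj[of j "Suc j" i] by (intro exI[of _ "q i j"] exI[of _ "q i (Suc j)"]) (simp add: ed_def)
next
  case False
  then show ?thesis using q_ends[of 0] tip_ne[of i k] by (cases "i = 0") (auto simp: ed_def)
qed

lemma gr_less: "e \<in> gr n \<Longrightarrow> x \<in> e \<Longrightarrow> x < st n"
proof -
  assume "e \<in> gr n" "x \<in> e"
  then obtain i j where "i < n" "j \<le> 2 * k" "x \<in> ed i j" by (auto simp: gr_def)
  then show ?thesis using ed_less[of j x i] st_mono[of "Suc i" n] by auto
qed

lemma gr_all_edges: "gr n \<subseteq> all_edges (st n)"
proof
  fix e assume e: "e \<in> gr n"
  then obtain i j where "e = ed i j" "j \<le> 2 * k" by (auto simp: gr_def)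
  then obtain u w where "e = {u, w}" "u \<noteq> w" using ed_pair[of j i] by auto
  then show "e \<in> all_edges (st n)" using gr_less[OF e] by (auto simp: all_edges_def)
qed

lemma gr_Suc: "gr (Suc n) = gr n \<union> ed n ` {..2 * k}"
  unfolding gr_def by (simp add: lessThan_Suc Un_commute)

lemma ed_in_gr: "i < n \<Longrightarrow> j \<le> 2 * k \<Longrightarrow> ed i j \<in> gr n"
  by (auto simp: gr_def)

lemma ed_fresh: "j \<le> 2 * k \<Longrightarrow> 0 < i \<or> j < 2 * k \<Longrightarrow> \<exists>x\<in>ed i j. st i \<le> x"
  using q_mid[of k i] q_mid[of j i] q_mid[of "Suc j" i] k3
  by (cases "j = 0") (auto simp: ed_def)

text \<open>Every edge of a later block contains a vertex beyond all earlier blocks, so only edges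
  of one block have to be compared.\<close>

lemma ed_inj:
  assumes "ed i j = ed i' j'" "j \<le> 2 * k" "j' \<le> 2 * k"
  shows "i = i' \<and> j = j'"
proof -
  have less: False if h: "ed i j = ed i' j'" "i < i'" "j \<le> 2 * k" "j' \<le> 2 * k" for i i' j j'
  proof -
    obtain x where "x \<in> ed i' j'" "st i' \<le> x" using ed_fresh[of j' i'] h by auto
    then show False using ed_less[of j x i] st_mono[of "Suc i" i'] h by auto
  qed
  then have i: "i = i'" using assms by (metis linorder_neqE_nat)
  have top: False if e: "ed i j = ed i (2 * k)" "j < 2 * k" for j
  proof (cases "i = 0")
    case True
    then have "{j, Suc j} = {0, 2 * k}" using e q_inj by (auto simp: ed_def doubleton_eq_iff)
    then show False using k3 by (auto simp: doubleton_eq_iff)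
  next
    case False
    then have "tip i \<in> {q i j, q i (Suc j)}" using e by (auto simp: ed_def)
    then show False using tip_ne[of i] False e(2) by auto
  qed
  have "j = j'" if "j < 2 * k" "j' < 2 * k"
  proof -
    have "{q i j, q i (Suc j)} = {q i j', q i (Suc j')}" using assms i that by (simp add: ed_def)
    then have "(j = j' \<and> Suc j = Suc j') \<or> (j = Suc j' \<and> Suc j = j')"
      using q_inj that by (auto simp: doubleton_eq_iff)
    then show ?thesis by auto
  qed
  then have "j = j'" using top[of j] top[of j'] assms i by (metis le_neq_implies_less)
  then show ?thesis using i by simp
qed

lemma ed_inj_on: "inj_on (\<lambda>(i, j). ed i j) (A \<times> {..2 * k})"
  by (rule inj_onI) (use ed_inj in auto)

lemma gr_image: "gr n = (\<lambda>(i, j). ed i j) ` ({..<n} \<times> {..2 * k})"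
  by (auto simp: gr_def)

lemma card_gr: "card (gr n) = (2 * k + 1) * n"
  unfolding gr_image by (subst card_image[OF ed_inj_on]) simp

text \<open>An edge stays within two consecutive blocks, so adjacent labels differ by at most
  \<open>4 * k\<close>.\<close>

lemma nbr_gr: "finite (nbr (gr n) v) \<and> card (nbr (gr n) v) \<le> 8 * k + 1"
proof -
  have close: "w \<le> u + 4 * k" if "j \<le> 2 * k" "u \<in> ed i j" "w \<in> ed i j" for i j u w
    using ed_less[OF that(1,3)] ed_lower[OF _ that(1,2)] k3 by (cases i) (auto simp: st_Suc st_0)
  have "nbr (gr n) v \<subseteq> {v - 4 * k..v + 4 * k}"
  proof
    fix w assume "w \<in> nbr (gr n) v"
    then obtain i j where "{v, w} = ed i j" "j \<le> 2 * k" by (auto simp: nbr_def gr_def)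
    moreover from this have "v \<in> ed i j" "w \<in> ed i j" by (metis insertI1 insertI2)+
    ultimately have "w \<le> v + 4 * k" "v \<le> w + 4 * k" using close[of j v i w] close[of j w i v] by auto
    then show "w \<in> {v - 4 * k..v + 4 * k}" by auto
  qed
  moreover have "card {v - 4 * k..v + 4 * k} \<le> 8 * k + 1" by simp
  ultimately show ?thesis by (meson card_mono finite_atLeastAtMost finite_subset le_trans)
qed

section \<open>Girth of the nested graph\<close>

lemma ed_path: "ed i ` {..<2 * k} = (\<lambda>j. {q i j, q i (Suc j)}) ` {..<2 * k}"
  by (auto simp: ed_def)

definition lip :: "nat set set \<Rightarrow> (nat \<Rightarrow> int) \<Rightarrow> bool" where
  "lip E f \<longleftrightarrow> (\<forall>u w. {u, w} \<in> E \<longrightarrow> \<bar>f u - f w\<bar> \<le> 1)"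

lemma lip_image: "(\<And>j. j \<in> J \<Longrightarrow> \<bar>f (a j) - f (b j)\<bar> \<le> 1) \<Longrightarrow> lip ((\<lambda>j. {a j, b j}) ` J) f"
  by (auto simp: lip_def doubleton_eq_iff abs_minus_commute)

lemma lip_Un: "lip (A \<union> B) f \<longleftrightarrow> lip A f \<and> lip B f"
  by (auto simp: lip_def)

lemma lip_cong: "lip E f \<Longrightarrow> (\<And>e x. e \<in> E \<Longrightarrow> x \<in> e \<Longrightarrow> f x = g x) \<Longrightarrow> lip E g"
  unfolding lip_def by (metis insertI1 insertI2)

lemma lip_single: "lip {{a, b}} f \<longleftrightarrow> \<bar>f a - f b\<bar> \<le> 1"
  by (auto simp: lip_def doubleton_eq_iff abs_minus_commute)

definition along :: "nat \<Rightarrow> nat \<Rightarrow> int" where "along i v = int v - int (st i) + 1"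

lemma along_q: "0 < j \<Longrightarrow> j < 2 * k \<Longrightarrow> along i (q i j) = int j"
  by (simp add: along_def q_mid)

lemma st_le_q: "j \<le> 2 * k \<Longrightarrow> st i \<le> q i j \<longleftrightarrow> 0 < j \<and> j < 2 * k"
  using q_0[of i] q_2k[of i] q_mid[of j i] by (cases "j = 0"; cases "j = 2 * k") auto

text \<open>The last clause is what makes the next chord \<open>{tip i, q i k}\<close> harmless.\<close>

definition opposite :: "nat \<Rightarrow> (nat \<Rightarrow> int) \<Rightarrow> bool" where
  "opposite n f \<longleftrightarrow> lip (gr n) f \<and> f (q n 0) = k \<and> f (q n (2 * k)) = k \<and> (0 < n \<longrightarrow> f (tip n) = 0)"

lemma opposite_exists: "\<exists>f. opposite n f"
proof (induction n)
  case 0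
  show ?case by (rule exI[of _ "\<lambda>_. int k"]) (simp add: opposite_def gr_def lip_def)
next
  case (Suc n)
  then obtain f where f: "lip (gr n) f" "f (q n 0) = k" "f (q n (2 * k)) = k" "0 < n \<Longrightarrow> f (tip n) = 0"
    by (auto simp: opposite_def)
  \<comment> \<open>Modelled on the distance from the next tip \<open>q n 1\<close>: 0 there,
    \<open>k\<close> at vertices \<open>k + 1\<close> and \<open>k + 2\<close>, then falling to 2 at
    \<open>q n (2 * k)\<close>. On old vertices \<open>k - 2 - f\<close> matches the value
    \<open>k - 1\<close> of \<open>q n k\<close> across the edge at \<open>tip n\<close>, and
    truncation at 1 matches \<open>q n 0\<close>. Old neighbours of \<open>q n (2 * k)\<close> have
    \<open>f \<ge> k - 1\<close>, hence value 1.\<close>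
  define h where "h v = (if st n \<le> v then (if along n v \<le> int k + 1 then along n v - 1 else 2 * int k + 2 - along n v)
     else if v = q n (2 * k) then 2 else max 1 (int k - 2 - f v))" for v
  have hq: "h (q n j) = (if j = 0 then 1 else if j \<le> k + 1 then int j - 1 else 2 * int k + 2 - int j)"
    if "j \<le> 2 * k" for j
  proof (cases "j = 0 \<or> j = 2 * k")
    case True
    then show ?thesis using f(2) q_0[of n] q_2k[of n] q_ends[of n] k3 by (auto simp: h_def)
  next
    case False
    then show ?thesis using that st_le_q[OF that, of n] along_q[of j n] by (auto simp: h_def)
  qed
  have "lip (ed n ` {..<2 * k}) h" unfolding ed_path
  proof (rule lip_image)
    fix j assume j: "j \<in> {..<2 * k}"
    show "\<bar>h (q n j) - h (q n (Suc j))\<bar> \<le> 1" using j k3 hq[of j] hq[of "Suc j"] by auto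
  qed
  moreover have "lip {ed n (2 * k)} h"
  proof (cases "n = 0")
    case True
    then show ?thesis using hq[of 0] hq[of "2 * k"] k3 by (simp add: ed_def lip_single)
  next
    case False
    then have "h (tip n) = int k - 2"
      using f(4) tip_less[of n] tip_ne[of n "2 * k"] k3 by (simp add: h_def)
    then show ?thesis using False hq[of k] k3 by (simp add: ed_def lip_single)
  qed
  moreover have "lip (gr n) h" unfolding lip_def
  proof (intro allI impI)
    fix u w assume uw: "{u, w} \<in> gr n"
    then have "u < st n" "w < st n" "\<bar>f u - f w\<bar> \<le> 1" using gr_less[OF uw] f(1) by (auto simp: lip_def)
    then show "\<bar>h u - h w\<bar> \<le> 1" using f(3) by (auto simp: h_def)
  qed
  moreover have "gr (Suc n) = gr n \<union> (ed n ` {..<2 * k} \<union> {ed n (2 * k)})"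
    unfolding gr_Suc by (simp flip: lessThan_Suc_atMost add: lessThan_Suc)
  ultimately have "lip (gr (Suc n)) h" by (simp only: lip_Un)
  then show ?case using hq[of 1] hq[of "k + 1"] hq[of "k + 2"] k3
    by (intro exI[of _ h]) (simp add: opposite_def q_Suc del: add_2_eq_Suc')
qed

text \<open>A block is added as a path of leaves, then its last path edge, then the edge at the tip.
  Only the last two can close a cycle, and each gets a potential for
  \<open>no_short_cycle_insert\<close>.\<close>

lemma gr_no_short_cycle: "\<forall>L\<le>2 * k. \<not> has_cycle_of_length (gr n) L"
proof (induction n)
  case 0
  have "\<not> has_cycle_of_length {} L" for L
    unfolding has_cycle_of_length_def by (metis empty_iff less_le_trans zero_less_numeral)
  then show ?case by (simp add: gr_def)
next
  case (Suc n)
  define ok where "ok E \<longleftrightarrow> (\<forall>L\<le>2 * k. \<not> has_cycle_of_length E L)" for E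
  obtain f where f: "opposite n f" using opposite_exists by auto
  \<comment> \<open>In block 0 the edge with index \<open>2 * k\<close> is put first, so that in
    every block the path is closed by its last edge.\<close>
  define E0 where "E0 = (if n = 0 then {{q 0 0, q 0 (2 * k)}} else gr n)"
  define Path where "Path = (\<lambda>j. {q n j, q n (Suc j)})"
  have leaf: "ok (insert {u, v} T)" if "ok T" "v \<notin> \<Union> T" "u \<noteq> v" for T u v
    using no_short_cycle_leaf that unfolding ok_def by blast
  have E0: "ok E0"
  proof (cases "n = 0")
    case True
    have "ok (gr 0)" using Suc True by (simp add: ok_def)
    then show ?thesis using leaf[of "gr 0" "q 0 (2 * k)" "q 0 0"] q_ends[of 0] True
      by (simp add: E0_def gr_def)
  qed (use Suc in \<open>simp add: E0_def ok_def\<close>)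
  have E0_less: "x < st n" if "e \<in> E0" "x \<in> e" for e x
    using that gr_less[of e n x] q_0[of 0] q_2k[of 0] by (auto simp: E0_def split: if_splits)
  have "ok (E0 \<union> Path ` {..<2 * k - 1})" unfolding Path_def
  proof (rule leaf_path[OF leaf E0])
    show "inj_on (q n) {..2 * k - 1}" using inj_on_subset[OF q_inj_on] by auto
    fix j assume "1 \<le> j" "j \<le> 2 * k - 1"
    then show "q n j \<notin> \<Union> E0" using E0_less[of _ "q n j"] st_le_q[of j n] by force
  qed
  moreover have "Path ` {..<2 * k} = insert (Path (2 * k - 1)) (Path ` {..<2 * k - 1})"
  proof -
    have "{..<2 * k} = insert (2 * k - 1) {..<2 * k - 1}" using k3 by auto
    then show ?thesis by (simp only: image_insert)
  qed
  moreover have "ok (insert {q n (2 * k - 1), q n (2 * k)} (E0 \<union> Path ` {..<2 * k - 1}))"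
    if o: "ok (E0 \<union> Path ` {..<2 * k - 1})"
  proof -
    \<comment> \<open>Position along the path, 0 on old vertices except for \<open>- 1\<close> at
      the far end: the last path edge leads from \<open>2 * k - 1\<close> to
      \<open>- 1\<close>.\<close>
    define h where "h v = (if st n \<le> v then along n v else if v = q n (2 * k) then - 1 else 0)" for v
    have hq: "h (q n j) = (if j = 2 * k then - 1 else int j)" if "j \<le> 2 * k" for j
      using that st_le_q[OF that, of n] along_q[of j n] q_ends[of n] by (auto simp: h_def)
    have "lip E0 h" unfolding lip_def
      using E0_less by (fastforce simp: h_def)
    moreover have "lip (Path ` {..<2 * k - 1}) h" unfolding Path_def
    proof (rule lip_image)
      fix j assume "j \<in> {..<2 * k - 1}"
      then show "\<bar>h (q n j) - h (q n (Suc j))\<bar> \<le> 1" using hq[of j] hq[of "Suc j"] by auto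
    qed
    ultimately have "lip (E0 \<union> Path ` {..<2 * k - 1}) h" by (simp only: lip_Un)
    moreover have "int (2 * k) \<le> \<bar>h (q n (2 * k - 1)) - h (q n (2 * k))\<bar>"
      using hq[of "2 * k - 1"] hq[of "2 * k"] k3 by (simp add: of_nat_diff)
    ultimately show ?thesis using o no_short_cycle_insert[of "2 * k" _ h] unfolding ok_def lip_def by blast
  qed
  moreover have "Path (2 * k - 1) = {q n (2 * k - 1), q n (2 * k)}" using k3 by (simp add: Path_def)
  ultimately have E2: "ok (E0 \<union> Path ` {..<2 * k})" by simp
  have "ok (gr (Suc n))"
  proof (cases "n = 0")
    case True
    have "gr (Suc n) = E0 \<union> Path ` {..<2 * k}"
      unfolding gr_Suc E0_def Path_def using True
      by (simp flip: lessThan_Suc_atMost add: lessThan_Suc ed_path) (simp add: ed_def gr_def)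
    then show ?thesis using E2 by simp
  next
    case False
    have fs: "f (q n 0) = k" "f (q n (2 * k)) = k" "f (tip n) = 0" "lip (gr n) f" using f False by (auto simp: opposite_def)
    \<comment> \<open>The potential of \<open>opposite\<close>, continued along the path:
      \<open>k\<close> at both ends, \<open>2 * k\<close> in the middle, while the tip has
      0.\<close>
    define h where "h v = (if st n \<le> v then k + min (along n v) (2 * int k - along n v) else f v)" for v
    have hq: "h (q n j) = k + min (int j) (2 * int k - int j)" if "j \<le> 2 * k" for j
      using that st_le_q[OF that, of n] along_q[of j n] fs by (auto simp: h_def)
    have "lip (gr n) h"
      by (rule lip_cong[OF fs(4)]) (use gr_less[of _ n] in \<open>force simp: h_def\<close>)
    moreover have "lip (Path ` {..<2 * k}) h" unfolding Path_def
    proof (rule lip_image)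
      fix j assume "j \<in> {..<2 * k}"
      then show "\<bar>h (q n j) - h (q n (Suc j))\<bar> \<le> 1" using hq[of j] hq[of "Suc j"] by auto
    qed
    ultimately have "lip (E0 \<union> Path ` {..<2 * k}) h" using False by (simp add: lip_Un E0_def)
    moreover have "int (2 * k) \<le> \<bar>h (tip n) - h (q n k)\<bar>"
      using hq[of k] fs(3) tip_less[of n] False by (simp add: h_def)
    ultimately have "ok (insert {tip n, q n k} (E0 \<union> Path ` {..<2 * k}))"
      using E2 no_short_cycle_insert[of "2 * k" _ h] unfolding ok_def lip_def by blast
    moreover have "gr (Suc n) = insert {tip n, q n k} (E0 \<union> Path ` {..<2 * k})"
      unfolding gr_Suc E0_def Path_def using False
      by (simp flip: lessThan_Suc_atMost add: lessThan_Suc ed_path) (simp add: ed_def)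
    ultimately show ?thesis by simp
  qed
  then show ?case by (simp add: ok_def)
qed

lemma gr_girth:
  assumes "0 < n"
  shows "has_girth (gr n) (2 * k + 1)"
proof -
  define vs where "vs = map (q 0) [0..<2 * k + 1]"
  have nth: "vs ! j = q 0 j" if "j \<le> 2 * k" for j using that by (simp add: vs_def del: upt_Suc)
  have "{vs ! j, vs ! ((j + 1) mod (2 * k + 1))} \<in> gr n" if "j < 2 * k + 1" for j
  proof (cases "j = 2 * k")
    case True
    have "{vs ! j, vs ! ((j + 1) mod (2 * k + 1))} = ed 0 (2 * k)"
      using True nth[of 0] nth[of "2 * k"] by (auto simp: ed_def)
    then show ?thesis using assms by (simp add: ed_in_gr)
  next
    case False
    then have "{vs ! j, vs ! ((j + 1) mod (2 * k + 1))} = ed 0 j"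
      using that nth[of j] nth[of "Suc j"] by (auto simp: ed_def)
    then show ?thesis using assms that by (simp add: ed_in_gr)
  qed
  moreover have "distinct vs" unfolding vs_def distinct_map
    by (intro conjI inj_on_subset[OF q_inj_on]) auto
  ultimately have "has_cycle_of_length (gr n) (2 * k + 1)"
    unfolding has_cycle_of_length_def using k3 by (intro conjI exI[of _ vs]) (auto simp: vs_def)
  then show ?thesis using gr_no_short_cycle[of n] by (auto simp: has_girth_def)
qed

text \<open>With one edge cut in each half of its path, a block falls into the edge with index
  \<open>2 * k\<close> and four stretches, one at either end of the path and two at the middle
  vertex. Each stretch is grown away from that vertex.\<close>

lemma forest_cut:
  assumes b: "\<And>i. b1 i < k" "\<And>i. k \<le> b2 i \<and> b2 i < 2 * k"
  shows "forest (\<Union>i<n. ed i ` ({..2 * k} - {b1 i, b2 i}))"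
proof (induction n)
  case 0
  show ?case by (simp add: forest.empty)
next
  case (Suc n)
  define T0 where "T0 = (\<Union>i<n. ed i ` ({..2 * k} - {b1 i, b2 i}))"
  define T1 where "T1 = insert (ed n (2 * k)) T0"
  define T2 where "T2 = T1 \<union> (\<lambda>j. {q n j, q n (Suc j)}) ` {..<b1 n}"
  define T3 where "T3 = T2 \<union> (\<lambda>j. {q n (k - j), q n (k - Suc j)}) ` {..<k - 1 - b1 n}"
  define T4 where "T4 = T3 \<union> (\<lambda>j. {q n (k + j), q n (k + Suc j)}) ` {..<b2 n - k}"
  define T5 where "T5 = T4 \<union> (\<lambda>j. {q n (2 * k - j), q n (2 * k - Suc j)}) ` {..<2 * k - 1 - b2 n}"
  note bn = b(1)[of n] b(2)[of n]
  have T0: "x < st n" if "x \<in> \<Union> T0" for x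
  proof -
    have "T0 \<subseteq> gr n" by (auto simp: T0_def gr_def)
    then show ?thesis using that gr_less by auto
  qed
  have qT0: "q n j \<notin> \<Union> T0" if "0 < j" "j < 2 * k" for j
    using T0[of "q n j"] st_le_q[of j n] that by auto
  have fT0: "forest T0" using Suc by (simp add: T0_def)
  have U1: "\<Union> T1 \<subseteq> \<Union> T0 \<union> (if n = 0 then {q n 0, q n (2 * k)} else {tip n, q n k})"
    by (auto simp: T1_def ed_def)
  have "forest T1"
  proof (cases "n = 0")
    case True
    then have "\<Union> T0 = {}" by (simp add: T0_def)
    then have "q 0 (2 * k) \<notin> \<Union> T0" by (simp only: empty_iff not_False_eq_True)
    then show ?thesis using forest.leaf[OF fT0 _ q_ends[of 0]] True by (simp add: T1_def ed_def)
  next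
    case False
    then show ?thesis using forest.leaf[OF fT0 qT0[of k] tip_ne[of n k]] k3 by (simp add: T1_def ed_def)
  qed
  have q1: "q n j \<notin> \<Union> T1" if "0 < j" "j < 2 * k" "j \<noteq> k" for j
  proof -
    have "q n j \<notin> (if n = 0 then {q n 0, q n (2 * k)} else {tip n, q n k})"
      using that q_inj[of j 0 n] q_inj[of j "2 * k" n] q_inj[of j k n] tip_ne[of n j] by (cases "n = 0") auto
    then show ?thesis using qT0[OF that(1,2)] U1 by blast
  qed
  have qim: "q n j \<in> q n ` J \<longleftrightarrow> j \<in> J" if "j \<le> 2 * k" "J \<subseteq> {..2 * k}" for j J
    using that by (intro inj_on_image_mem_iff[OF q_inj_on]) auto
  have U2: "\<Union> T2 \<subseteq> \<Union> T1 \<union> q n ` {0..b1 n}" by (force simp: T2_def)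
  have "forest T2" unfolding T2_def
    by (rule leaf_path[OF forest.leaf \<open>forest T1\<close>])
      (use bn q1 inj_on_subset[OF q_inj_on] in auto)
  have q2: "q n j \<notin> \<Union> T2" if "b1 n < j" "j < 2 * k" "j \<noteq> k" for j
  proof -
    have "q n j \<notin> q n ` {0..b1 n}" using that bn by (subst qim) auto
    moreover have "q n j \<notin> \<Union> T1" using that by (intro q1) auto
    ultimately show ?thesis using U2 by blast
  qed
  have U3: "\<Union> T3 \<subseteq> \<Union> T2 \<union> q n ` {b1 n<..k}" by (force simp: T3_def)
  have "forest T3" unfolding T3_def
    by (rule leaf_path[OF forest.leaf \<open>forest T2\<close>])
      (use bn q2 in \<open>auto simp: inj_on_def q_inj\<close>)
  have q3: "q n j \<notin> \<Union> T3" if "k < j" "j < 2 * k" for j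
  proof -
    have "q n j \<notin> q n ` {b1 n<..k}" using that bn by (subst qim) auto
    moreover have "q n j \<notin> \<Union> T2" using that bn by (intro q2) auto
    ultimately show ?thesis using U3 by blast
  qed
  have U4: "\<Union> T4 \<subseteq> \<Union> T3 \<union> q n ` {k..b2 n}" using bn by (force simp: T4_def)
  have "forest T4" unfolding T4_def
    by (rule leaf_path[OF forest.leaf \<open>forest T3\<close>])
      (use bn q3 in \<open>auto simp: inj_on_def q_inj\<close>)
  have q4: "q n j \<notin> \<Union> T4" if "b2 n < j" "j < 2 * k" for j
  proof -
    have "q n j \<notin> q n ` {k..b2 n}" using that bn by (subst qim) auto
    moreover have "q n j \<notin> \<Union> T3" using that bn by (intro q3) auto
    ultimately show ?thesis using U4 by blast
  qed
  have "forest T5" unfolding T5_def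
    by (rule leaf_path[OF forest.leaf \<open>forest T4\<close>])
      (use bn q4 in \<open>auto simp: inj_on_def q_inj\<close>)
  moreover have "(\<Union>i<Suc n. ed i ` ({..2 * k} - {b1 i, b2 i})) \<subseteq> T5"
  proof -
    have "ed n j \<in> T5" if j: "j \<le> 2 * k" "j \<noteq> b1 n" "j \<noteq> b2 n" for j
    proof -
      consider "j = 2 * k" | "j < b1 n" | "b1 n < j" "j < k" | "k \<le> j" "j < b2 n" | "b2 n < j" "j < 2 * k"
        using j by linarith
      then show ?thesis
      proof cases
        case 1
        then show ?thesis by (auto simp: T5_def T4_def T3_def T2_def T1_def)
      next
        case 2
        then have "ed n j \<in> T2" using bn by (auto simp: T2_def ed_def)
        then show ?thesis by (auto simp: T5_def T4_def T3_def)
      next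
        case 3
        then have "ed n j = {q n (k - (k - Suc j)), q n (k - Suc (k - Suc j))}"
          by (auto simp: ed_def Suc_diff_Suc insert_commute)
        then have "ed n j \<in> T3" using 3 unfolding T3_def by (intro UnI2 image_eqI[of _ _ "k - Suc j"]) auto
        then show ?thesis by (auto simp: T5_def T4_def)
      next
        case 4
        then have "ed n j = {q n (k + (j - k)), q n (k + Suc (j - k))}" using bn by (auto simp: ed_def)
        then have "ed n j \<in> T4" using 4 unfolding T4_def by (intro UnI2 image_eqI[of _ _ "j - k"]) auto
        then show ?thesis by (auto simp: T5_def)
      next
        case 5
        then have "ed n j = {q n (2 * k - (2 * k - Suc j)), q n (2 * k - Suc (2 * k - Suc j))}"
          by (auto simp: ed_def Suc_diff_Suc insert_commute)
        then show ?thesis using 5 unfolding T5_def by (intro UnI2 image_eqI[of _ _ "2 * k - Suc j"]) auto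
      qed
    qed
    moreover have "T0 \<subseteq> T5" by (auto simp: T5_def T4_def T3_def T2_def T1_def)
    moreover have "(\<Union>i<Suc n. ed i ` ({..2 * k} - {b1 i, b2 i})) = T0 \<union> ed n ` ({..2 * k} - {b1 n, b2 n})"
      by (simp add: T0_def lessThan_Suc Un_commute)
    ultimately show ?thesis by (simp add: image_subset_iff)
  qed
  ultimately show ?case by (rule forest_subset)
qed

text \<open>Cutting one edge in every complete spoke of length \<open>k\<close> destroys all cycles.\<close>

lemma gr_dense_forest:
  assumes A: "A \<subseteq> gr n"
  shows "\<exists>T\<subseteq>A. forest T \<and> card A * (k - 1) \<le> k * card T"
proof -
  define I1 I2 where "I1 = {i. i < n \<and> (\<forall>j<k. ed i j \<in> A)}"
    and "I2 = {i. i < n \<and> (\<forall>j. k \<le> j \<and> j < 2 * k \<longrightarrow> ed i j \<in> A)}"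
  \<comment> \<open>An edge missing from \<open>A\<close> if the half has one, so that the cut costs
    nothing, and otherwise any edge of the half. Only the complete halves, recorded in
    \<open>I1\<close> and \<open>I2\<close>, lose an edge of \<open>A\<close>.\<close>
  define b1 where "b1 i = (SOME j. j < k \<and> ((\<exists>j<k. ed i j \<notin> A) \<longrightarrow> ed i j \<notin> A))" for i
  define b2 where "b2 i = (SOME j. (k \<le> j \<and> j < 2 * k) \<and> ((\<exists>j. k \<le> j \<and> j < 2 * k \<and> ed i j \<notin> A) \<longrightarrow> ed i j \<notin> A))" for i
  have "\<exists>j. j < k \<and> ((\<exists>j<k. ed i j \<notin> A) \<longrightarrow> ed i j \<notin> A)" for i
  proof (cases "\<exists>j<k. ed i j \<notin> A")
    case False
    then show ?thesis using k3 by (intro exI[of _ 0]) auto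
  qed blast
  then have b1: "b1 i < k \<and> ((\<exists>j<k. ed i j \<notin> A) \<longrightarrow> ed i (b1 i) \<notin> A)" for i unfolding b1_def by (rule someI_ex)
  have "\<exists>j. (k \<le> j \<and> j < 2 * k) \<and> ((\<exists>j. k \<le> j \<and> j < 2 * k \<and> ed i j \<notin> A) \<longrightarrow> ed i j \<notin> A)" for i
  proof (cases "\<exists>j. k \<le> j \<and> j < 2 * k \<and> ed i j \<notin> A")
    case False
    then show ?thesis using k3 by (intro exI[of _ k]) auto
  qed blast
  then have b2: "(k \<le> b2 i \<and> b2 i < 2 * k) \<and> ((\<exists>j. k \<le> j \<and> j < 2 * k \<and> ed i j \<notin> A) \<longrightarrow> ed i (b2 i) \<notin> A)" for i
    unfolding b2_def by (rule someI_ex)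
  define F where "F = (\<Union>i<n. ed i ` ({..2 * k} - {b1 i, b2 i}))"
  have "forest F" unfolding F_def by (rule forest_cut) (use b1 b2 in auto)
  then have fT: "forest (A \<inter> F)" by (rule forest_subset) auto
  have finA: "finite A" by (rule finite_subset[OF A]) (simp add: gr_def)
  have fin: "finite I1" "finite I2" by (auto simp: I1_def I2_def)
  have "A - F \<subseteq> (\<lambda>i. ed i (b1 i)) ` I1 \<union> (\<lambda>i. ed i (b2 i)) ` I2"
  proof
    fix e assume e: "e \<in> A - F"
    then obtain i j where ij: "i < n" "j \<le> 2 * k" "e = ed i j" using A by (auto simp: gr_def)
    then have "j = b1 i \<or> j = b2 i" using e by (auto simp: F_def)
    then show "e \<in> (\<lambda>i. ed i (b1 i)) ` I1 \<union> (\<lambda>i. ed i (b2 i)) ` I2"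
      using e ij b1[of i] b2[of i] by (auto simp: I1_def I2_def)
  qed
  then have "card (A - F) \<le> card ((\<lambda>i. ed i (b1 i)) ` I1 \<union> (\<lambda>i. ed i (b2 i)) ` I2)"
    using fin by (intro card_mono) auto
  also have "\<dots> \<le> card ((\<lambda>i. ed i (b1 i)) ` I1) + card ((\<lambda>i. ed i (b2 i)) ` I2)" by (rule card_Un_le)
  also have "\<dots> \<le> card I1 + card I2" using fin by (intro add_mono card_image_le)
  finally have 1: "card (A - F) \<le> card I1 + card I2" .
  \<comment> \<open>Complete halves are disjoint and have \<open>k\<close> edges each, so at most
    \<open>card A / k\<close> edges are lost.\<close>
  have "card (I1 \<times> {..<k} \<union> I2 \<times> {k..<2 * k}) \<le> card A"
  proof (rule card_inj_on_le[OF _ _ finA])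
    show "inj_on (\<lambda>(i, j). ed i j) (I1 \<times> {..<k} \<union> I2 \<times> {k..<2 * k})"
      by (rule inj_on_subset[OF ed_inj_on[of UNIV]]) auto
    show "(\<lambda>(i, j). ed i j) ` (I1 \<times> {..<k} \<union> I2 \<times> {k..<2 * k}) \<subseteq> A" by (auto simp: I1_def I2_def)
  qed
  moreover have "card (I1 \<times> {..<k} \<union> I2 \<times> {k..<2 * k}) = card I1 * k + card I2 * k"
    using fin by (subst card_Un_disjoint) auto
  ultimately have 2: "(card I1 + card I2) * k \<le> card A" by (simp add: add_mult_distrib)
  have "card A = card (A \<inter> F) + card (A - F)"
    using finA by (metis Int_Diff_Un Int_Diff_disjoint card_Un_disjoint finite_Diff finite_Int)
  then have "k * card A = k * card (A \<inter> F) + card (A - F) * k" by (simp add: algebra_simps)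
  also have "\<dots> \<le> k * card (A \<inter> F) + card A" using 1 2 by (meson add_left_mono le_trans mult_le_mono1)
  finally have "card A * (k - 1) \<le> k * card (A \<inter> F)" by (simp add: algebra_simps diff_mult_distrib2)
  then show ?thesis using fT by (intro exI[of _ "A \<inter> F"]) auto
qed

end

section \<open>Straight-line drawing of the nested graph\<close>

lemma closed_segment_affine_image:
  fixes f :: "complex \<Rightarrow> complex"
  assumes "\<And>a b u. f ((1 - u) *\<^sub>R a + u *\<^sub>R b) = (1 - u) *\<^sub>R f a + u *\<^sub>R f b"
  shows "f ` closed_segment a b = closed_segment (f a) (f b)"
proof -
  have s: "closed_segment a b = (\<lambda>u. (1 - u) *\<^sub>R a + u *\<^sub>R b) ` {0..1}" for a b :: complex
    by (auto simp: closed_segment_def)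
  show ?thesis unfolding s image_image assms ..
qed

context nested_faces
begin

text \<open>The face with corners \<open>-1\<close>, \<open>1\<close>, \<open>2 * \<i>\<close> is cut along the graph of \<open>1 - \<bar>s\<bar>\<close> on
  \<open>[-1, 1]\<close>, subdivided into \<open>2 * k\<close> equal parts, and along the segment from \<open>\<i>\<close> to \<open>2 * \<i>\<close>.
  The affine map \<open>zoom\<close> takes it to the face that is cut next.\<close>

definition loc :: "nat \<Rightarrow> complex" where
  "loc j = Complex (real j / real k - 1) (1 - \<bar>real j / real k - 1\<bar>)"

text \<open>\<open>u\<close> and \<open>v\<close> are \<open>1 - Re - Im\<close> and
  \<open>1 + Re - Im\<close> of the image, its depths below the two slopes of the cut. Their
  coefficients are forced by the images of the corners: \<open>loc (k + 1)\<close>,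
  \<open>loc (k + 2)\<close> and, for the upper corner, \<open>loc 1\<close>.\<close>

definition zoom :: "complex \<Rightarrow> complex" where
  "zoom z = (let u = (1 - 1 / real k) * Im z; v = (3 + Re z - 3 / 2 * Im z) / real k
     in Complex ((v - u) / 2) (1 - (u + v) / 2))"

definition tri :: "complex \<Rightarrow> bool" where
  "tri z \<longleftrightarrow> 0 \<le> Im z \<and> Im z \<le> 2 * (1 - \<bar>Re z\<bar>)"

lemma zoom_corners: "zoom (loc 0) = loc (k + 1)" "zoom (loc (2 * k)) = loc (k + 2)" "zoom (Complex 0 2) = loc 1"
  using k3 by (auto simp: zoom_def loc_def Let_def field_simps abs_if)

lemma zoom_affine: "zoom ((1 - u) *\<^sub>R a + u *\<^sub>R b) = (1 - u) *\<^sub>R zoom a + u *\<^sub>R zoom b"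
  using k3 by (simp add: zoom_def Let_def complex_eq_iff field_simps)

lemma zoom_pow_affine:
  "(zoom ^^ i) ((1 - u) *\<^sub>R a + u *\<^sub>R b) = (1 - u) *\<^sub>R (zoom ^^ i) a + u *\<^sub>R (zoom ^^ i) b"
  by (induction i) (simp_all add: zoom_affine)

lemma zoom_inj: "inj zoom"
proof (rule injI)
  fix z w assume e: "zoom z = zoom w"
  define f where "f z = (1 - 1 / real k) * Im z" for z
  define h where "h z = (3 + Re z - 3 / 2 * Im z) / real k" for z
  have zc: "Re (zoom z) = (h z - f z) / 2" "Im (zoom z) = 1 - (f z + h z) / 2" for z
    by (simp_all add: zoom_def Let_def f_def h_def)
  have "Re (zoom z) = Re (zoom w)" "Im (zoom z) = Im (zoom w)" using e by auto
  then have "h z - f z = h w - f w" "f z + h z = f w + h w" by (simp_all add: zc)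
  then have eq: "f z = f w" "h z = h w" by linarith+
  have "Im z = Im w" using eq(1) k3 by (simp add: f_def)
  moreover from this have "Re z = Re w" using eq(2) k3 by (simp add: h_def)
  ultimately show "z = w" by (simp add: complex_eq_iff)
qed

lemma zoom_pow_inj: "(zoom ^^ i) z = (zoom ^^ i) w \<longleftrightarrow> z = w"
  using inj_fn[OF zoom_inj, of i] by (simp add: inj_eq)

text \<open>In terms of the depths, being on the cut means \<open>u = 0\<close> or
  \<open>v = 0\<close>; the former happens only on the base of the triangle, the latter only at its
  upper corner. Strict positivity is \<open>u + v < 2\<close>, where \<open>c \<le> 1 / 3\<close>
  makes the bound largest at \<open>y = 2\<close>, with value \<open>2 - 2 * c\<close>.\<close>

lemma zoom_tri:
  assumes "tri z"
  shows "0 < Im (zoom z)" "Im (zoom z) \<le> 1 - \<bar>Re (zoom z)\<bar>"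
    "1 - \<bar>Re (zoom z)\<bar> \<le> Im (zoom z) \<Longrightarrow> Im z = 0 \<or> z = Complex 0 2"
proof -
  define c where "c = 1 / real k"
  have c: "0 < c" "c \<le> 1 / 3" using k3 by (auto simp: c_def field_simps)
  define x y where "x = Re z" and "y = Im z"
  have t: "0 \<le> y" "y \<le> 2 * (1 - \<bar>x\<bar>)" using assms by (auto simp: tri_def x_def y_def)
  define u v where "u = (1 - c) * y" and "v = c * (3 + x - 3 / 2 * y)"
  have w: "Re (zoom z) = (v - u) / 2" "Im (zoom z) = 1 - (u + v) / 2"
    by (simp_all add: zoom_def Let_def u_def v_def x_def y_def c_def)
  have s: "2 * \<bar>x\<bar> \<le> 3 + x - 3 / 2 * y" using t by (auto simp: abs_if split: if_splits)
  have u0: "0 \<le> u" using c t by (simp add: u_def)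
  have v0: "0 \<le> v" unfolding v_def using s c by (intro mult_nonneg_nonneg) auto
  have "u + v \<le> y - c * y + c * (4 - 2 * y)"
  proof -
    have "3 + x - 3 / 2 * y \<le> 4 - 2 * y" using t by (auto simp: abs_if split: if_splits)
    then have "v \<le> c * (4 - 2 * y)" unfolding v_def using c by (intro mult_left_mono) auto
    then show ?thesis by (simp add: u_def algebra_simps)
  qed
  also have "\<dots> = (1 - 3 * c) * y + 4 * c" by (simp add: algebra_simps)
  also have "\<dots> \<le> (1 - 3 * c) * 2 + 4 * c" using c t by (intro add_right_mono mult_left_mono) auto
  also have "\<dots> < 2" using c by simp
  finally show "0 < Im (zoom z)" by (simp add: w)
  show "Im (zoom z) \<le> 1 - \<bar>Re (zoom z)\<bar>" using u0 v0 by (auto simp: w abs_if field_simps)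
  assume "1 - \<bar>Re (zoom z)\<bar> \<le> Im (zoom z)"
  then have "u = 0 \<or> v = 0" using u0 v0 by (auto simp: w abs_if field_simps split: if_splits)
  then show "Im z = 0 \<or> z = Complex 0 2"
  proof
    assume "u = 0"
    then show ?thesis using c by (simp add: u_def y_def)
  next
    assume "v = 0"
    then have v: "3 + x - 3 / 2 * y = 0" using c by (simp add: v_def)
    then have "x = 0" using s by auto
    then have "y = 2" using v by simp
    then show ?thesis using \<open>x = 0\<close> by (simp add: x_def y_def complex_eq_iff)
  qed
qed

lemma tri_zoom: "tri z \<Longrightarrow> tri (zoom z)"
  using zoom_tri(1,2)[of z] by (auto simp: tri_def)

lemma tri_zoom_pow: "tri z \<Longrightarrow> tri ((zoom ^^ i) z)"
  by (induction i) (simp_all add: tri_zoom)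

text \<open>The counterpart of \<open>ed\<close> in the local coordinates of block \<open>i\<close>,
  with \<open>Complex 0 2\<close> as the place of the tip; the drawing itself is the
  \<open>i\<close>-fold \<open>zoom\<close> of it.\<close>

definition lseg :: "nat \<Rightarrow> nat \<Rightarrow> complex set" where
  "lseg i j = (if j < 2 * k then closed_segment (loc j) (loc (Suc j))
     else if i = 0 then closed_segment (loc 0) (loc (2 * k)) else closed_segment (Complex 0 2) (loc k))"

lemma lseg_path:
  assumes "z \<in> lseg i j" "j < 2 * k"
  shows "Im z = 1 - \<bar>Re z\<bar>" "real j / k - 1 \<le> Re z" "Re z \<le> real (Suc j) / k - 1"
proof -
  obtain u where u: "0 \<le> u" "u \<le> 1" "z = (1 - u) *\<^sub>R loc j + u *\<^sub>R loc (Suc j)"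
    using assms by (auto simp: lseg_def closed_segment_def)
  have k: "0 < real k" using k3 by simp
  have R: "Re z = (real j + u) / k - 1"
    using k by (simp add: u(3) loc_def field_simps)
  show "real j / k - 1 \<le> Re z" "Re z \<le> real (Suc j) / k - 1"
    using u k unfolding R by (simp_all add: divide_right_mono)
  show "Im z = 1 - \<bar>Re z\<bar>"
  proof (cases "Suc j \<le> k")
    case True
    have "loc i = Complex (real i / k - 1) (real i / k)" if "i \<le> k" for i
    proof -
      have "real i / k \<le> 1" using that k by simp
      then show ?thesis by (simp add: loc_def)
    qed
    then have "Im z = 1 + Re z" using True k by (simp add: u(3) R field_simps)
    moreover have "Re z \<le> 0"
    proof -
      have "real j + u \<le> k" using True u by linarith
      then show ?thesis using k by (simp add: R)
    qed
    ultimately show ?thesis by simp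
  next
    case False
    have "loc i = Complex (real i / k - 1) (2 - real i / k)" if "k \<le> i" for i
    proof -
      have "1 \<le> real i / k" using that k by simp
      then show ?thesis by (simp add: loc_def)
    qed
    then have "Im z = 1 - Re z" using False k by (simp add: u(3) R field_simps)
    moreover have "0 \<le> Re z"
    proof -
      have "k \<le> real j + u" using False u by linarith
      then show ?thesis using k by (simp add: R)
    qed
    ultimately show ?thesis by simp
  qed
qed

lemma lseg_spoke:
  assumes "z \<in> lseg i (2 * k)" "0 < i"
  shows "Re z = 0" "1 \<le> Im z" "Im z \<le> 2"
  using assms k3 by (auto simp: lseg_def closed_segment_def loc_def)

lemma lseg_base:
  assumes "z \<in> lseg 0 (2 * k)"
  shows "Im z = 0" "\<bar>Re z\<bar> \<le> 1"
  using assms k3 by (auto simp: lseg_def closed_segment_def loc_def abs_le_iff)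

lemma lseg_tri: "z \<in> lseg i j \<Longrightarrow> j \<le> 2 * k \<Longrightarrow> tri z"
proof -
  assume z: "z \<in> lseg i j" "j \<le> 2 * k"
  consider "j < 2 * k" | "j = 2 * k" "i = 0" | "j = 2 * k" "0 < i" using z by linarith
  then show ?thesis
  proof cases
    case 1
    have "real j / k \<ge> 0" by simp
    moreover have "real (Suc j) / k \<le> 2"
      using 1 k3 by (auto simp: field_simps simp flip: of_nat_Suc of_nat_mult)
    ultimately have "\<bar>Re z\<bar> \<le> 1" using lseg_path(2,3)[OF z(1) 1] unfolding abs_le_iff by linarith
    then show ?thesis using lseg_path[OF z(1) 1] by (simp add: tri_def)
  next
    case 2
    then show ?thesis using lseg_base z by (simp add: tri_def)
  next
    case 3
    then show ?thesis using lseg_spoke[of z i] z by (simp add: tri_def)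
  qed
qed

lemma loc_inj: "loc i = loc j \<longleftrightarrow> i = j"
  using k3 by (auto simp: loc_def)

lemma loc_lseg: "j < 2 * k \<Longrightarrow> loc j \<in> lseg i j" "j < 2 * k \<Longrightarrow> loc (Suc j) \<in> lseg i j"
  by (auto simp: lseg_def)

lemma loc_eqI: "Re z = real l / k - 1 \<Longrightarrow> Im z = 1 - \<bar>Re z\<bar> \<Longrightarrow> z = loc l"
  by (simp add: loc_def complex_eq_iff)

lemma loc_2: "Im (loc l) < 2" by (simp add: loc_def)

lemma loc_mem_ed:
  assumes "loc l \<in> lseg i j" "j \<le> 2 * k"
  shows "q i l \<in> ed i j"
proof -
  have k: "0 < real k" using k3 by simp
  consider "j < 2 * k" | "j = 2 * k" "i = 0" | "j = 2 * k" "0 < i" using assms by linarith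
  then show ?thesis
  proof cases
    case 1
    have "real j / k - 1 \<le> real l / k - 1" "real l / k - 1 \<le> real (Suc j) / k - 1"
      using lseg_path(2,3)[OF assms(1) 1] by (simp_all add: loc_def)
    then have "l = j \<or> l = Suc j" using k by (auto simp: divide_le_cancel)
    then show ?thesis using 1 by (auto simp: ed_def)
  next
    case 2
    then have "\<bar>real l / k - 1\<bar> = 1" using lseg_base[of "loc l"] assms by (simp add: loc_def)
    then have "real l / k = 0 \<or> real l / k = 2" by (auto simp: abs_if split: if_splits)
    then have "real l = 0 \<or> real l = 2 * real k" using k by (auto simp: divide_eq_eq)
    then have "l = 0 \<or> l = 2 * k" by (metis of_nat_eq_0_iff of_nat_eq_iff of_nat_mult of_nat_numeral)
    then show ?thesis using 2 by (auto simp: ed_def)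
  next
    case 3
    then have "loc l \<in> lseg i (2 * k)" using assms(1) by simp
    then have "Re (loc l) = 0" using 3(2) by (rule lseg_spoke(1))
    then have "real l / k = 1" by (simp add: loc_def)
    then have "real l = real k" using k by (simp add: divide_eq_eq)
    then have "l = k" by simp
    then show ?thesis using 3 by (auto simp: ed_def)
  qed
qed

lemma apex_mem_ed:
  assumes "Complex 0 2 \<in> lseg i j" "j \<le> 2 * k"
  shows "tip i \<in> ed i j"
proof -
  have "\<not> j < 2 * k" using lseg_path(1)[OF assms(1)] by auto
  moreover have "i \<noteq> 0" using calculation assms lseg_base[of "Complex 0 2"] by (cases i) auto
  ultimately show ?thesis by (auto simp: ed_def)
qed

text \<open>Every segment is on or above the cut, except for the base of block 0, which no zoomed
  point reaches. So by \<open>zoom_tri\<close> the point before the last zoom is on the base or is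
  the upper corner; neither is possible for a point that was itself zoomed, which leaves
  \<open>m = 0\<close>.\<close>

lemma lseg_zoom:
  assumes w: "(zoom ^^ Suc m) z \<in> lseg i j" "j \<le> 2 * k" and z: "z \<in> lseg i' j'" "j' \<le> 2 * k" "0 < i'"
  shows "m = 0 \<and> (z = loc 0 \<or> z = loc (2 * k) \<or> z = Complex 0 2)"
proof -
  define z' where "z' = (zoom ^^ m) z"
  have t: "tri z" using lseg_tri z by blast
  then have t': "tri z'" unfolding z'_def by (rule tri_zoom_pow)
  have w': "zoom z' \<in> lseg i j" using w by (simp add: z'_def)
  have "1 - \<bar>Re (zoom z')\<bar> \<le> Im (zoom z')"
  proof -
    consider "j < 2 * k" | "j = 2 * k" "i = 0" | "j = 2 * k" "0 < i" using w by linarith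
    then show ?thesis
    proof cases
      case 1 then show ?thesis using lseg_path(1)[OF w'] by simp
    next
      case 2 then show ?thesis using lseg_base(1)[of "zoom z'"] w' zoom_tri(1)[OF t'] by simp
    next
      case 3 then show ?thesis using lseg_spoke[of "zoom z'" i] w' by simp
    qed
  qed
  then have c: "Im z' = 0 \<or> z' = Complex 0 2" by (rule zoom_tri(3)[OF t'])
  have m: "m = 0"
  proof (cases m)
    case (Suc m')
    then have "z' = zoom ((zoom ^^ m') z)" by (simp add: z'_def)
    then have "0 < Im z'" "Im z' \<le> 1" using zoom_tri(1,2)[OF tri_zoom_pow[OF t, of m']] by auto
    then show ?thesis using c by auto
  qed
  then have "Im z = 0 \<or> z = Complex 0 2" using c by (simp add: z'_def)
  moreover have "z = loc 0 \<or> z = loc (2 * k) \<or> z = Complex 0 2" if "Im z = 0"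
  proof (cases "j' < 2 * k")
    case True
    then have "\<bar>Re z\<bar> = 1" using lseg_path(1)[OF z(1)] that by simp
    then have "Re z = -1 \<or> Re z = 1" by (auto simp: abs_if split: if_splits)
    then show ?thesis using that k3 by (auto simp: loc_def complex_eq_iff)
  next
    case False
    then show ?thesis using lseg_spoke[of z i'] z that by simp
  qed
  ultimately show ?thesis using m by blast
qed

text \<open>The offset 1 after \<open>mod\<close> reflects that inner vertices of a path are
  numbered from 1.\<close>

definition pos :: "nat \<Rightarrow> complex" where
  "pos v = (if v = 0 then loc 0 else if v = 1 then loc (2 * k)
     else (zoom ^^ ((v - 2) div (2 * k - 1))) (loc ((v - 2) mod (2 * k - 1) + 1)))"

lemma pos_st: "j < 2 * k - 1 \<Longrightarrow> pos (st i + j) = (zoom ^^ i) (loc (Suc j))"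
  by (simp add: pos_def st_def)

lemma pos_q: "j \<le> 2 * k \<Longrightarrow> pos (q i j) = (zoom ^^ i) (loc j)"
proof -
  assume j: "j \<le> 2 * k"
  have z: "(zoom ^^ n) (zoom z) = (zoom ^^ Suc n) z" for n z by (simp add: funpow_swap1)
  consider "j = 0" | "j = 2 * k" | "0 < j" "j < 2 * k" using j by linarith
  then show ?thesis
  proof cases
    case 1
    then show ?thesis
    proof (cases i)
      case 0 then show ?thesis using 1 by (simp add: q_def pos_def)
    next
      case (Suc n)
      then have "pos (q i j) = (zoom ^^ n) (loc (k + 1))" using 1 k3 pos_st[of k n] by (simp add: q_def)
      then show ?thesis using Suc 1 z[of n "loc 0"] by (simp add: zoom_corners(1))
    qed
  next
    case 2
    then show ?thesis
    proof (cases i)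
      case 0 then show ?thesis using 2 k3 by (simp add: q_def pos_def)
    next
      case (Suc n)
      then have "pos (q i j) = (zoom ^^ n) (loc (k + 2))" using 2 k3 pos_st[of "Suc k" n] by (simp add: q_def)
      then show ?thesis using Suc 2 z[of n "loc (2 * k)"] by (simp add: zoom_corners(2) del: add_2_eq_Suc')
    qed
  next
    case 3
    then show ?thesis using pos_st[of "j - 1" i] by (simp add: q_mid)
  qed
qed

lemma pos_tip: "0 < i \<Longrightarrow> pos (tip i) = (zoom ^^ i) (Complex 0 2)"
proof -
  assume "0 < i"
  then obtain n where n: "i = Suc n" by (cases i) auto
  have "pos (tip i) = (zoom ^^ n) (loc 1)" using n pos_st[of 0 n] k3 by (simp add: tip_def)
  also have "\<dots> = (zoom ^^ n) (zoom (Complex 0 2))" by (simp only: zoom_corners(3))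
  also have "\<dots> = (zoom ^^ i) (Complex 0 2)" by (simp add: n funpow_swap1)
  finally show ?thesis .
qed

lemma vertex_cases:
  obtains i l where "v = q i l" "l \<le> 2 * k" "i = 0 \<or> (0 < l \<and> l < 2 * k)"
proof -
  consider "v = 0" | "v = 1" | "2 \<le> v" by linarith
  then show ?thesis
  proof cases
    case 1 then show ?thesis using that[of 0 0] by (simp add: q_def)
  next
    case 2 then show ?thesis using that[of 0 "2 * k"] k3 by (simp add: q_def)
  next
    case 3
    define i l where "i = (v - 2) div (2 * k - 1)" and "l = (v - 2) mod (2 * k - 1) + 1"
    have "l - 1 < 2 * k - 1" using k3 by (simp add: l_def)
    then have l: "0 < l" "l < 2 * k" by (auto simp: l_def)
    have "v - 2 = (2 * k - 1) * i + (l - 1)" by (simp add: i_def l_def)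
    then have "v = q i l" using 3 q_mid[OF l, of i] by (simp add: st_def)
    then show ?thesis using that[of i l] l by simp
  qed
qed

lemma zoom_pow_diff: "i \<le> i' \<Longrightarrow> (zoom ^^ i) w = (zoom ^^ i') z \<Longrightarrow> w = (zoom ^^ (i' - i)) z"
proof -
  assume "i \<le> i'" "(zoom ^^ i) w = (zoom ^^ i') z"
  then have "(zoom ^^ i) w = (zoom ^^ i) ((zoom ^^ (i' - i)) z)"
    by (simp flip: funpow_add[THEN fun_cong, unfolded o_apply])
  then show ?thesis by (simp add: zoom_pow_inj)
qed

lemma loc_in_lseg: "l \<le> 2 * k \<Longrightarrow> \<exists>j<2 * k. loc l \<in> lseg i j"
  using loc_lseg(1)[of l i] loc_lseg(2)[of "2 * k - 1" i] k3
  by (cases "l = 2 * k") (auto intro: exI[of _ "2 * k - 1"] exI[of _ l])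

text \<open>Blocks meet only in the corners of the face that the inner one subdivides.\<close>

lemma segments_cross:
  assumes "i < i'" "(zoom ^^ i) w = (zoom ^^ i') z" and w: "w \<in> lseg i j" "j \<le> 2 * k"
    and z: "z \<in> lseg i' j'" "j' \<le> 2 * k"
  shows "\<exists>y. y \<in> ed i j \<and> y \<in> ed i' j' \<and> pos y = (zoom ^^ i') z \<and>
    (\<exists>l. l \<le> 2 * k \<and> w = loc l \<and> y = q i l) \<and> (\<forall>l. 0 < l \<and> l < 2 * k \<longrightarrow> z \<noteq> loc l)"
proof -
  obtain m where m: "i' - i = Suc m" using assms(1) by (metis Suc_diff_Suc)
  have wz: "w = (zoom ^^ Suc m) z" using zoom_pow_diff[of i i' w z] assms(1,2) m by simp
  have c: "m = 0 \<and> (z = loc 0 \<or> z = loc (2 * k) \<or> z = Complex 0 2)"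
    using lseg_zoom[of m z i j i' j'] w z wz assms(1) by auto
  then have i': "i' = Suc i" using m assms(1) by simp
  have wz': "w = zoom z" using wz c by simp
  have "z \<noteq> loc l" if "0 < l \<and> l < 2 * k" for l
    using c that loc_2[of l] k3 by (auto simp: loc_inj)
  moreover consider "z = loc 0" | "z = loc (2 * k)" | "z = Complex 0 2" using c by auto
  then have "\<exists>y. y \<in> ed i j \<and> y \<in> ed i' j' \<and> pos y = (zoom ^^ i') z \<and> (\<exists>l. l \<le> 2 * k \<and> w = loc l \<and> y = q i l)"
  proof cases
    case 1
    have "w = loc (k + 1)" using wz' 1 zoom_corners(1) by simp
    then show ?thesis using loc_mem_ed[of "k + 1" i j] loc_mem_ed[of 0 i' j'] w z 1 k3 pos_q[of 0 i']
      by (intro exI[of _ "q i (k + 1)"]) (auto simp: i' q_Suc intro!: exI[of _ "Suc k"])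
  next
    case 2
    have "w = loc (k + 2)" using wz' 2 zoom_corners(2) by simp
    then show ?thesis using loc_mem_ed[of "k + 2" i j] loc_mem_ed[of "2 * k" i' j'] w z 2 k3 pos_q[of "2 * k" i']
      by (intro exI[of _ "q i (k + 2)"]) (auto simp: i' q_Suc intro!: exI[of _ "k + 2"] simp del: add_2_eq_Suc')
  next
    case 3
    have "w = loc 1" using wz' 3 zoom_corners(3) by simp
    then show ?thesis using loc_mem_ed[of 1 i j] apex_mem_ed[of i' j'] w z 3 k3 pos_tip[of i']
      by (intro exI[of _ "q i 1"]) (auto simp: i' q_Suc intro!: exI[of _ "Suc 0"])
  qed
  ultimately show ?thesis by blast
qed

lemma pos_inj: "inj pos"
proof (rule injI)
  have less: False if h: "pos (q i l) = pos (q i' l')" "i < i'" "l \<le> 2 * k" "0 < l'" "l' < 2 * k" for i l i' l'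
  proof -
    obtain j where "j < 2 * k" "loc l \<in> lseg i j" using loc_in_lseg[OF h(3)] by auto
    then show False using segments_cross[of i i' "loc l" "loc l'" j l'] h loc_lseg(1)[of l' i'] pos_q[of l i] pos_q[of l' i']
      by auto
  qed
  fix u v assume e: "pos u = pos v"
  obtain i l where u: "u = q i l" "l \<le> 2 * k" "i = 0 \<or> (0 < l \<and> l < 2 * k)" by (rule vertex_cases)
  obtain i' l' where v: "v = q i' l'" "l' \<le> 2 * k" "i' = 0 \<or> (0 < l' \<and> l' < 2 * k)" by (rule vertex_cases)
  have "\<not> i < i'" using less[of i l i' l'] e u v by auto
  moreover have "\<not> i' < i" using less[of i' l' i l] e u v by auto
  ultimately have "i = i'" by simp
  then have "loc l = loc l'" using e u v by (simp add: pos_q zoom_pow_inj)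
  then show "u = v" using u v \<open>i = i'\<close> by (simp add: loc_inj)
qed

text \<open>An edge is a set without direction; \<open>Min\<close> and \<open>Max\<close> choose
  one.\<close>

definition wire :: "nat set \<Rightarrow> real \<Rightarrow> complex" where
  "wire e = linepath (pos (Min e)) (pos (Max e))"

lemma wire_ed:
  assumes "j \<le> 2 * k"
  shows "path_image (wire (ed i j)) = (zoom ^^ i) ` lseg i j"
proof -
  have two: "path_image (wire {u, w}) = closed_segment (pos u) (pos w)" for u w
    by (cases "u \<le> w") (auto simp: wire_def min_def max_def closed_segment_commute)
  show ?thesis
    using assms k3 two pos_q[of j i] pos_q[of "Suc j" i] pos_q[of 0 0] pos_q[of "2 * k" 0] pos_q[of k i] pos_tip[of i]
    by (auto simp: ed_def lseg_def closed_segment_affine_image[OF zoom_pow_affine])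
qed

lemma gr_planar: "planar (st n) (gr n)"
proof -
  have 1: "\<exists>u w. e = {u, w} \<and> arc (wire e) \<and> pathstart (wire e) = pos u \<and> pathfinish (wire e) = pos w"
    if "e \<in> gr n" for e
  proof -
    obtain i j where "e = ed i j" "j \<le> 2 * k" using \<open>e \<in> gr n\<close> by (auto simp: gr_def)
    then obtain u w where uw: "e = {u, w}" "u \<noteq> w" using ed_pair by blast
    then have mm: "e = {Min e, Max e}" "Min e \<noteq> Max e" by (cases "u \<le> w"; auto simp: min_def max_def)+
    then have "pos (Min e) \<noteq> pos (Max e)" using pos_inj by (simp add: inj_eq)
    then show ?thesis using mm(1) by (intro exI[of _ "Min e"] exI[of _ "Max e"]) (simp add: wire_def)
  qed
  have 2: "x \<in> e" if h: "e \<in> gr n" "pos x \<in> path_image (wire e)" for e x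
  proof -
    obtain i j where e: "e = ed i j" "j \<le> 2 * k" using h(1) by (auto simp: gr_def)
    obtain z where z: "z \<in> lseg i j" "pos x = (zoom ^^ i) z" using h(2) e by (auto simp: wire_ed)
    obtain i' l where x: "x = q i' l" "l \<le> 2 * k" "i' = 0 \<or> (0 < l \<and> l < 2 * k)" by (rule vertex_cases)
    \<comment> \<open>A vertex is treated as an endpoint of a path edge of its own block, so that
      \<open>segments_cross\<close> also covers vertices on edges.\<close>
    obtain j' where j': "j' < 2 * k" "loc l \<in> lseg i' j'" using loc_in_lseg[OF x(2)] by auto
    have eq: "(zoom ^^ i') (loc l) = (zoom ^^ i) z" using x z pos_q by simp
    consider "i' = i" | "i' < i" | "i < i'" by linarith
    then show ?thesis
    proof cases
      case 1
      then have "z = loc l" using eq by (simp add: zoom_pow_inj)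
      then show ?thesis using loc_mem_ed z e x 1 by simp
    next
      case 2
      then obtain y where "y \<in> ed i j" "pos y = (zoom ^^ i) z"
        using segments_cross[OF 2 eq j'(2) less_imp_le[OF j'(1)] z(1) e(2)] by blast
      then show ?thesis using z(2) pos_inj e by (metis injD)
    next
      case 3
      then have "0 < l \<and> l < 2 * k" using x(3) by auto
      then have "loc l \<noteq> loc l"
        using segments_cross[OF 3 eq[symmetric] z(1) e(2) j'(2) less_imp_le[OF j'(1)]] by blast
      then show ?thesis by simp
    qed
  qed
  have 3: "path_image (wire e) \<inter> path_image (wire e') \<subseteq> pos ` (e \<inter> e')"
    if h: "e \<in> gr n" "e' \<in> gr n" "e \<noteq> e'" for e e'
  proof
    fix p assume p: "p \<in> path_image (wire e) \<inter> path_image (wire e')"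
    obtain i j where e: "e = ed i j" "j \<le> 2 * k" using h(1) by (auto simp: gr_def)
    obtain i' j' where e': "e' = ed i' j'" "j' \<le> 2 * k" using h(2) by (auto simp: gr_def)
    obtain w where w: "w \<in> lseg i j" "p = (zoom ^^ i) w" using p e by (auto simp: wire_ed)
    obtain z where z: "z \<in> lseg i' j'" "p = (zoom ^^ i') z" using p e' by (auto simp: wire_ed)
    have eq: "(zoom ^^ i) w = (zoom ^^ i') z" using w z by simp
    \<comment> \<open>Within one block two segments meet only in path vertices: consecutive ones
      share an endpoint, the base meets the path at its ends and the upper segment meets it in the
      middle.\<close>
    have same: "\<exists>l\<le>2 * k. w = loc l" if h: "w \<in> lseg i j" "w \<in> lseg i j'" "j < j'" "j' \<le> 2 * k" for w i j j'
    proof -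
      have k: "0 < real k" using k3 by simp
      note wp = lseg_path[OF h(1) less_le_trans[OF h(3,4)]]
      consider "j' < 2 * k" | "j' = 2 * k" "i = 0" | "j' = 2 * k" "0 < i" using h by linarith
      then show ?thesis
      proof cases
        case 1
        then have "real j' / k - 1 \<le> real (Suc j) / k - 1" using lseg_path(2)[OF h(2) 1] wp(3) by linarith
        then have "j' = Suc j" using h(3) k by (simp add: divide_le_cancel)
        then have "Re w = real j' / k - 1" using lseg_path(2)[OF h(2) 1] wp(3) by simp
        then have "w = loc j'" using wp(1) by (rule loc_eqI)
        then show ?thesis using h(4) by blast
      next
        case 2
        then have "Im w = 0" using lseg_base(1) h(2) by simp
        then have "Re w = -1 \<or> Re w = 1" using wp(1) by (auto simp: abs_if split: if_splits)
        then have "w = loc 0 \<or> w = loc (2 * k)" using \<open>Im w = 0\<close> k3 by (auto simp: loc_def complex_eq_iff)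
        then show ?thesis by auto
      next
        case 3
        then have "Re w = 0" using lseg_spoke(1)[of w i] h(2) by simp
        then have "w = loc k" using wp(1) k by (intro loc_eqI) simp_all
        then show ?thesis by (intro exI[of _ k]) simp
      qed
    qed
    consider "i' = i" | "i' < i" | "i < i'" by linarith
    then show "p \<in> pos ` (e \<inter> e')"
    proof cases
      case 1
      then have wz: "w = z" using eq by (simp add: zoom_pow_inj)
      have "j \<noteq> j'" using h(3) e e' 1 by auto
      then obtain l where l: "l \<le> 2 * k" "w = loc l"
        using same[of w i j j'] same[of w i j' j] w z wz 1 e e' by (metis linorder_neqE_nat)
      then have "q i l \<in> ed i j" "q i l \<in> ed i j'" using loc_mem_ed w z wz 1 e e' by auto
      then show ?thesis using l w e e' 1 by (intro image_eqI[of _ _ "q i l"]) (simp_all add: pos_q)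
    next
      case 2
      then obtain y where "y \<in> ed i' j'" "y \<in> ed i j" "pos y = (zoom ^^ i) w"
        using segments_cross[OF 2 eq[symmetric] z(1) e'(2) w(1) e(2)] by (elim exE conjE) (rule that; assumption)
      then show ?thesis using w(2) e e' by (intro image_eqI[of _ _ y]) simp_all
    next
      case 3
      then obtain y where "y \<in> ed i j" "y \<in> ed i' j'" "pos y = (zoom ^^ i') z"
        using segments_cross[OF 3 eq w(1) e(2) z(1) e'(2)] by (elim exE conjE) (rule that; assumption)
      then show ?thesis using z(2) e e' by (intro image_eqI[of _ _ y]) simp_all
    qed
  qed
  show ?thesis unfolding planar_def
  proof (intro exI[of _ pos] exI[of _ wire] conjI ballI allI impI)
    show "inj_on pos {..<st n}" by (rule inj_on_subset[OF pos_inj subset_UNIV])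
  qed (use 1 2 3 in auto)
qed

lemma gr_maximal_planar:
  assumes "0 < n"
  shows "maximal_planar_girth (2 * k + 1) (st n) (gr n)"
  unfolding maximal_planar_girth_def
proof (intro conjI gr_planar gr_girth[OF assms])
  show "real (card (gr n)) * (real (2 * k + 1) - 2) = real (2 * k + 1) * (real (st n) - 2)"
    using k3 by (simp add: card_gr st_def of_nat_diff algebra_simps)
qed

end

section \<open>Both sides of the threshold\<close>

lemma has_cycle_image:
  assumes "has_cycle_of_length E L" "inj f" "\<And>e. e \<in> E \<Longrightarrow> f ` e \<in> E'"
  shows "has_cycle_of_length E' L"
proof -
  obtain vs where vs: "3 \<le> L" "length vs = L" "distinct vs" "\<forall>i<L. {vs ! i, vs ! ((i + 1) mod L)} \<in> E"
    using assms(1) unfolding has_cycle_of_length_def by auto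
  have "{map f vs ! i, map f vs ! ((i + 1) mod L)} \<in> E'" if i: "i < L" for i
  proof -
    have "(i + 1) mod L < L" using i by simp
    then have "{map f vs ! i, map f vs ! ((i + 1) mod L)} = f ` {vs ! i, vs ! ((i + 1) mod L)}"
      using i vs(2) by simp
    then show ?thesis using assms(3)[OF vs(4)[rule_format, OF i]] by simp
  qed
  then show ?thesis unfolding has_cycle_of_length_def
    using vs inj_on_subset[OF assms(2) subset_UNIV] by (intro conjI exI[of _ "map f vs"]) (auto simp: distinct_map)
qed

lemma planar_pull:
  assumes "planar N H" and \<sigma>: "\<sigma> permutes {..<N}"
  shows "planar N (pull N H \<sigma>)"
proof -
  from assms(1)[unfolded planar_def] obtain pos :: "nat \<Rightarrow> complex" and \<gamma> :: "nat set \<Rightarrow> real \<Rightarrow> complex" where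
    inj: "inj_on pos {..<N}" and
    \<gamma>: "\<forall>e\<in>H. \<exists>u w. e = {u, w} \<and> arc (\<gamma> e) \<and> pathstart (\<gamma> e) = pos u \<and> pathfinish (\<gamma> e) = pos w" and
    mem: "\<forall>e\<in>H. \<forall>x<N. pos x \<in> path_image (\<gamma> e) \<longrightarrow> x \<in> e" and
    cross: "\<forall>e\<in>H. \<forall>e'\<in>H. e \<noteq> e' \<longrightarrow> path_image (\<gamma> e) \<inter> path_image (\<gamma> e') \<subseteq> pos ` (e \<inter> e')"
    by (elim exE conjE)
  have i\<sigma>: "inj \<sigma>" by (rule permutes_inj[OF \<sigma>])
  have less: "\<sigma> x < N" if "x < N" for x using permutes_in_image[OF \<sigma>, of x] that by simp
  have H: "\<sigma> ` e \<in> H" if "e \<in> pull N H \<sigma>" for e using that by (simp add: pull_def)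
  show ?thesis unfolding planar_def
  proof (intro exI[of _ "pos \<circ> \<sigma>"] exI[of _ "\<lambda>e. \<gamma> (\<sigma> ` e)"] conjI ballI allI impI)
    show "inj_on (pos \<circ> \<sigma>) {..<N}"
      using inj permutes_image[OF \<sigma>] inj_on_subset[OF i\<sigma> subset_UNIV] by (intro comp_inj_on) simp_all
  next
    fix e assume e: "e \<in> pull N H \<sigma>"
    obtain u w where uw: "\<sigma> ` e = {u, w}" "arc (\<gamma> (\<sigma> ` e))" "pathstart (\<gamma> (\<sigma> ` e)) = pos u" "pathfinish (\<gamma> (\<sigma> ` e)) = pos w"
      using \<gamma>[rule_format, OF H[OF e]] by blast
    then obtain a b where ab: "a \<in> e" "b \<in> e" "u = \<sigma> a" "w = \<sigma> b" by (metis imageE insertI1 insertI2)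
    have "\<sigma> ` e = \<sigma> ` {a, b}" using uw(1) ab by simp
    then have "e = {a, b}" by (simp only: inj_image_eq_iff[OF i\<sigma>])
    then show "\<exists>u w. e = {u, w} \<and> arc (\<gamma> (\<sigma> ` e)) \<and> pathstart (\<gamma> (\<sigma> ` e)) = (pos \<circ> \<sigma>) u \<and> pathfinish (\<gamma> (\<sigma> ` e)) = (pos \<circ> \<sigma>) w"
      using uw(2-4) unfolding ab(3,4) o_apply by (intro exI[of _ a] exI[of _ b] conjI)
  next
    fix e x assume e: "e \<in> pull N H \<sigma>" and x: "x < N" "(pos \<circ> \<sigma>) x \<in> path_image (\<gamma> (\<sigma> ` e))"
    have "\<sigma> x \<in> \<sigma> ` e" using mem[rule_format, OF H[OF e] less[OF x(1)]] x(2) by simp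
    then show "x \<in> e" using inj_image_mem_iff[OF i\<sigma>] by simp
  next
    fix e e' assume e: "e \<in> pull N H \<sigma>" "e' \<in> pull N H \<sigma>" "e \<noteq> e'"
    have "\<sigma> ` e \<noteq> \<sigma> ` e'" using e(3) inj_image_eq_iff[OF i\<sigma>] by simp
    then have "path_image (\<gamma> (\<sigma> ` e)) \<inter> path_image (\<gamma> (\<sigma> ` e')) \<subseteq> pos ` (\<sigma> ` e \<inter> \<sigma> ` e')"
      using cross[rule_format, OF H[OF e(1)] H[OF e(2)]] by simp
    also have "\<dots> = (pos \<circ> \<sigma>) ` (e \<inter> e')" by (simp only: image_Int[OF i\<sigma>, symmetric] image_comp)
    finally show "path_image (\<gamma> (\<sigma> ` e)) \<inter> path_image (\<gamma> (\<sigma> ` e')) \<subseteq> (pos \<circ> \<sigma>) ` (e \<inter> e')" .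
  qed
qed

lemma pull_eq_image:
  assumes \<sigma>: "\<sigma> permutes {..<N}" and H: "H \<subseteq> all_edges N"
  shows "pull N H \<sigma> = (`) (inv \<sigma>) ` H"
proof (rule set_eqI, rule iffI)
  fix e assume "e \<in> pull N H \<sigma>"
  then show "e \<in> (`) (inv \<sigma>) ` H"
    using permutes_inj[OF \<sigma>] by (intro image_eqI[of _ _ "\<sigma> ` e"]) (simp_all add: pull_def image_inv_f_f)
next
  fix e assume "e \<in> (`) (inv \<sigma>) ` H"
  then obtain f where f: "f \<in> H" "e = inv \<sigma> ` f" by auto
  then obtain u w where uw: "f = {u, w}" "u < N" "w < N" "u \<noteq> w" using H by (auto simp: all_edges_def)
  have "inv \<sigma> u < N" "inv \<sigma> w < N"
    using uw permutes_in_image[OF permutes_inv[OF \<sigma>]] by (metis lessThan_iff)+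
  moreover have "inv \<sigma> u \<noteq> inv \<sigma> w" using uw(4) permutes_inj[OF permutes_inv[OF \<sigma>]] by (simp add: inj_eq)
  ultimately have "e \<in> all_edges N" unfolding f(2) uw(1) all_edges_def by auto
  moreover have "\<sigma> ` e = f" unfolding f(2) using permutes_surj[OF \<sigma>] by (simp add: image_f_inv_f)
  ultimately show "e \<in> pull N H \<sigma>" using f by (simp add: pull_def)
qed

lemma maximal_planar_girth_pull:
  assumes "maximal_planar_girth g N H" and \<sigma>: "\<sigma> permutes {..<N}" and H: "H \<subseteq> all_edges N"
  shows "maximal_planar_girth g N (pull N H \<sigma>)"
proof -
  have i: "inj \<sigma>" "inj (inv \<sigma>)" using permutes_inj[OF \<sigma>] permutes_inj[OF permutes_inv[OF \<sigma>]] .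
  have "has_cycle_of_length (pull N H \<sigma>) L \<longleftrightarrow> has_cycle_of_length H L" for L
  proof
    show "has_cycle_of_length H L" if "has_cycle_of_length (pull N H \<sigma>) L"
      by (rule has_cycle_image[OF that i(1)]) (simp add: pull_def)
    show "has_cycle_of_length (pull N H \<sigma>) L" if "has_cycle_of_length H L"
      by (rule has_cycle_image[OF that i(2)]) (simp add: pull_eq_image[OF \<sigma> H])
  qed
  moreover have "card (pull N H \<sigma>) = card H"
    unfolding pull_eq_image[OF \<sigma> H]
  proof (rule card_image)
    show "inj_on ((`) (inv \<sigma>)) H" by (rule inj_onI) (use inj_image_eq_iff[OF i(2)] in blast)
  qed
  ultimately show ?thesis using assms(1) planar_pull[OF _ \<sigma>]
    by (simp add: maximal_planar_girth_def has_girth_def)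
qed

lemma ex_complement: "finite S \<Longrightarrow> ex p S (\<lambda>W. of_bool (P W)) = 1 - ex p S (\<lambda>W. of_bool (\<not> P W))"
proof -
  assume S: "finite S"
  have "(\<lambda>W. of_bool (P W) + of_bool (\<not> P W)) = (\<lambda>_. 1 :: real)" by (rule ext) simp
  then have "1 = ex p S (\<lambda>W. of_bool (P W) + of_bool (\<not> P W))" using ex_const[OF S, of p 1] by simp
  then show ?thesis by (simp add: ex_add)
qed

context nested_faces
begin

text \<open>The constant \<open>exp 1 ^ 2 * \<Delta>\<close> of \<open>spread_copies\<close> with
  the degree bound of \<open>nbr_gr\<close>.\<close>

definition dmax :: real where "dmax = exp 1 ^ 2 * real (8 * k + 1)"

text \<open>Each of \<open>r\<close> rounds uses density \<open>p / r\<close>. By Bernoulli's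
  inequality their union has density at most \<open>p\<close>, and containing a copy is an
  increasing property.\<close>

lemma mpg_probability:
  assumes p: "0 < p" "p \<le> 1" and n: "0 < n" and N: "dmax \<le> real (st n)" and r: "2 \<le> r"
    and M: "2 * exp 1 \<le> M" "M ^ 2 \<le> p / r * (real (st n) / dmax) powr ((real k - 1) / real k)"
    and L: "real ((2 * k + 1) * n) < M ^ r"
  shows "1 - real r * 2 ^ r * (4 * exp 1 / M) \<le> Gnp_prob (st n) p (has_spanning_mpg (2 * k + 1) (st n))"
proof -
  define I where "I = {\<tau>. \<tau> permutes {..<st n}}"
  define S where "S = pull (st n) (gr n)"
  define X where "X = all_edges (st n)"
  define \<kappa> where "\<kappa> = (real (st n) / dmax) powr ((real k - 1) / real k)"
  have dm: "0 < dmax" by (simp add: dmax_def)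
  have fX: "finite X" by (simp add: X_def finite_all_edges)
  have sp: "spread 1 \<kappa> X I S" unfolding \<kappa>_def X_def I_def S_def dmax_def
    by (rule spread_copies[OF gr_all_edges nbr_gr])
      (use k3 gr_dense_forest N in \<open>auto simp: dmax_def\<close>)
  have p1: "0 < p / r" "p / r < 1" using p r by (auto simp: field_simps)
  have \<kappa>: "0 < \<kappa>"
  proof -
    have "0 < real (st n)" unfolding of_nat_0_less_iff by (simp add: st_def)
    then show ?thesis using dm by (simp add: \<kappa>_def)
  qed
  have cS: "card (S \<tau>) \<le> (2 * k + 1) * n" if "\<tau> \<in> I" for \<tau>
  proof -
    have "S \<tau> = (`) (inv \<tau>) ` gr n" using that pull_eq_image gr_all_edges by (simp add: S_def I_def)
    moreover have "finite (gr n)" by (simp add: gr_def)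
    ultimately show ?thesis using card_image_le[of "gr n" "(`) (inv \<tau>)"] by (simp add: card_gr)
  qed
  have fail: "ex (1 - (1 - p / r) ^ r) X (\<lambda>W. of_bool (\<not> (\<exists>\<tau>\<in>I. S \<tau> \<subseteq> W))) \<le> real r * 2 ^ r * (4 * exp 1 / M) * 1"
    by (rule spread_family_threshold[OF sp p1 \<kappa> _ cS M(1) M(2)[folded \<kappa>_def] L]) simp
  have "1 - real r * (p / r) \<le> (1 - p / r) ^ r"
    using Bernoulli_inequality[of "- (p / r)" r] p1 by simp
  then have q: "1 - (1 - p / r) ^ r \<le> p" using r by simp
  have "1 - real r * 2 ^ r * (4 * exp 1 / M) \<le> ex (1 - (1 - p / r) ^ r) X (\<lambda>W. of_bool (\<exists>\<tau>\<in>I. S \<tau> \<subseteq> W))"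
    using fail ex_complement[OF fX, of "1 - (1 - p / r) ^ r" "\<lambda>W. \<exists>\<tau>\<in>I. S \<tau> \<subseteq> W"] by linarith
  also have "\<dots> \<le> ex p X (\<lambda>W. of_bool (\<exists>\<tau>\<in>I. S \<tau> \<subseteq> W))"
  proof (rule ex_mono_prob[OF fX _ q p(2)])
    show "0 \<le> 1 - (1 - p / r) ^ r" using p1 by (simp add: power_le_one)
    show "of_bool (\<exists>\<tau>\<in>I. S \<tau> \<subseteq> W) \<le> (of_bool (\<exists>\<tau>\<in>I. S \<tau> \<subseteq> W') :: real)" if "W \<subseteq> W'" for W W'
      using that by (auto simp: of_bool_def)
  qed
  also have "\<dots> \<le> ex p X (\<lambda>W. of_bool (has_spanning_mpg (2 * k + 1) (st n) W))"
  proof (rule ex_mono)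
    fix W
    have "has_spanning_mpg (2 * k + 1) (st n) W" if "\<tau> \<in> I" "S \<tau> \<subseteq> W" for \<tau>
      unfolding has_spanning_mpg_def
      using that maximal_planar_girth_pull[OF gr_maximal_planar[OF n] _ gr_all_edges]
      by (intro exI[of _ "S \<tau>"]) (simp add: S_def I_def)
    then show "of_bool (\<exists>\<tau>\<in>I. S \<tau> \<subseteq> W) \<le> (of_bool (has_spanning_mpg (2 * k + 1) (st n) W) :: real)"
      by (auto simp: of_bool_def)
  qed (use p in auto)
  finally show ?thesis by (simp add: Gnp_prob_eq_ex X_def)
qed

lemma mpg_above_threshold:
  fixes p :: "nat \<Rightarrow> real"
  assumes p01: "\<And>n. 0 \<le> p n \<and> p n \<le> 1"
    and p: "\<forall>\<^sub>F n in at_top. ln (real n) powr (1 / real k) / real n powr ((2 * real k - 3) / (2 * real k - 1)) \<le> p n"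
  shows "(\<lambda>n. Gnp_prob (st n) (p n) (has_spanning_mpg (2 * k + 1) (st n))) \<longlonglongrightarrow> 1"
proof -
  \<comment> \<open>The surplus \<open>(k - 1) / k - (2 * k - 3) / (2 * k - 1)\<close>:
    \<open>p n\<close> times the spread parameter is at least of order
    \<open>n powr \<delta>\<close>.\<close>
  define \<delta> where "\<delta> = 1 / (real k * (2 * real k - 1))"
  \<comment> \<open>\<open>r = 8 / \<delta>\<close>. With \<open>M = n powr (\<delta> / 4)\<close>
    this gives \<open>M ^ r = n ^ 2\<close>, eventually more than the number of edges, while
    \<open>M ^ 2\<close> uses only half of the surplus and leaves
    \<open>n powr (\<delta> / 2)\<close> against the constant \<open>c\<close>.\<close>
  define r where "r = 8 * k * (2 * k - 1)"
  define M where "M n = real n powr (\<delta> / 4)" for n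
  define c where "c = 1 / (real r * dmax powr ((real k - 1) / real k))"
  define X where "X n = Gnp_prob (st n) (p n) (has_spanning_mpg (2 * k + 1) (st n))" for n
  have k: "3 \<le> real k" using k3 by simp
  have \<delta>: "0 < \<delta>" using k by (simp add: \<delta>_def)
  have r2: "2 \<le> r" using k3 by (simp add: r_def)
  have \<delta>r: "\<delta> / 4 * real r = 2"
  proof -
    define x where "x = real k * (2 * real k - 1)"
    have "real r = 8 * x" using k3 by (simp add: r_def x_def of_nat_diff)
    moreover have "x \<noteq> 0" using k by (simp add: x_def)
    ultimately show ?thesis by (simp add: \<delta>_def flip: x_def)
  qed
  have dm: "0 < dmax" by (simp add: dmax_def)
  have c: "0 < c" using dm r2 by (simp add: c_def)
  have \<delta>e: "(real k - 1) / real k - (2 * real k - 3) / (2 * real k - 1) = \<delta>"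
    using k by (simp add: \<delta>_def field_simps)
  have lim: "filterlim (\<lambda>n. real n powr a) at_top sequentially" if "0 < a" for a
  proof -
    have "filterlim (\<lambda>x :: real. exp (a * ln x)) at_top at_top"
      by (intro filterlim_compose[OF exp_at_top] filterlim_tendsto_pos_mult_at_top[OF tendsto_const that ln_at_top])
    then have "filterlim (\<lambda>n. exp (a * ln (real n))) at_top sequentially"
      by (rule filterlim_compose[OF _ filterlim_real_sequentially])
    moreover have "\<forall>\<^sub>F n in sequentially. exp (a * ln (real n)) = real n powr a"
      using eventually_gt_at_top[of 0] by eventually_elim (simp add: powr_def)
    ultimately show ?thesis by (rule filterlim_mono_eventually[OF _ order_refl order_refl])
  qed
  have "X n \<ge> 1 - real r * 2 ^ r * (4 * exp 1 / M n)"
    if n: "3 \<le> n" "dmax \<le> real n" "2 * k + 2 \<le> n" "2 * exp 1 \<le> real n powr (\<delta> / 4)" "1 / c \<le> real n powr (\<delta> / 2)"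
      and pn: "ln (real n) powr (1 / real k) / real n powr ((2 * real k - 3) / (2 * real k - 1)) \<le> p n" for n
    unfolding X_def
  proof (rule mpg_probability)
    have n0: "0 < real n" using n by simp
    have st: "real n \<le> real (st n)"
    proof -
      have "1 * n \<le> (2 * k - 1) * n" using k3 by (intro mult_le_mono1) simp
      then have "n \<le> st n" unfolding st_def by linarith
      then show ?thesis by (simp only: of_nat_le_iff)
    qed
    \<comment> \<open>From \<open>n = 3\<close> on the logarithmic factor is at least 1, so
      \<open>p n\<close> is at least the pure power of \<open>n\<close>.\<close>
    have "exp 1 \<le> real n" using n(1) exp_le by linarith
    then have "1 \<le> ln (real n)" using n0 by (simp add: ln_ge_iff)
    then have "1 \<le> ln (real n) powr (1 / real k)" by (simp add: ge_one_powr_ge_zero)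
    then have "1 / real n powr ((2 * real k - 3) / (2 * real k - 1)) \<le> ln (real n) powr (1 / real k) / real n powr ((2 * real k - 3) / (2 * real k - 1))"
      by (intro divide_right_mono) auto
    then have pn': "1 / real n powr ((2 * real k - 3) / (2 * real k - 1)) \<le> p n" using pn by linarith
    moreover have "0 < 1 / real n powr ((2 * real k - 3) / (2 * real k - 1))" using n0 by simp
    ultimately show "0 < p n" by linarith
    show "p n \<le> 1" using p01 by simp
    show "0 < n" using n by simp
    show "dmax \<le> real (st n)" using n st by linarith
    show "2 \<le> r" by (rule r2)
    show "2 * exp 1 \<le> M n" using n by (simp add: M_def)
    have "M n ^ r = real n powr (\<delta> / 4 * real r)" using n0 by (simp add: M_def powr_powr flip: powr_realpow)
    also have "\<dots> = real n ^ 2" unfolding \<delta>r using n0 by (simp add: powr_numeral)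
    finally have Mr: "M n ^ r = real n ^ 2" .
    have "(2 * k + 1) * n < n * n" using n(1,3) by (intro mult_strict_right_mono) auto
    then have "real ((2 * k + 1) * n) < real (n * n)" by (simp only: of_nat_less_iff)
    then show "real ((2 * k + 1) * n) < M n ^ r" by (simp add: Mr power2_eq_square)
    have "M n ^ 2 = real n powr (\<delta> / 2)" using n0 by (simp add: M_def powr_powr flip: powr_numeral)
    also have "\<dots> \<le> real n powr (\<delta> / 2) * (c * real n powr (\<delta> / 2))"
    proof -
      have "1 \<le> c * real n powr (\<delta> / 2)" using n(5) c by (simp add: pos_divide_le_eq mult.commute)
      then have "real n powr (\<delta> / 2) * 1 \<le> real n powr (\<delta> / 2) * (c * real n powr (\<delta> / 2))"
        by (rule mult_left_mono) simp
      then show ?thesis by simp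
    qed
    also have "\<dots> = c * real n powr \<delta>" using n0 by (simp flip: powr_add)
    also have "\<dots> = 1 / real n powr ((2 * real k - 3) / (2 * real k - 1)) / r * (real n / dmax) powr ((real k - 1) / real k)"
      unfolding \<delta>e[symmetric] c_def using n0 dm by (simp add: powr_diff powr_divide field_simps)
    also have "\<dots> \<le> p n / r * (real (st n) / dmax) powr ((real k - 1) / real k)"
      using p01[of n] pn' st dm k n0 by (intro mult_mono divide_right_mono powr_mono2) auto
    finally show "M n ^ 2 \<le> p n / r * (real (st n) / dmax) powr ((real k - 1) / real k)" .
  qed
  moreover have "\<forall>\<^sub>F n in at_top. 3 \<le> n \<and> dmax \<le> real n \<and> 2 * k + 2 \<le> n \<and> 2 * exp 1 \<le> real n powr (\<delta> / 4) \<and> 1 / c \<le> real n powr (\<delta> / 2)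
     \<and> ln (real n) powr (1 / real k) / real n powr ((2 * real k - 3) / (2 * real k - 1)) \<le> p n"
    using lim[of "\<delta> / 4"] lim[of "\<delta> / 2"] \<delta> p filterlim_real_sequentially
    by (intro eventually_conj eventually_ge_at_top) (auto simp: filterlim_at_top)
  ultimately have lower: "\<forall>\<^sub>F n in at_top. 1 - real r * 2 ^ r * (4 * exp 1 / M n) \<le> X n"
    by (auto elim!: eventually_mono)
  have "(\<lambda>n. real r * 2 ^ r * (4 * exp 1 / M n)) \<longlonglongrightarrow> real r * 2 ^ r * 0"
    using lim[of "\<delta> / 4"] \<delta> unfolding M_def
    by (intro tendsto_mult tendsto_const tendsto_divide_0[OF tendsto_const] filterlim_at_top_imp_at_infinity) auto
  then have "(\<lambda>n. 1 - real r * 2 ^ r * (4 * exp 1 / M n)) \<longlonglongrightarrow> 1 - real r * 2 ^ r * 0"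
    by (intro tendsto_diff tendsto_const)
  moreover have "X n \<le> 1" for n
  proof -
    have "X n \<le> ex (p n) (all_edges (st n)) (\<lambda>_. 1)"
      unfolding X_def Gnp_prob_eq_ex using p01 by (intro ex_mono) auto
    then show ?thesis by (simp add: ex_const finite_all_edges)
  qed
  ultimately have "X \<longlonglongrightarrow> 1"
    using lower by (intro tendsto_sandwich[OF lower _ _ tendsto_const]) auto
  then show ?thesis unfolding X_def .
qed

end

theorem theorem3:
  fixes k g :: nat
  assumes "k \<ge> 3" and "g = 2 * k + 1"
  shows "\<exists>c1 c2 :: real. c1 > 0 \<and> c2 > 0 \<and>
    (\<forall>p :: nat \<Rightarrow> real. (\<forall>n. 0 \<le> p n \<and> p n \<le> 1) \<longrightarrow>
        (\<forall>\<^sub>F n in at_top. p n \<le> (c1 / real n) powr ((real g - 2) / real g)) \<longrightarrow>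
        ((\<lambda>n. Gnp_prob ((g - 2) * n + 2) (p n) (has_spanning_mpg g ((g - 2) * n + 2)))
           \<longlonglongrightarrow> 0)) \<and>
    (\<forall>p :: nat \<Rightarrow> real. (\<forall>n. 0 \<le> p n \<and> p n \<le> 1) \<longrightarrow>
        (\<forall>\<^sub>F n in at_top. p n \<ge> c2 * ln (real n) powr (1 / real k)
                              / real n powr ((real g - 4) / (real g - 2))) \<longrightarrow>
        ((\<lambda>n. Gnp_prob ((g - 2) * n + 2) (p n) (has_spanning_mpg g ((g - 2) * n + 2)))
           \<longlonglongrightarrow> 1))"
proof -
  interpret nested_faces k by unfold_locales (rule assms(1))
  obtain c1 :: real where "0 < c1" and c1: "\<forall>p :: nat \<Rightarrow> real. (\<forall>n. 0 \<le> p n \<and> p n \<le> 1) \<longrightarrow>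
    (\<forall>\<^sub>F n in at_top. p n \<le> (c1 / real n) powr ((real g - 2) / real g)) \<longrightarrow>
    (\<lambda>n. Gnp_prob ((g - 2) * n + 2) (p n) (has_spanning_mpg g ((g - 2) * n + 2))) \<longlonglongrightarrow> 0"
    using mpg_below_threshold[of g] assms by auto
  have N: "(g - 2) * n + 2 = st n" for n using assms by (simp add: st_def)
  have g: "real g - 4 = 2 * real k - 3" "real g - 2 = 2 * real k - 1" using assms by auto
  have "(\<lambda>n. Gnp_prob ((g - 2) * n + 2) (p n) (has_spanning_mpg g ((g - 2) * n + 2))) \<longlonglongrightarrow> 1"
    if "\<forall>n. 0 \<le> p n \<and> p n \<le> 1"
      and "\<forall>\<^sub>F n in at_top. p n \<ge> 1 * ln (real n) powr (1 / real k) / real n powr ((real g - 4) / (real g - 2))"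
    for p :: "nat \<Rightarrow> real"
    using mpg_above_threshold[of p, folded assms(2)] that unfolding N g by simp
  \<comment> \<open>\<open>c2 = 1\<close> suffices because the surplus power of \<open>n\<close>
    absorbs constants.\<close>
  then show ?thesis using \<open>0 < c1\<close> c1 by (intro exI[of _ c1] exI[of _ "1::real"]) simp
qed

end
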